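(* Let $E$ be a reflexive Banach space with the approximation property, and let $\mathfrak{A}$ be a closed subalgebra of $\mathcal{B}(E)$ containing $\mathcal{K}(E)$, where $\mathcal{B}(E)$ and $\mathcal{K}(E)$ denote the bounded and the compact operators on $E$. Let $\mathcal{E}\ell(\mathfrak{A})$ be the algebra of elementary operators on $\mathfrak{A}$, equipped with the operator norm. Then the flip $$\mathcal{E}\ell(\mathfrak{A}) \to \mathcal{E}\ell(\mathfrak{A}), \qquad \Big[x \mapsto \sum_{j=1}^n a_j x b_j\Big] \mapsto \Big[x \mapsto \sum_{j=1}^n b_j x a_j\Big]$$ is continuous if and only if $\dim E < \infty$.
   Context: For an algebra $\mathfrak{A}$, a linear operator $T$ on $\mathfrak{A}$ is called elementary if there are $a_1,b_1,\dots,a_n,b_n \in \mathfrak{A}$ such that $Tx = \sum_{j=1}^n a_j x b_j$ for all $x \in \mathfrak{A}$. The set of all elementary operators on $\mathfrak{A}$ is denoted $\mathcal{E}\ell(\mathfrak{A})$; with composition as multiplication it is an algebra. If $\mathfrak{A}$ is a Banach algebra, $\mathcal{E}\ell(\mathfrak{A})$ consists of bounded operators and is normed by the operator norm of $\mathcal{B}(\mathfrak{A})$. Let $\mathfrak{A}^{\mathrm{op}}$ be $\mathfrak{A}$ with reversed multiplication. The canonical map $\mathfrak{A}\otimes\mathfrak{A}^{\mathrm{op}} \to \mathcal{E}\ell(\mathfrak{A})$ sends $\sum_j a_j\otimes b_j$ to $x\mapsto \sum_j a_j x b_j$ (algebraic tensor product). A Banach algebra $\mathfrak{A}$ is ultraprime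 if there is $C>0$ with $\sup\{\|axb\| : x\in\mathfrak{A},\ \|x\|\le 1\} \ge C\|a\|\|b\|$ for all $a,b\in\mathfrak{A}$. It is known that for ultraprime $\mathfrak{A}$ the canonical map is an algebra isomorphism, and that every closed subalgebra of $\mathcal{B}(E)$ ($E$ a Banach space) containing the finite rank operators, in particular $\mathfrak{A}$ as in the claim, is ultraprime. The flip on $\mathfrak{A}\otimes\mathfrak{A}^{\mathrm{op}}$ is the linear map determined by $a\otimes b\mapsto b\otimes a$; for ultraprime $\mathfrak{A}$ it is transported to a well-defined linear map on $\mathcal{E}\ell(\mathfrak{A})$, also called the flip. *)

theory Defs
  imports "HOL-Analysis.Analysis"
begin

text \<open>
  The scalar field is either the real or the complex numbers.  A Banach space over it is a
  (real) Banach space with a compatible multiplication by scalars of type \<open>'k\<close>.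
\<close>

class real_or_complex = real_normed_field +
  assumes real_or_complex:
    "(\<forall>z. \<exists>a. z = a *\<^sub>R 1) \<or>
     (\<exists>j. j * j = - 1 \<and> (\<forall>z. \<exists>a b. z = a *\<^sub>R 1 + b *\<^sub>R j))"

instance real :: real_or_complex
  by standard auto

instance complex :: real_or_complex
proof (standard, intro disjI2 exI[of _ \<i>] conjI allI)
  show "\<exists>a b. z = a *\<^sub>R 1 + b *\<^sub>R \<i>" for z
    by (intro exI[of _ "Re z"] exI[of _ "Im z"]) (simp add: complex_eq_iff)
qed simp

locale normed_space_over = vector_space smul
  for smul :: "'k::real_or_complex \<Rightarrow> 'e::real_normed_vector \<Rightarrow> 'e" +
  assumes norm_smul: "norm (smul c x) = norm c * norm x"
    and smul_of_real: "smul (of_real r) x = r *\<^sub>R x"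

definition finite_dim :: "('k::field \<Rightarrow> 'e::ab_group_add \<Rightarrow> 'e) \<Rightarrow> bool" where
  "finite_dim smul \<longleftrightarrow> (\<exists>B. finite B \<and> module.span smul B = UNIV)"

text \<open>
  The library type of bounded operators only asks for real linearity; linearity over the
  scalar field is imposed by passing to a subset, on which the norm is still the operator norm.
\<close>

definition bounded_ops ::
    "('k::real_or_complex \<Rightarrow> 'e::real_normed_vector \<Rightarrow> 'e) \<Rightarrow> ('e \<Rightarrow>\<^sub>L 'e) set" where
  "bounded_ops smul =
     {T. \<forall>c x. blinfun_apply T (smul c x) = smul c (blinfun_apply T x)}"

definition compact_ops ::
    "('k::real_or_complex \<Rightarrow> 'e::real_normed_vector \<Rightarrow> 'e) \<Rightarrow> ('e \<Rightarrow>\<^sub>L 'e) set" where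
  "compact_ops smul =
     {T \<in> bounded_ops smul. compact (closure (blinfun_apply T ` cball 0 1))}"

definition finite_rank_ops ::
    "('k::real_or_complex \<Rightarrow> 'e::real_normed_vector \<Rightarrow> 'e) \<Rightarrow> ('e \<Rightarrow>\<^sub>L 'e) set" where
  "finite_rank_ops smul =
     {T \<in> bounded_ops smul. \<exists>B. finite B \<and> range (blinfun_apply T) \<subseteq> module.span smul B}"

definition approximation_property ::
    "('k::real_or_complex \<Rightarrow> 'e::real_normed_vector \<Rightarrow> 'e) \<Rightarrow> bool" where
  "approximation_property smul \<longleftrightarrow>
     (\<forall>K \<epsilon>. compact K \<and> 0 < \<epsilon> \<longrightarrow>
        (\<exists>T \<in> finite_rank_ops smul. \<forall>x\<in>K. norm (blinfun_apply T x - x) < \<epsilon>))"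

definition dual ::
    "('k::real_or_complex \<Rightarrow> 'e::real_normed_vector \<Rightarrow> 'e) \<Rightarrow> ('e \<Rightarrow>\<^sub>L 'k) set" where
  "dual smul = {f. \<forall>c x. blinfun_apply f (smul c x) = c * blinfun_apply f x}"

text \<open>
  \<open>\<Phi>\<close> belongs to the bidual if it is linear and bounded on \<open>dual smul\<close>; its values elsewhere
  are irrelevant.  Linearity is stated through pointwise linear combinations of functionals.
\<close>

definition bidual_functional ::
    "('k::real_or_complex \<Rightarrow> 'e::real_normed_vector \<Rightarrow> 'e) \<Rightarrow> (('e \<Rightarrow>\<^sub>L 'k) \<Rightarrow> 'k) \<Rightarrow> bool" where
  "bidual_functional smul \<Phi> \<longleftrightarrow>
     (\<forall>f\<in>dual smul. \<forall>g\<in>dual smul. \<Phi> (f + g) = \<Phi> f + \<Phi> g) \<and>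
     (\<forall>c. \<forall>f\<in>dual smul. \<forall>g\<in>dual smul.
        (\<forall>x. blinfun_apply g x = c * blinfun_apply f x) \<longrightarrow> \<Phi> g = c * \<Phi> f) \<and>
     (\<exists>C. \<forall>f\<in>dual smul. norm (\<Phi> f) \<le> C * norm f)"

definition reflexive_space ::
    "('k::real_or_complex \<Rightarrow> 'e::real_normed_vector \<Rightarrow> 'e) \<Rightarrow> bool" where
  "reflexive_space smul \<longleftrightarrow>
     (\<forall>\<Phi>. bidual_functional smul \<Phi> \<longrightarrow>
        (\<exists>x. \<forall>f\<in>dual smul. \<Phi> f = blinfun_apply f x))"

definition smul_op ::
    "('k::real_or_complex \<Rightarrow> 'e::real_normed_vector \<Rightarrow> 'e) \<Rightarrow> 'k \<Rightarrow> ('e \<Rightarrow>\<^sub>L 'e) \<Rightarrow> ('e \<Rightarrow>\<^sub>L 'e)" where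
  "smul_op smul c T = Blinfun (\<lambda>x. smul c (blinfun_apply T x))"

lemma (in normed_space_over) smul_op_apply:
  "blinfun_apply (smul_op smul c T) x = smul c (blinfun_apply T x)"
proof -
  have "bounded_linear (\<lambda>x. smul c (blinfun_apply T x))"
  proof (rule bounded_linear_intro)
    show "smul c (blinfun_apply T (x + y)) =
        smul c (blinfun_apply T x) + smul c (blinfun_apply T y)" for x y
      by (simp add: blinfun.add_right scale_right_distrib)
    show "smul c (blinfun_apply T (r *\<^sub>R x)) = r *\<^sub>R smul c (blinfun_apply T x)" for r x
      unfolding blinfun.scaleR_right by (simp only: smul_of_real[symmetric] scale_left_commute)
    show "norm (smul c (blinfun_apply T x)) \<le> norm x * (norm c * norm T)" for x
      using mult_left_mono[OF norm_blinfun[of T x] norm_ge_zero[of c]]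
      by (simp add: norm_smul mult_ac)
  qed
  then show ?thesis
    by (simp add: smul_op_def bounded_linear_Blinfun_apply)
qed

definition subalgebra ::
    "('k::real_or_complex \<Rightarrow> 'e::real_normed_vector \<Rightarrow> 'e) \<Rightarrow> ('e \<Rightarrow>\<^sub>L 'e) set \<Rightarrow> bool" where
  "subalgebra smul A \<longleftrightarrow>
     A \<subseteq> bounded_ops smul \<and> 0 \<in> A \<and>
     (\<forall>S\<in>A. \<forall>T\<in>A. S + T \<in> A \<and> S o\<^sub>L T \<in> A) \<and>
     (\<forall>c. \<forall>T\<in>A. smul_op smul c T \<in> A)"

text \<open>
  An operator on \<open>A\<close> is a function that is \<open>undefined\<close> outside \<open>A\<close>, so that two of them are
  equal iff they agree on \<open>A\<close>.
\<close>

definition elem_op ::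
    "('e::real_normed_vector \<Rightarrow>\<^sub>L 'e) set \<Rightarrow> nat \<Rightarrow> (nat \<Rightarrow> 'e \<Rightarrow>\<^sub>L 'e) \<Rightarrow> (nat \<Rightarrow> 'e \<Rightarrow>\<^sub>L 'e)
      \<Rightarrow> ('e \<Rightarrow>\<^sub>L 'e) \<Rightarrow> ('e \<Rightarrow>\<^sub>L 'e)" where
  "elem_op A n a b = (\<lambda>x\<in>A. \<Sum>j<n. a j o\<^sub>L x o\<^sub>L b j)"

definition El ::
    "('e::real_normed_vector \<Rightarrow>\<^sub>L 'e) set \<Rightarrow> (('e \<Rightarrow>\<^sub>L 'e) \<Rightarrow> ('e \<Rightarrow>\<^sub>L 'e)) set" where
  "El A = {elem_op A n a b | n a b. \<forall>j<n. a j \<in> A \<and> b j \<in> A}"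

definition El_norm ::
    "('e::real_normed_vector \<Rightarrow>\<^sub>L 'e) set \<Rightarrow> (('e \<Rightarrow>\<^sub>L 'e) \<Rightarrow> ('e \<Rightarrow>\<^sub>L 'e)) \<Rightarrow> real" where
  "El_norm A T = (SUP x \<in> A \<inter> cball 0 1. norm (T x))"

text \<open>
  The value outside \<open>El A\<close> plays no role for the topology, but the locale \<open>Metric_space\<close>
  requires a distance to be nonnegative everywhere.
\<close>

definition El_dist ::
    "('e::real_normed_vector \<Rightarrow>\<^sub>L 'e) set \<Rightarrow> (('e \<Rightarrow>\<^sub>L 'e) \<Rightarrow> ('e \<Rightarrow>\<^sub>L 'e))
      \<Rightarrow> (('e \<Rightarrow>\<^sub>L 'e) \<Rightarrow> ('e \<Rightarrow>\<^sub>L 'e)) \<Rightarrow> real" where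
  "El_dist A S T = (if S \<in> El A \<and> T \<in> El A then El_norm A (\<lambda>x. S x - T x) else 0)"

lemma El_bounded:
  assumes "T \<in> El A"
  obtains C where "\<And>x. x \<in> A \<inter> cball 0 1 \<Longrightarrow> norm (T x) \<le> C"
proof -
  obtain n a b where T: "T = elem_op A n a b"
    using assms unfolding El_def by blast
  show thesis
  proof (rule that)
    fix x assume x: "x \<in> A \<inter> cball 0 1"
    have "norm (a j o\<^sub>L x o\<^sub>L b j) \<le> norm (a j) * norm (b j)" for j
    proof -
      have "norm (a j o\<^sub>L x o\<^sub>L b j) \<le> norm (a j o\<^sub>L x) * norm (b j)"
        by (rule norm_blinfun_compose)
      also have "\<dots> \<le> (norm (a j) * norm x) * norm (b j)"
        by (intro mult_right_mono norm_blinfun_compose norm_ge_zero)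
      also have "\<dots> \<le> (norm (a j) * 1) * norm (b j)"
        using x by (intro mult_right_mono mult_left_mono) auto
      finally show ?thesis by simp
    qed
    then show "norm (T x) \<le> (\<Sum>j<n. norm (a j) * norm (b j))"
      using x by (auto simp: T elem_op_def intro!: sum_norm_le)
  qed
qed

lemma Metric_space_El:
  assumes "normed_space_over smul" and A: "subalgebra smul A"
  shows "Metric_space (El A) (El_dist A)"
proof -
  interpret normed_space_over smul by fact
  have A0: "0 \<in> A"
    using A by (auto simp: subalgebra_def)
  have AR: "r *\<^sub>R x \<in> A" if "x \<in> A" for r x
  proof -
    have "smul_op smul (of_real r) x = r *\<^sub>R x"
      by (rule blinfun_eqI) (simp add: smul_op_apply smul_of_real scaleR_blinfun.rep_eq)
    then show ?thesis
      using A that by (metis subalgebra_def)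
  qed
  have bdd: "bdd_above ((\<lambda>x. norm (S x - T x)) ` (A \<inter> cball 0 1))"
    if ST: "S \<in> El A" "T \<in> El A" for S T
  proof -
    obtain C where "\<And>x. x \<in> A \<inter> cball 0 1 \<Longrightarrow> norm (S x) \<le> C"
      using El_bounded[OF ST(1)] by blast
    moreover obtain D where "\<And>x. x \<in> A \<inter> cball 0 1 \<Longrightarrow> norm (T x) \<le> D"
      using El_bounded[OF ST(2)] by blast
    ultimately show ?thesis
      by (intro bdd_aboveI2[where M = "C + D"]) (meson add_mono norm_triangle_le_diff)
  qed
  have upper: "norm (S x - T x) \<le> El_dist A S T"
    if "S \<in> El A" "T \<in> El A" "x \<in> A \<inter> cball 0 1" for S T x
    using cSUP_upper[OF that(3) bdd[OF that(1,2)]] that by (simp add: El_dist_def El_norm_def)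
  have zero_in: "0 \<in> A \<inter> cball 0 1"
    using A0 by simp
  show ?thesis
  proof
    show nonneg: "0 \<le> El_dist A S T" for S T
      using upper[OF _ _ zero_in, of S T] norm_ge_zero order_trans
      by (cases "S \<in> El A \<and> T \<in> El A") (blast, auto simp: El_dist_def)
    show "El_dist A S T = El_dist A T S" for S T
      by (simp add: El_dist_def El_norm_def norm_minus_commute)
    show "El_dist A S T = 0 \<longleftrightarrow> S = T" if "S \<in> El A" "T \<in> El A" for S T
    proof
      assume "El_dist A S T = 0"
      then have eq: "S x = T x" if "x \<in> A \<inter> cball 0 1" for x
        using upper[OF \<open>S \<in> El A\<close> \<open>T \<in> El A\<close> that] by simp
      have hom: "U (r *\<^sub>R x) = r *\<^sub>R U x" if "U \<in> El A" "x \<in> A" for U r x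
        using that AR[OF that(2)]
        by (auto simp: El_def elem_op_def scaleR_sum_right bounded_bilinear.scaleR_left[OF bounded_bilinear_blinfun_compose]
            bounded_bilinear.scaleR_right[OF bounded_bilinear_blinfun_compose])
      show "S = T"
      proof (rule extensionalityI[where A = A])
        show "S \<in> extensional A" "T \<in> extensional A"
          using that by (auto simp: El_def elem_op_def)
        fix x assume x: "x \<in> A"
        show "S x = T x"
        proof (cases "x = 0")
          case True
          then show ?thesis using eq A0 by simp
        next
          case False
          have "S (inverse (norm x) *\<^sub>R x) = T (inverse (norm x) *\<^sub>R x)"
            using False AR[OF x] by (intro eq) simp
          then show ?thesis
            using False x that by (simp add: hom)
        qed
      qed
    next
      assume "S = T"
      then show "El_dist A S T = 0"
        using cSUP_const[OF ex_in_conv[THEN iffD1, OF exI, OF zero_in], of "0::real"]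
        by (auto simp: El_dist_def El_norm_def)
    qed
    show "El_dist A S U \<le> El_dist A S T + El_dist A T U"
      if "S \<in> El A" "T \<in> El A" "U \<in> El A" for S T U
    proof -
      have "norm (S x - U x) \<le> El_dist A S T + El_dist A T U" if "x \<in> A \<inter> cball 0 1" for x
        using upper[of S T x] upper[of T U x] that \<open>S \<in> El A\<close> \<open>T \<in> El A\<close> \<open>U \<in> El A\<close>
          norm_diff_triangle_ineq[of "S x" "T x" "T x" "U x"]
        by (smt (verit) norm_diff_triangle_le)
      then have "(SUP x \<in> A \<inter> cball 0 1. norm (S x - U x)) \<le> El_dist A S T + El_dist A T U"
        using zero_in by (intro cSUP_least) auto
      then show ?thesis
        using that by (simp add: El_dist_def[of A S U] El_norm_def)
    qed
  qed
qed

definition El_topology ::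
    "('e::real_normed_vector \<Rightarrow>\<^sub>L 'e) set \<Rightarrow> (('e \<Rightarrow>\<^sub>L 'e) \<Rightarrow> ('e \<Rightarrow>\<^sub>L 'e)) topology" where
  "El_topology A = Metric_space.mtopology (El A) (El_dist A)"

text \<open>
  The description is definite because for ultraprime \<open>A\<close> the canonical map from the tensor
  product onto \<open>El A\<close> is injective: the flipped operator does not depend on the representation.
\<close>

definition El_flip ::
    "('e::real_normed_vector \<Rightarrow>\<^sub>L 'e) set
      \<Rightarrow> (('e \<Rightarrow>\<^sub>L 'e) \<Rightarrow> ('e \<Rightarrow>\<^sub>L 'e)) \<Rightarrow> (('e \<Rightarrow>\<^sub>L 'e) \<Rightarrow> ('e \<Rightarrow>\<^sub>L 'e))" where
  "El_flip A T = (THE S. \<exists>n a b. (\<forall>j<n. a j \<in> A \<and> b j \<in> A) \<and>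
                        T = elem_op A n a b \<and> S = elem_op A n b a)"

end

theory Submission
  imports Defs
begin

text \<open>
  For finite-dimensional \<open>E\<close> the matrix entries of the flip of \<open>T\<close> are traces of values of \<open>T\<close>
  at operators of rank one, so the flip is Lipschitz.

  Conversely, the flip maps \<open>x \<mapsto> f\<^sub>0 (x e) F\<close>, where \<open>F = \<Sum>u\<^sub>j \<otimes> f\<^sub>j\<close>, to
  \<open>x \<mapsto> (\<Sum>f\<^sub>j (x u\<^sub>j)) e \<otimes> f\<^sub>0\<close>; if it is continuous, then
  \<open>\<bar>tr (x F)\<bar> \<le> C \<parallel>x\<parallel> \<parallel>F\<parallel>\<close> for operators of finite rank.  In a separable reflexive space
  every bounded functional on the compact operators is a norm limit of elementary ones,
  \<open>x \<mapsto> \<Sum>f\<^sub>j (x u\<^sub>j)\<close>: compact operators attain their norm, so Simons' inequality applies.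
  Thus \<open>x \<mapsto> tr (x F)\<close> is given by a nuclear series with sum of norms \<open>O(\<parallel>F\<parallel>)\<close>, and by the approximation
  property the trace itself is bounded by a multiple of the operator norm.  Approximating now the
  trace by an elementary functional shows that the identity is a norm limit of operators of finite
  rank.  A projection of norm one onto a separable subspace reduces the general case to this one.
\<close>

section \<open>Sublinear functionals and the Hahn-Banach theorem\<close>

text \<open>The norm of \<open>x \<mapsto> f0 (x e) F\<close> is at most a multiple of the operator
  norm of \<open>F\<close>, whereas its flip measures the trace functional
  \<open>x \<mapsto> tr (x F)\<close>, in spirit the nuclear norm of \<open>F\<close>. Continuity of
  the flip makes these two norms comparable. If \<open>A\<close> contained the identity, a bound of
  the trace by the operator norm would be immediate; but \<open>A\<close> may consist of compact
  operators only, and a bound over such \<open>x\<close> says nothing directly about the identity. A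
  nuclear series with controlled sum of norms bridges this gap, since its vectors fit into a compact
  set, where the approximation property acts. Separability is forced by a diagonal choice: a single
  sequence of operators has to test a norm-dense family of elementary functionals, so the space and
  its dual both need countable dense sets.\<close>

definition sublinear :: "('a::real_vector \<Rightarrow> real) \<Rightarrow> bool" where
  "sublinear p \<longleftrightarrow> (\<forall>x y. p (x + y) \<le> p x + p y) \<and> (\<forall>r x. 0 \<le> r \<longrightarrow> p (r *\<^sub>R x) = r * p x)"

lemma sublinear_add: "sublinear p \<Longrightarrow> p (x + y) \<le> p x + p y"
  by (simp add: sublinear_def)

lemma sublinear_scale: "sublinear p \<Longrightarrow> 0 \<le> r \<Longrightarrow> p (r *\<^sub>R x) = r * p x"
  by (simp add: sublinear_def)

lemma sublinear_zero: "sublinear p \<Longrightarrow> p 0 = 0"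
  using sublinear_scale[of p 0 0] by simp

lemma sublinear_minus: "sublinear p \<Longrightarrow> - p (- x) \<le> p x"
  using sublinear_add[of p x "- x"] sublinear_zero[of p] by simp

lemma sublinearI:
  assumes add: "\<And>x y. p (x + y) \<le> p x + p y"
    and scale: "\<And>r x. 0 < r \<Longrightarrow> p (r *\<^sub>R x) \<le> r * p x" and zero: "p 0 = 0"
  shows "sublinear p"
proof -
  have "p (r *\<^sub>R x) = r * p x" if "0 \<le> r" for r x
  proof (cases "r = 0")
    case False
    then have r: "0 < r" using that by simp
    have "p (inverse r *\<^sub>R (r *\<^sub>R x)) \<le> inverse r * p (r *\<^sub>R x)"
      using r by (intro scale) simp
    then have "r * p x \<le> p (r *\<^sub>R x)"
      using r by (simp add: field_simps)
    then show ?thesis using scale[OF r, of x] by simp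
  qed (simp add: zero)
  then show ?thesis by (simp add: sublinear_def add)
qed

text \<open>The infimum of \<open>p (x + c) - g c\<close> over the cone \<open>C\<close> is finite
  because \<open>g \<le> p\<close> there, and every linear functional below \<open>q\<close>
  dominates \<open>g\<close> on \<open>C\<close>. It is used with a subspace carrying the functional
  to be extended, and with a single ray to exploit minimality.\<close>

lemma sublinear_inf_convolution:
  fixes p :: "'a::real_vector \<Rightarrow> real"
  assumes p: "sublinear p" and C0: "0 \<in> C"
    and Cadd: "\<And>c d. c \<in> C \<Longrightarrow> d \<in> C \<Longrightarrow> c + d \<in> C \<and> g (c + d) = g c + g d"
    and Cscale: "\<And>r c. 0 \<le> r \<Longrightarrow> c \<in> C \<Longrightarrow> r *\<^sub>R c \<in> C \<and> g (r *\<^sub>R c) = r * g c"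
    and gp: "\<And>c. c \<in> C \<Longrightarrow> g c \<le> p c"
  obtains q where "sublinear q" "\<And>x c. c \<in> C \<Longrightarrow> q x \<le> p (x + c) - g c" "\<And>x. q x \<le> p x"
proof -
  define q where "q x = (INF c\<in>C. p (x + c) - g c)" for x
  have g0: "g 0 = 0" using Cscale[of 0 0] C0 by simp
  have lower: "- p (- x) \<le> p (x + c) - g c" if "c \<in> C" for x c
    using sublinear_add[OF p, of "x + c" "- x"] gp[OF that] by simp
  have bdd: "bdd_below ((\<lambda>c. p (x + c) - g c) ` C)" for x
    using lower by (intro bdd_belowI2) blast
  have up: "q x \<le> p (x + c) - g c" if "c \<in> C" for x c
    unfolding q_def using that by (intro cINF_lower[OF bdd])
  have qp: "q x \<le> p x" for x
    using up[OF C0, of x] g0 by simp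
  have ne: "C \<noteq> {}" using C0 by auto
  have least: "a \<le> q x" if "\<And>c. c \<in> C \<Longrightarrow> a \<le> p (x + c) - g c" for a x
    unfolding q_def using that by (intro cINF_greatest[OF ne])
  have "sublinear q"
  proof (rule sublinearI)
    fix x y
    have "q (x + y) - (p (y + d) - g d) \<le> q x" if d: "d \<in> C" for d
    proof (rule least)
      fix c assume c: "c \<in> C"
      have "q (x + y) \<le> p ((x + y) + (c + d)) - g (c + d)"
        using Cadd[OF c d] by (intro up) simp
      also have "\<dots> \<le> p (x + c) - g c + (p (y + d) - g d)"
        using Cadd[OF c d] sublinear_add[OF p, of "x + c" "y + d"] by (simp add: algebra_simps)
      finally show "q (x + y) - (p (y + d) - g d) \<le> p (x + c) - g c" by simp
    qed
    then have "q (x + y) - q x \<le> q y"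
      by (intro least) (simp add: algebra_simps)
    then show "q (x + y) \<le> q x + q y" by simp
  next
    fix r :: real and x assume r: "0 < r"
    have "q (r *\<^sub>R x) / r \<le> q x"
    proof (rule least)
      fix c assume c: "c \<in> C"
      have "q (r *\<^sub>R x) \<le> p (r *\<^sub>R x + r *\<^sub>R c) - g (r *\<^sub>R c)"
        using Cscale[of r c] r c by (intro up) simp
      also have "\<dots> = r * (p (x + c) - g c)"
        using Cscale[of r c] r c sublinear_scale[OF p, of r "x + c"] by (simp add: algebra_simps)
      finally show "q (r *\<^sub>R x) / r \<le> p (x + c) - g c"
        using r by (simp add: field_simps)
    qed
    then show "q (r *\<^sub>R x) \<le> r * q x" using r by (simp add: field_simps)
  next
    have "0 \<le> q 0" by (rule least) (simp add: gp)
    then show "q 0 = 0" using qp[of 0] sublinear_zero[OF p] by simp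
  qed
  then show thesis using that up qp by blast
qed

text \<open>Zorn's lemma. The infimum of a chain is finite since \<open>q \<le> p\<close> implies
  \<open>- p (- x) \<le> q x\<close>, and it is subadditive since the smaller of two members of the
  chain serves at both \<open>x\<close> and \<open>y\<close>.\<close>

lemma exists_minimal_sublinear:
  fixes p :: "'a::real_vector \<Rightarrow> real"
  assumes p: "sublinear p"
  obtains m where "sublinear m" "m \<le> p" "\<And>q. sublinear q \<Longrightarrow> q \<le> m \<Longrightarrow> q = m"
proof -
  define A where "A = {q. sublinear q \<and> q \<le> p}"
  have pA: "p \<in> A" using p by (simp add: A_def)
  have po: "partial_order_on A (relation_of (\<ge>) A)"
    by (rule partial_order_on_relation_ofI) auto
  have "\<exists>m\<in>A. \<forall>q\<in>A. m \<ge> q \<longrightarrow> q = m"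
  proof (rule predicate_Zorn[OF po])
    fix C assume C: "C \<in> Chains (relation_of (\<ge>) A)"
    show "\<exists>u\<in>A. \<forall>q\<in>C. q \<ge> u"
    proof (cases "C = {}")
      case True
      then show ?thesis using pA by blast
    next
      case False
      have CA: "sublinear q" "q \<le> p" if "q \<in> C" for q
        using Chains_relation_of[OF C] that by (auto simp: A_def)
      have tot: "q \<le> r \<or> r \<le> q" if "q \<in> C" "r \<in> C" for q r
        using C that by (auto simp: Chains_def relation_of_def)
      define u where "u x = (INF q\<in>C. q x)" for x
      have "- p (- x) \<le> q x" if "q \<in> C" for q x
        using sublinear_minus[OF CA(1)[OF that], of x] le_funD[OF CA(2)[OF that], of "- x"]
        by linarith
      then have bdd: "bdd_below ((\<lambda>q. q x) ` C)" for x
        by (intro bdd_belowI2) blast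
      have up: "u x \<le> q x" if "q \<in> C" for q x
        unfolding u_def using that by (intro cINF_lower[OF bdd])
      have least: "a \<le> u x" if "\<And>q. q \<in> C \<Longrightarrow> a \<le> q x" for a x
        unfolding u_def using that by (intro cINF_greatest[OF False])
      have "sublinear u"
      proof (rule sublinearI)
        fix x y
        have "u (x + y) - r y \<le> u x" if r: "r \<in> C" for r
        proof (rule least)
          fix q assume q: "q \<in> C"
          obtain s where s: "s \<in> C" "s \<le> q" "s \<le> r" using tot[OF q r] q r by blast
          have "u (x + y) \<le> s x + s y"
            using up[OF s(1)] sublinear_add[OF CA(1)[OF s(1)]] order_trans by blast
          also have "\<dots> \<le> q x + r y" using s(2,3) by (intro add_mono) (auto dest: le_funD)
          finally show "u (x + y) - r y \<le> q x" by simp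
        qed
        then have "u (x + y) - u x \<le> u y"
          by (intro least) (simp add: algebra_simps)
        then show "u (x + y) \<le> u x + u y" by simp
      next
        fix r :: real and x assume r: "0 < r"
        have "u (r *\<^sub>R x) / r \<le> u x"
          using r up sublinear_scale[OF CA(1), of _ r x]
          by (intro least) (auto simp: field_simps)
        then show "u (r *\<^sub>R x) \<le> r * u x" using r by (simp add: field_simps)
      next
        obtain q where "q \<in> C" using False by auto
        then have "u 0 \<le> 0" using up[of q 0] sublinear_zero[OF CA(1), of q] by simp
        moreover have "0 \<le> u 0" by (rule least) (simp add: sublinear_zero[OF CA(1)])
        ultimately show "u 0 = 0" by simp
      qed
      moreover have "u \<le> p" 
      proof -
        obtain q where "q \<in> C" using False by auto
        then show ?thesis using up[of q] le_funD[OF CA(2)[of q]] by (intro le_funI) (blast intro: order_trans)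
      qed
      ultimately have "u \<in> A" by (simp add: A_def)
      then show ?thesis using up by (auto simp: le_fun_def)
    qed
  qed
  then obtain m where m: "m \<in> A" "\<And>q. q \<in> A \<Longrightarrow> q \<le> m \<Longrightarrow> q = m" by blast
  show thesis
  proof (rule that)
    show "sublinear m" "m \<le> p" using m(1) by (auto simp: A_def)
    fix q assume q: "sublinear q" "q \<le> m"
    have "q \<in> A" using q \<open>m \<le> p\<close> unfolding A_def by (blast intro: order_trans)
    then show "q = m" using q(2) by (rule m(2))
  qed
qed

text \<open>A minimal sublinear functional is automatically linear, so minimality replaces the
  extension by one dimension at a time. The convolution \<open>q\<close> builds in the values on
  \<open>W\<close> beforehand.\<close>

theorem Hahn_Banach_sublinear:
  fixes p :: "'a::real_vector \<Rightarrow> real"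
  assumes p: "sublinear p" and W: "subspace W"
    and gadd: "\<And>x y. x \<in> W \<Longrightarrow> y \<in> W \<Longrightarrow> g (x + y) = g x + g y"
    and gscale: "\<And>r x. x \<in> W \<Longrightarrow> g (r *\<^sub>R x) = r * g x"
    and gp: "\<And>x. x \<in> W \<Longrightarrow> g x \<le> p x"
  obtains h where "linear h" "\<And>x. h x \<le> p x" "\<And>x. x \<in> W \<Longrightarrow> h x = g x"
proof -
  obtain q where q: "sublinear q" "\<And>x c. c \<in> W \<Longrightarrow> q x \<le> p (x + c) - g c" "\<And>x. q x \<le> p x"
  proof (rule sublinear_inf_convolution[OF p, of W g])
    show "0 \<in> W" by (rule subspace_0[OF W])
  qed (use gadd gscale gp subspace_add[OF W] subspace_scale[OF W] in auto)
  obtain m where m: "sublinear m" "m \<le> q" and min: "\<And>q. sublinear q \<Longrightarrow> q \<le> m \<Longrightarrow> q = m"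
    using exists_minimal_sublinear[OF q(1)] by blast
  \<comment> \<open>Convolution with the ray through \<open>y\<close> gives a sublinear
    \<open>m'\<close> below \<open>m\<close>. By minimality \<open>m' = m\<close>, and the bound for
    \<open>m'\<close> at \<open>c = y\<close> is the claim.\<close>
  have ge: "m x + m y \<le> m (x + y)" for x y
  proof -
    define C where "C = {t *\<^sub>R y | t. 0 \<le> t}"
    obtain m' where m': "sublinear m'" "\<And>x c. c \<in> C \<Longrightarrow> m' x \<le> m (x + c) - m c" "\<And>x. m' x \<le> m x"
    proof (rule sublinear_inf_convolution[OF m(1), of C m])
      show "0 \<in> C" unfolding C_def by (intro CollectI exI[of _ 0]) simp
      show "c + d \<in> C \<and> m (c + d) = m c + m d" if cd: "c \<in> C" "d \<in> C" for c d
      proof -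
        obtain s t where st: "0 \<le> s" "0 \<le> t" "c = s *\<^sub>R y" "d = t *\<^sub>R y"
          using cd by (auto simp: C_def)
        then show ?thesis
          using sublinear_scale[OF m(1), of _ y] add_nonneg_nonneg[OF st(1,2)]
          by (auto simp: C_def scaleR_add_left[symmetric] distrib_right)
      qed
      show "r *\<^sub>R c \<in> C \<and> m (r *\<^sub>R c) = r * m c" if rc: "0 \<le> r" "c \<in> C" for r c
      proof -
        obtain s where s: "0 \<le> s" "c = s *\<^sub>R y"
          using rc by (auto simp: C_def)
        then have "r *\<^sub>R c = (r * s) *\<^sub>R y" "0 \<le> r * s" using rc by auto
        then have "r *\<^sub>R c \<in> C" unfolding C_def by blast
        then show ?thesis by (simp add: sublinear_scale[OF m(1) rc(1)])
      qed
    qed auto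
    have "m' = m" using m'(3) by (intro min m') (simp add: le_fun_def)
    moreover have "y \<in> C" unfolding C_def by (intro CollectI exI[of _ 1]) simp
    ultimately show ?thesis using m'(2)[of y x] by simp
  qed
  have add: "m (x + y) = m x + m y" for x y
    by (rule order_antisym[OF sublinear_add[OF m(1)] ge])
  have neg: "m (- x) = - m x" for x
    using add[of x "- x"] sublinear_zero[OF m(1)] by simp
  have "linear m"
  proof (rule linearI)
    show "m (r *\<^sub>R x) = r *\<^sub>R m x" for r x
    proof (cases "0 \<le> r")
      case False
      then have "m ((- r) *\<^sub>R x) = - r * m x" by (intro sublinear_scale[OF m(1)]) simp
      then show ?thesis using neg[of "r *\<^sub>R x"] by simp
    qed (simp add: sublinear_scale[OF m(1)])
  qed (rule add)
  moreover have "m x \<le> p x" for x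
    using le_funD[OF m(2), of x] q(3)[of x] by linarith
  moreover have "m x = g x" if x: "x \<in> W" for x
  proof -
    have le: "m y \<le> g y" if "y \<in> W" for y
    proof -
      have "q y \<le> p (y + (- y)) - g (- y)"
        using that subspace_neg[OF W that] by (intro q)
      then have "q y \<le> g y" using gscale[OF that, of "-1"] sublinear_zero[OF p] by simp
      then show ?thesis using le_funD[OF m(2), of y] by linarith
    qed
    have "m (- x) \<le> g (- x)" using subspace_neg[OF W x] by (rule le)
    then show ?thesis using le[OF x] neg[of x] gscale[OF x, of "-1"] by simp
  qed
  ultimately show thesis using that by blast
qed

text \<open>
  A negative value of \<open>a\<close> at \<open>x\<close> bounds \<open>t\<close> from above and a negative value of \<open>b\<close> at \<open>y\<close>
  bounds it from below; were the bounds incompatible, \<open>a\<close> and \<open>b\<close> would both be negative at a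
  positive combination of \<open>x\<close> and \<open>y\<close>.
\<close>

lemma max_sublinear_nonneg:
  fixes a b :: "'a::real_vector \<Rightarrow> real"
  assumes W: "subspace W" and a: "sublinear a" and b: "sublinear b"
    and nn: "\<And>x. x \<in> W \<Longrightarrow> 0 \<le> max (a x) (b x)"
  obtains t where "0 \<le> t" "t \<le> 1" "\<And>x. x \<in> W \<Longrightarrow> 0 \<le> t * a x + (1 - t) * b x"
proof -
  have key: "b y * a x \<le> b x * a y" if x: "x \<in> W" "a x < 0" and y: "y \<in> W" "b y < 0" for x y
  proof (rule ccontr)
    assume neg: "\<not> ?thesis"
    have bx: "0 \<le> b x" and ay: "0 \<le> a y" using nn[OF x(1)] nn[OF y(1)] x y by auto
    \<comment> \<open>The slack \<open>d\<close> makes \<open>a z\<close> strictly negative and must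
      leave \<open>b z\<close> negative too, so \<open>b x * d\<close> has to stay below the gap;
      the \<open>+ 1\<close> covers \<open>b x = 0\<close>.\<close>
    define d where "d = (b y * a x - b x * a y) / (b x + 1)"
    have d: "0 < d" using neg bx by (simp add: d_def)
    have "b x * d < b y * a x - b x * a y"
    proof -
      have "b x * d < (b x + 1) * d" using d by (simp add: algebra_simps)
      also have "\<dots> = b y * a x - b x * a y" using bx by (simp add: d_def)
      finally show ?thesis .
    qed
    define z where "z = (a y + d) *\<^sub>R x + (- a x) *\<^sub>R y"
    have zW: "z \<in> W" unfolding z_def using W x y by (intro subspace_add subspace_scale)
    have "a z \<le> (a y + d) * a x + (- a x) * a y"
      using sublinear_add[OF a, of "(a y + d) *\<^sub>R x" "(- a x) *\<^sub>R y"]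
        sublinear_scale[OF a, of "a y + d" x] sublinear_scale[OF a, of "- a x" y] ay d x
      by (simp add: z_def)
    also have "\<dots> = d * a x" by (simp add: algebra_simps)
    also have "\<dots> < 0" using d x by (simp add: mult_pos_neg)
    finally have "a z < 0" .
    moreover have "b z \<le> (a y + d) * b x + (- a x) * b y"
      using sublinear_add[OF b, of "(a y + d) *\<^sub>R x" "(- a x) *\<^sub>R y"]
        sublinear_scale[OF b, of "a y + d" x] sublinear_scale[OF b, of "- a x" y] ay d x
      by (simp add: z_def)
    then have "b z < 0" using \<open>b x * d < _\<close> by (simp add: algebra_simps)
    ultimately show False using nn[OF zW] by simp
  qed
  \<comment> \<open>This is \<open>0 \<le> t * a y + (1 - t) * b y\<close> solved for
    \<open>t\<close>. The element \<open>0\<close> of \<open>T\<close> keeps the supremum meaningful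
    and nonnegative when no such \<open>y\<close> exists.\<close>
  define lo where "lo y = - b y / (a y - b y)" for y
  define T where "T = insert 0 (lo ` {y \<in> W. b y < 0})"
  have lo1: "lo y \<le> 1" if "y \<in> W" "b y < 0" for y
    using nn[OF that(1)] that by (simp add: lo_def field_simps)
  have bdd: "bdd_above T" using lo1 by (auto simp: T_def intro!: bdd_aboveI[of _ 1])
  define t where "t = Sup T"
  have t0: "0 \<le> t" unfolding t_def using bdd by (intro cSup_upper) (auto simp: T_def)
  have t1: "t \<le> 1" unfolding t_def using lo1 by (intro cSup_least) (auto simp: T_def)
  show thesis
  proof (rule that[OF t0 t1])
    fix x assume x: "x \<in> W"
    consider "0 \<le> a x" "0 \<le> b x" | "b x < 0" | "a x < 0" by linarith
    then show "0 \<le> t * a x + (1 - t) * b x"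
    proof cases
      case 1
      then show ?thesis using t0 t1 by simp
    next
      case 2
      then have pos: "0 < a x - b x" using nn[OF x] by simp
      have "lo x \<le> t" unfolding t_def using bdd x 2 by (intro cSup_upper) (auto simp: T_def)
      then have "- b x \<le> t * (a x - b x)" using pos by (simp add: lo_def field_simps)
      then show ?thesis by (simp add: algebra_simps)
    next
      case 3
      have bx: "0 \<le> b x" using nn[OF x] 3 by simp
      have "t \<le> b x / (b x - a x)"
        unfolding t_def
      proof (rule cSup_least)
        fix s assume "s \<in> T"
        then consider "s = 0" | y where "y \<in> W" "b y < 0" "s = lo y" by (auto simp: T_def)
        then show "s \<le> b x / (b x - a x)"
        proof cases
          case (2 y)
          have ay: "0 \<le> a y" using nn[OF 2(1)] 2 by simp
          have div: "p / D \<le> q / D'" if "0 < D" "0 < D'" "p * D' \<le> q * D" for p q D D' :: real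
            using that by (simp add: field_simps)
          have "0 < a y - b y" "0 < b x - a x" using 2 3 ay bx by linarith+
          moreover have "- b y * (b x - a x) \<le> b x * (a y - b y)"
            using key[OF x 3 2(1,2)] by (simp add: algebra_simps)
          ultimately show ?thesis
            unfolding 2(3) lo_def by (rule div)
        qed (use 3 bx in simp)
      qed (simp add: T_def)
      then have "t * (b x - a x) \<le> b x" using 3 bx by (simp add: field_simps)
      then show ?thesis by (simp add: algebra_simps)
    qed
  qed
qed

lemma sublinear_max: 
  assumes "sublinear a" "sublinear b"
  shows "sublinear (\<lambda>x. max (a x) (b x))"
proof (rule sublinearI)
  show "max (a (x + y)) (b (x + y)) \<le> max (a x) (b x) + max (a y) (b y)" for x y
    using sublinear_add[OF assms(1), of x y] sublinear_add[OF assms(2), of x y] by linarith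
  show "max (a (r *\<^sub>R x)) (b (r *\<^sub>R x)) \<le> r * max (a x) (b x)" if "0 < r" for r x
    using that by (simp add: sublinear_scale[OF assms(1)] sublinear_scale[OF assms(2)])
qed (simp add: sublinear_zero assms)

lemma sublinear_comb: 
  assumes "sublinear a" "sublinear b" "0 \<le> s" "0 \<le> t"
  shows "sublinear (\<lambda>x. s * a x + t * b x)"
proof (rule sublinearI)
  show "s * a (x + y) + t * b (x + y) \<le> s * a x + t * b x + (s * a y + t * b y)" for x y
    using mult_left_mono[OF sublinear_add[OF assms(1), of x y] assms(3)]
     mult_left_mono[OF sublinear_add[OF assms(2), of x y] assms(4)] by (simp add: algebra_simps)
  show "s * a (r *\<^sub>R x) + t * b (r *\<^sub>R x) \<le> r * (s * a x + t * b x)" if "0 < r" for r x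
    using that by (simp add: sublinear_scale[OF assms(1)] sublinear_scale[OF assms(2)] algebra_simps)
qed (simp add: sublinear_zero assms)

text \<open>A finite minimax principle, by induction: the case of two functionals is applied to the
  maximum of the first ones and to the last one, and the resulting share of the last one is mixed
  into each of the others.\<close>

lemma exists_convex_comb_nonneg:
  fixes a :: "nat \<Rightarrow> 'a::real_vector \<Rightarrow> real"
  assumes W: "subspace W" and sub: "\<And>i. i \<le> n \<Longrightarrow> sublinear (a i)"
    and nn: "\<And>x. x \<in> W \<Longrightarrow> \<exists>i\<le>n. 0 \<le> a i x"
  shows "\<exists>l. (\<forall>i. 0 \<le> l i) \<and> (\<Sum>i\<le>n. l i) = 1 \<and> (\<forall>x\<in>W. 0 \<le> (\<Sum>i\<le>n. l i * a i x))"
  using sub nn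
proof (induction n arbitrary: a)
  case 0
  then show ?case by (intro exI[of _ "\<lambda>_. 1"]) auto
next
  case (Suc n)
  define M where "M x = (MAX i\<in>{..n}. a i x)" for x
  note sub = Suc.prems(1)
  have M_max: "sublinear (\<lambda>x. MAX i\<in>{..k}. a i x)" if "k \<le> n" for k
    using that
  proof (induction k)
    case 0
    then show ?case using sub[of 0] by simp
  next
    case (Suc k)
    have "(MAX i\<in>{..Suc k}. a i x) = max (a (Suc k) x) (MAX i\<in>{..k}. a i x)" for x
      by (simp add: atMost_Suc)
    then show ?case using sublinear_max[OF sub[of "Suc k"] Suc.IH] Suc.prems by simp
  qed
  then have M: "sublinear M" unfolding M_def by simp
  have Mi: "\<exists>i\<le>n. M x = a i x" for x
  proof -
    have "M x \<in> (\<lambda>i. a i x) ` {..n}" unfolding M_def by (intro Max_in) auto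
    then show ?thesis by auto
  qed
  have aM: "a i x \<le> M x" if "i \<le> n" for i x
    unfolding M_def using that by (intro Max_ge) auto
  have "0 \<le> max (M x) (a (Suc n) x)" if "x \<in> W" for x
    using Suc.prems(2)[OF that] aM by (metis le_SucE le_max_iff_disj order_trans)
  then obtain t where t: "0 \<le> t" "t \<le> 1" "\<And>x. x \<in> W \<Longrightarrow> 0 \<le> t * M x + (1 - t) * a (Suc n) x"
    using max_sublinear_nonneg[OF W M Suc.prems(1)[of "Suc n"]] by auto
  define b where "b i x = t * a i x + (1 - t) * a (Suc n) x" for i x
  have "\<exists>l. (\<forall>i. 0 \<le> l i) \<and> (\<Sum>i\<le>n. l i) = 1 \<and> (\<forall>x\<in>W. 0 \<le> (\<Sum>i\<le>n. l i * b i x))"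
  proof (rule Suc.IH)
    show "sublinear (b i)" if "i \<le> n" for i
      unfolding b_def using that t by (intro sublinear_comb Suc.prems) auto
    show "\<exists>i\<le>n. 0 \<le> b i x" if "x \<in> W" for x
      using t(3)[OF that] Mi[of x] by (auto simp: b_def)
  qed
  then obtain l where l: "\<And>i. 0 \<le> l i" "(\<Sum>i\<le>n. l i) = 1" "\<And>x. x \<in> W \<Longrightarrow> 0 \<le> (\<Sum>i\<le>n. l i * b i x)"
    by blast
  define l' where "l' i = (if i \<le> n then t * l i else 1 - t)" for i
  have sumS: "(\<Sum>i\<le>Suc n. l' i * f i) = t * (\<Sum>i\<le>n. l i * f i) + (1 - t) * f (Suc n)" for f :: "nat \<Rightarrow> real"
    by (simp add: l'_def sum_distrib_left mult.assoc)
  show ?case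
  proof (intro exI[of _ l'] conjI allI ballI)
    show "0 \<le> l' i" for i using t l(1) by (simp add: l'_def)
    show "(\<Sum>i\<le>Suc n. l' i) = 1" using sumS[of "\<lambda>_. 1"] l(2) by simp
    fix x assume "x \<in> W"
    have "(\<Sum>i\<le>n. l i * b i x) =
        (\<Sum>i\<le>n. t * (l i * a i x)) + (\<Sum>i\<le>n. l i * ((1 - t) * a (Suc n) x))"
      by (simp add: b_def distrib_left mult_ac flip: sum.distrib)
    also have "\<dots> = t * (\<Sum>i\<le>n. l i * a i x) + (1 - t) * a (Suc n) x"
      using l(2) by (simp flip: sum_distrib_left sum_distrib_right)
    finally have "(\<Sum>i\<le>n. l i * b i x) = t * (\<Sum>i\<le>n. l i * a i x) + (1 - t) * a (Suc n) x" .
    then show "0 \<le> (\<Sum>i\<le>Suc n. l' i * a i x)" using l(3)[OF \<open>x \<in> W\<close>] by (simp only: sumS)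
  qed
qed

section \<open>Simons' inequality\<close>

text \<open>
  Choose \<open>y\<^sub>n\<close> in the convex hull of the \<open>n\<close>-th tail almost minimising the norm of
  \<open>z\<^sub>n + 2\<^sup>-\<^sup>n y\<^sub>n\<close>, where \<open>z\<^sub>n = (\<Sum>k<n. 2\<^sup>-\<^sup>k\<^sup>-\<^sup>1 y\<^sub>k)\<close>, and let \<open>b\<close> attain the norm of the limit \<open>z\<close>.
  Minimality says that \<open>b\<close> at \<open>y\<^sub>n\<close> hardly exceeds \<open>b\<close> at the average \<open>t\<^sub>n\<close> of the later
  \<open>y\<^sub>k\<close>, so \<open>b t\<^sub>n\<close> hardly decreases.
\<close>

lemma Simons_inequality:
  fixes x :: "nat \<Rightarrow> 'z::banach" and B :: "('z \<Rightarrow> real) set"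
  assumes bdd: "\<And>n. norm (x n) \<le> M"
    and lin: "\<And>b. b \<in> B \<Longrightarrow> linear b"
    and ble: "\<And>b z. b \<in> B \<Longrightarrow> b z \<le> norm z"
    and att: "\<And>z. z \<in> closure (convex hull range x) \<Longrightarrow> \<exists>b\<in>B. b z = norm z"
    and ge1: "\<And>y. y \<in> convex hull range x \<Longrightarrow> 1 \<le> norm y"
    and \<theta>: "0 < \<theta>"
  shows "\<exists>b\<in>B. \<forall>N. \<exists>n\<ge>N. 1 - \<theta> \<le> b (x n)"
proof -
  define C where "C n = convex hull (x ` {n..})" for n
  \<comment> \<open>These tolerances sum to \<open>\<theta> / 2\<close>, which is the total loss
    allowed in the lower bound for \<open>b (t n)\<close>.\<close>
  define e where "e n = \<theta> * (1/2) ^ (n + 2)" for n :: nat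
  have Cconv: "convex (C n)" for n by (simp add: C_def)
  have xC: "x k \<in> C n" if "n \<le> k" for k n
    unfolding C_def using that by (intro hull_inc) auto
  have Cmono: "C m \<subseteq> C n" if "n \<le> m" for m n
    unfolding C_def using that by (intro hull_mono) auto
  have C0: "C 0 = convex hull range x" by (simp add: C_def atLeast_0)
  have CM: "norm y \<le> M" if "y \<in> C n" for y n
  proof -
    have "C n \<subseteq> cball 0 M" unfolding C_def using bdd by (intro hull_minimal convex_cball) auto
    then show ?thesis using that by auto
  qed
  have epos: "0 < e n" for n using \<theta> by (simp add: e_def)
  have "\<exists>y\<in>C n. \<forall>y'\<in>C n. norm (z + (1/2)^n *\<^sub>R y) \<le> norm (z + (1/2)^n *\<^sub>R y') + (1/2)^n * e n" for n z
  proof -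
    let ?S = "(\<lambda>y. norm (z + (1/2)^n *\<^sub>R y)) ` C n"
    have ne: "?S \<noteq> {}" using xC[of n n] by auto
    have bd: "bdd_below ?S" by (intro bdd_belowI2[of _ 0]) simp
    have "Inf ?S < Inf ?S + (1/2)^n * e n" using epos by simp
    then obtain s where "s \<in> ?S" "s < Inf ?S + (1/2)^n * e n"
      using cInf_lessD[OF ne] by blast
    then obtain y where y: "y \<in> C n" "norm (z + (1/2)^n *\<^sub>R y) < Inf ?S + (1/2)^n * e n" by auto
    have "Inf ?S \<le> norm (z + (1/2)^n *\<^sub>R y')" if "y' \<in> C n" for y'
      using bd that by (intro cInf_lower) auto
    then show ?thesis using y by (intro bexI[of _ y]) fastforce+
  qed
  then obtain Y where YC: "\<And>n z. Y n z \<in> C n"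
    and Ymin: "\<And>n z y'. y' \<in> C n \<Longrightarrow>
      norm (z + (1/2)^n *\<^sub>R Y n z) \<le> norm (z + (1/2)^n *\<^sub>R y') + (1/2)^n * e n"
    by metis
  define zs where "zs = rec_nat 0 (\<lambda>n z. z + (1/2)^(Suc n) *\<^sub>R Y n z)"
  define y where "y n = Y n (zs n)" for n
  have zs0: "zs 0 = 0" and zsS: "zs (Suc n) = zs n + (1/2)^(Suc n) *\<^sub>R y n" for n
    by (simp_all add: zs_def y_def)
  have yC: "y n \<in> C n" for n by (simp add: y_def YC)
  have zsum: "zs n = (\<Sum>k<n. (1/2)^(Suc k) *\<^sub>R y k)" for n
    by (induction n) (simp_all add: zs0 zsS)
  have "summable (\<lambda>k. (1/2)^(Suc k) *\<^sub>R y k)"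
  proof (rule summable_comparison_test[OF _ summable_mult[of "\<lambda>k. (1/2)^(Suc k)" M]])
    show "\<exists>N. \<forall>k\<ge>N. norm ((1/2)^(Suc k) *\<^sub>R y k) \<le> M * (1/2)^(Suc k)"
      using CM[OF yC] by (auto simp: mult.commute intro!: mult_right_mono)
    show "summable (\<lambda>k. (1/2::real)^(Suc k))"
      using summable_geometric[of "1/2::real"] by (subst summable_Suc_iff) simp
  qed
  then obtain z where z: "zs \<longlonglongrightarrow> z"
    unfolding zsum using summable_LIMSEQ by blast
  define t where "t n = 2^n *\<^sub>R (z - zs n)" for n
  have zt: "z = zs n + (1/2)^n *\<^sub>R t n" for n
    by (simp add: t_def power_one_over)
  \<comment> \<open>The rescaled partial sum has total weight \<open>1 - (1/2)^k\<close>; the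
    missing weight is put on \<open>w\<close>, which completes a convex combination.\<close>
  have P: "2^n *\<^sub>R (zs (n + k) - zs n) + (1/2)^k *\<^sub>R w \<in> C n" if "w \<in> C (n + k)" for n k w
    using that
  proof (induction k arbitrary: w)
    case (Suc k)
    have "w \<in> C (n + k)" using Suc.prems Cmono[of "n + k" "n + Suc k"] by auto
    then have "(1/2) *\<^sub>R y (n + k) + (1/2) *\<^sub>R w \<in> C (n + k)"
      using Cconv yC by (intro convexD) auto
    from Suc.IH[OF this] show ?case
      by (simp add: zsS algebra_simps power_add power_one_over)
  qed simp
  define p where "p n k = 2^n *\<^sub>R (zs (n + k) - zs n) + (1/2)^k *\<^sub>R y (n + k)" for n k
  have pC: "p n k \<in> C n" for n k unfolding p_def by (rule P[OF yC])
  have pt: "p n \<longlonglongrightarrow> t n" for n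
  proof -
    have "(\<lambda>k. (1/2)^k *\<^sub>R y (n + k)) \<longlonglongrightarrow> 0"
    proof (rule Lim_null_comparison)
      show "\<forall>\<^sub>F k in sequentially. norm ((1/2)^k *\<^sub>R y (n + k)) \<le> (1/2)^k * M"
        using CM[OF yC] by (auto intro!: always_eventually mult_left_mono)
      show "(\<lambda>k. (1/2)^k * M) \<longlonglongrightarrow> 0"
        by (intro tendsto_mult_left_zero LIMSEQ_realpow_zero) auto
    qed
    moreover have "(\<lambda>k. zs (n + k)) \<longlonglongrightarrow> z"
      using LIMSEQ_ignore_initial_segment[OF z, of n] by (simp add: add.commute)
    ultimately have "(\<lambda>k. 2^n *\<^sub>R (zs (n + k) - zs n) + (1/2)^k *\<^sub>R y (n + k)) \<longlonglongrightarrow> 2^n *\<^sub>R (z - zs n) + 0"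
      by (intro tendsto_intros)
    then show ?thesis unfolding p_def[abs_def] t_def by simp
  qed
  have tC: "t n \<in> closure (C n)" for n
    using pt pC unfolding closure_sequential by blast
  have minz: "norm (zs n + (1/2)^n *\<^sub>R y n) \<le> norm z + (1/2)^n * e n" for n
  proof (rule LIMSEQ_le_const)
    have "(\<lambda>k. norm (zs n + (1/2)^n *\<^sub>R p n k) + (1/2)^n * e n)
        \<longlonglongrightarrow> norm (zs n + (1/2)^n *\<^sub>R t n) + (1/2)^n * e n"
      by (intro tendsto_intros pt)
    then show "(\<lambda>k. norm (zs n + (1/2)^n *\<^sub>R p n k) + (1/2)^n * e n) \<longlonglongrightarrow> norm z + (1/2)^n * e n"
      using zt[of n] by simp
    show "\<exists>N. \<forall>k\<ge>N. norm (zs n + (1/2)^n *\<^sub>R y n) \<le> norm (zs n + (1/2)^n *\<^sub>R p n k) + (1/2)^n * e n"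
      using Ymin[OF pC] by (auto simp: y_def)
  qed
  have t0: "t 0 = z" by (simp add: t_def zs0)
  have "z \<in> closure (convex hull range x)" using tC[of 0] by (simp add: t0 C0)
  then obtain b where b: "b \<in> B" "b z = norm z" using att by blast
  interpret b: linear b by (rule lin[OF b(1)])
  have z1: "1 \<le> norm z"
  proof (rule LIMSEQ_le_const)
    show "(\<lambda>k. norm (p 0 k)) \<longlonglongrightarrow> norm z" using pt[of 0] by (auto simp: t0 intro: tendsto_norm)
    show "\<exists>N. \<forall>k\<ge>N. 1 \<le> norm (p 0 k)" using ge1 pC[of 0] by (auto simp: C0)
  qed
  \<comment> \<open>As \<open>b\<close> is norming for \<open>z\<close>, its value at the almost
    minimal vector is at most \<open>b z\<close> plus the tolerance; the common part
    \<open>zs n\<close> cancels.\<close>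
  have byt: "b (y n) \<le> b (t n) + e n" for n
  proof -
    have "b (zs n + (1/2)^n *\<^sub>R y n) \<le> b z + (1/2)^n * e n"
      using ble[OF b(1), of "zs n + (1/2)^n *\<^sub>R y n"] minz[of n] b(2) by linarith
    also have "b z = b (zs n + (1/2)^n *\<^sub>R t n)" using zt[of n] by simp
    finally have "(1/2)^n * b (y n) \<le> (1/2)^n * (b (t n) + e n)"
      by (simp only: b.add b.scale) (simp add: distrib_left)
    then show ?thesis by simp
  qed
  have tS: "t (Suc n) = 2 *\<^sub>R t n - y n" for n
    by (simp add: t_def zsS algebra_simps power_one_over)
  have "b (t n) \<ge> 1 - \<theta> / 2 + \<theta> * (1/2)^(n+1)" for n
  proof (induction n)
    case 0
    then show ?case using b(2) z1 t0 by simp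
  next
    case (Suc n)
    have "b (t (Suc n)) = 2 * b (t n) - b (y n)"
      unfolding tS by (simp only: b.diff b.scale) simp
    then show ?case using Suc byt[of n] by (simp add: e_def)
  qed
  then have bt: "1 - \<theta> / 2 \<le> b (t n)" for n
    using \<theta> by (smt (verit) mult_nonneg_nonneg zero_le_power divide_nonneg_nonneg)
  \<comment> \<open>An upper bound for \<open>b\<close> on the tail from \<open>N\<close> passes to
    convex combinations and then to their limit \<open>t N\<close>, where it contradicts
    \<open>bt\<close>.\<close>
  have "\<exists>n\<ge>N. 1 - \<theta> \<le> b (x n)" for N
  proof (rule ccontr)
    assume "\<not> ?thesis"
    then have lt: "b (x n) \<le> 1 - \<theta>" if "N \<le> n" for n using that by (metis less_imp_le not_le)
    have "convex (b -` {..1 - \<theta>})"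
      by (intro convex_linear_vimage lin b) simp
    then have "C N \<subseteq> b -` {..1 - \<theta>}"
      unfolding C_def using lt by (intro hull_minimal) auto
    then have "b (p N k) \<le> 1 - \<theta>" for k using pC by auto
    moreover have "(\<lambda>k. b (p N k)) \<longlonglongrightarrow> b (t N)"
    proof -
      have "\<bar>b w\<bar> \<le> norm w" for w
        using ble[OF b(1), of w] ble[OF b(1), of "- w"] by (simp add: b.neg abs_le_iff)
      then have "bounded_linear b"
        by (intro bounded_linear_intro[where K = 1]) (auto simp: b.add b.scale)
      then show ?thesis using pt by (rule bounded_linear.tendsto)
    qed
    ultimately have "b (t N) \<le> 1 - \<theta>" by (intro LIMSEQ_le_const2) auto
    then show False using bt[of N] \<theta> by simp
  qed
  then show ?thesis using b(1) by blast
qed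

text \<open>The element \<open>j\<close> is zero in the real case and an imaginary unit in the complex case.\<close>

lemma ex_re:
  obtains re :: "'k::real_or_complex \<Rightarrow> real" and j :: 'k
  where "linear re" "re 1 = 1" "\<And>z. \<bar>re z\<bar> \<le> norm z" "norm j \<le> 1"
    "\<And>z. z = of_real (re z) - of_real (re (j * z)) * j" "j * j = - 1 \<or> j = 0"
    "\<And>z. \<exists>a b. z = of_real a + of_real b * j"
proof -
  consider "\<And>z::'k. \<exists>a. z = of_real a"
    | j :: 'k where "j * j = - 1" "\<And>z. \<exists>a b. z = of_real a + of_real b * j"
    using real_or_complex by (auto simp: of_real_def)
  then show thesis
  proof cases
    case 1
    define re :: "'k \<Rightarrow> real" where "re z = (THE a. z = of_real a)" for z
    have re: "re (of_real a) = a" for a by (auto simp: re_def)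
    have rez: "of_real (re z) = z" for z using 1[of z] re by auto
    show thesis
    proof (rule that[of re 0])
      show "linear re"
      proof (rule linearI)
        show "re (x + y) = re x + re y" for x y
          using re[of "re x + re y"] by (simp add: rez)
        show "re (r *\<^sub>R x) = r *\<^sub>R re x" for r x
          using re[of "r * re x"] by (simp add: rez scaleR_conv_of_real)
      qed
      show "re 1 = 1" using re[of 1] by simp
      show "\<bar>re z\<bar> \<le> norm z" for z using norm_of_real[of "re z", where 'a='k] by (simp add: rez)
    qed (auto simp: rez 1)
  next
    case (2 j)
    have nr: "j \<noteq> of_real a" for a
    proof
      assume "j = of_real a"
      then have "of_real (a * a) = (of_real (- 1) :: 'k)" using 2(1) by simp
      then have "a * a = - 1" unfolding of_real_eq_iff .
      then show False using zero_le_square[of a] by linarith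
    qed
    have uniq: "a = c \<and> b = d" if eq: "of_real a + of_real b * j = of_real c + of_real d * j" for a b c d
    proof -
      have "b = d"
      proof (rule ccontr)
        assume "b \<noteq> d"
        have "of_real (b - d) * j = of_real (c - a)" using eq by (simp add: algebra_simps)
        then have "j = of_real ((c - a) / (b - d))" using \<open>b \<noteq> d\<close> by (simp add: field_simps)
        then show False using nr by blast
      qed
      then show ?thesis using eq by simp
    qed
    define re :: "'k \<Rightarrow> real" where "re z = (THE a. \<exists>b. z = of_real a + of_real b * j)" for z
    have re: "re (of_real a + of_real b * j) = a" for a b
      unfolding re_def using uniq by (intro the_equality) blast+
    have nj: "norm j = 1"
    proof -
      have "norm j * norm j = 1" using 2(1) by (metis norm_minus_cancel norm_mult norm_one)
      then show ?thesis using norm_ge_zero[of j] by (metis abs_1 abs_of_nonneg power2_eq_1_iff power2_eq_square abs_minus_cancel)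
    qed
    \<comment> \<open>The expected modulus. The class only says that the norm is multiplicative, so
      the equality of the norm of \<open>a + b j\<close> with \<open>q a b\<close> has to be
      derived.\<close>
    define q where "q a b = sqrt (a\<^sup>2 + b\<^sup>2)" for a b :: real
    have nq: "norm (of_real a + of_real b * j) \<le> 2 * q a b" for a b
    proof -
      have "norm (of_real a + of_real b * j) \<le> \<bar>a\<bar> + \<bar>b\<bar>"
        using norm_triangle_ineq[of "of_real a" "of_real b * j"] by (simp add: norm_mult nj)
      also have "\<dots> \<le> 2 * q a b"
        using real_sqrt_sum_squares_ge1[of a b] real_sqrt_sum_squares_ge2[of b a]
          abs_le_iff real_sqrt_ge_abs1[of a b] real_sqrt_ge_abs2[of b a] unfolding q_def by linarith
      finally show ?thesis .
    qed
    have pow: "\<exists>c d. (of_real a + of_real b * j) ^ n = of_real c + of_real d * j \<and> q c d = q a b ^ n" for a b n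
    proof (induction n)
      case 0
      then show ?case by (intro exI[of _ 1] exI[of _ 0]) (simp add: q_def)
    next
      case (Suc n)
      then obtain c d where cd: "(of_real a + of_real b * j) ^ n = of_real c + of_real d * j" "q c d = q a b ^ n" by blast
      have jj: "j * (j * w) = - w" for w using 2(1) by (simp flip: mult.assoc)
      have "(of_real a + of_real b * j) ^ Suc n = of_real (a * c - b * d) + of_real (a * d + b * c) * j"
        unfolding power_Suc cd(1) by (simp add: algebra_simps jj 2(1))
      moreover have "q (a * c - b * d) (a * d + b * c) = q a b * q c d"
        unfolding q_def real_sqrt_mult[symmetric] by (rule arg_cong[where f = sqrt]) algebra
      ultimately show ?case
        by (intro exI[of _ "a * c - b * d"] exI[of _ "a * d + b * c"] conjI) (simp_all only: cd(2) power_Suc)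
    qed
    \<comment> \<open>Both sides are multiplicative, so applying the crude estimate to high powers
      removes its factor 2.\<close>
    have nq1: "norm (of_real a + of_real b * j) \<le> q a b" for a b
    proof (rule ccontr)
      assume neg: "\<not> ?thesis"
      let ?N = "norm (of_real a + of_real b * j)"
      have N: "?N ^ n \<le> 2 * q a b ^ n" for n
        using pow[of a b n] nq by (metis norm_power)
      have q0: "0 < q a b"
      proof -
        have "0 \<le> q a b" by (simp add: q_def)
        moreover have "q a b \<noteq> 0" using neg nq[of a b] by auto
        ultimately show ?thesis by simp
      qed
      have "1 < ?N / q a b" using neg q0 by (simp add: field_simps)
      then obtain n where "2 < (?N / q a b) ^ n" using real_arch_pow by blast
      then have "2 * q a b ^ n < ?N ^ n" using q0 by (simp add: power_divide field_simps)
      then show False using N[of n] by simp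
    qed
    \<comment> \<open>The product with the conjugate \<open>a - b j\<close> is the square of
      \<open>q a b\<close>, and the norm of the conjugate is at most \<open>q a b\<close> by the
      upper estimate.\<close>
    have nq2: "q a b \<le> norm (of_real a + of_real b * j)" for a b
    proof (cases "q a b = 0")
      case False
      then have q0: "0 < q a b" by (simp add: q_def less_le)
      have qm: "q a (- b) = q a b" by (simp add: q_def)
      have "(of_real a + of_real b * j) * (of_real a + of_real (- b) * j) = of_real ((q a b)\<^sup>2)"
      proof -
        have "(of_real a + of_real b * j) * (of_real a + of_real (- b) * j)
            = of_real a * of_real a - of_real b * of_real b * (j * j)" by (simp add: algebra_simps)
        then show ?thesis using 2(1) by (simp add: q_def power2_eq_square)
      qed
      then have "norm (of_real a + of_real b * j) * norm (of_real a + of_real (- b) * j) = (q a b)\<^sup>2"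
        by (metis norm_mult norm_of_real abs_power2)
      moreover have "norm (of_real a + of_real (- b) * j) \<le> q a b" using nq1[of a "- b"] qm by simp
      ultimately have "(q a b)\<^sup>2 \<le> norm (of_real a + of_real b * j) * q a b"
        by (metis mult_left_mono norm_ge_zero)
      then show ?thesis using q0 by (simp add: power2_eq_square)
    qed simp
    show thesis
    proof (rule that[of re j])
      show "linear re"
      proof (rule linearI)
        fix x y :: 'k and r
        obtain a b c d where "x = of_real a + of_real b * j" "y = of_real c + of_real d * j" 
          using 2(2) by metis
        moreover from this have "x + y = of_real (a + c) + of_real (b + d) * j"
          "r *\<^sub>R x = of_real (r * a) + of_real (r * b) * j"
          by (simp_all add: algebra_simps scaleR_conv_of_real)
        ultimately show "re (x + y) = re x + re y" "re (r *\<^sub>R x) = r *\<^sub>R re x" by (simp_all only: re real_scaleR_def)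
      qed
      show "re 1 = 1" using re[of 1 0] by simp
      fix z :: 'k
      obtain a b where z: "z = of_real a + of_real b * j" using 2(2) by blast
      show "\<bar>re z\<bar> \<le> norm z"
        using nq2[of a b] real_sqrt_ge_abs1[of a b] unfolding z re q_def by linarith
      have "j * z = of_real (- b) + of_real a * j"
        using arg_cong[OF 2(1), of "\<lambda>w. w * of_real b"] by (simp add: z algebra_simps)
      then have "re (j * z) = - b" by (simp only: re)
      then show "z = of_real (re z) - of_real (re (j * z)) * j" unfolding z re by (simp add: re)
    qed (use 2 nj in auto)
  qed
qed

section \<open>Normed spaces over the real or complex numbers\<close>

lemma compact_cball_scalar: "compact (cball (0::'k::real_or_complex) r)"
proof -
  obtain re :: "'k \<Rightarrow> real" and j :: 'k where re: "\<And>z. \<bar>re z\<bar> \<le> norm z" "norm j \<le> 1"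
    "\<And>z. z = of_real (re z) - of_real (re (j * z)) * j"
    by (rule ex_re) blast
  define h where "h = (\<lambda>(a::real, b::real). of_real a - of_real b * j)"
  have "compact (h ` (cball 0 r \<times> cball 0 r))"
    unfolding h_def by (intro compact_continuous_image compact_Times compact_cball)
      (auto simp: case_prod_unfold intro!: continuous_intros)
  moreover have "cball 0 r \<subseteq> h ` (cball 0 r \<times> cball 0 r)"
  proof
    fix z :: 'k assume z: "z \<in> cball 0 r"
    have "norm (j * z) \<le> 1 * norm z"
      unfolding norm_mult using re(2) by (intro mult_right_mono) auto
    then have "\<bar>re z\<bar> \<le> r" "\<bar>re (j * z)\<bar> \<le> r"
      using re(1)[of z] re(1)[of "j * z"] z by auto
    then show "z \<in> h ` (cball 0 r \<times> cball 0 r)"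
      using re(3)[of z] by (intro image_eqI[of _ _ "(re z, re (j * z))"]) (auto simp: h_def)
  qed
  ultimately show ?thesis
    by (metis closed_cball compact_Int_closed inf.absorb2)
qed

context normed_space_over
begin

lemma bounded_linear_smul_left: "bounded_linear (\<lambda>c. smul c u)"
proof (rule bounded_linear_intro)
  show "smul (r *\<^sub>R c) u = r *\<^sub>R smul c u" for r c
    by (simp add: scaleR_conv_of_real smul_of_real flip: scale_scale)
qed (auto simp: scale_left_distrib norm_smul)

lemma smul_scaleR: "smul c (r *\<^sub>R x) = r *\<^sub>R smul c x"
  by (simp add: scale_left_commute flip: smul_of_real)

lemma bounded_linear_smul_right: "bounded_linear (smul c)"
  by (rule bounded_linear_intro[where K = "norm c"])
    (auto simp: scale_right_distrib smul_scaleR norm_smul)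

lemma real_subspace: "subspace W \<Longrightarrow> real_vector.subspace W"
  unfolding real_vector.subspace_def by (metis smul_of_real subspace_def)

lemma dual_smul: "f \<in> dual smul \<Longrightarrow> blinfun_apply f (smul c x) = c * blinfun_apply f x"
  by (simp add: dual_def)

lemma bounded_ops_smul: "T \<in> bounded_ops smul \<Longrightarrow> blinfun_apply T (smul c x) = smul c (blinfun_apply T x)"
  by (simp add: bounded_ops_def)

text \<open>Reduction to the real theorem: the real part is extended to \<open>h\<close>, and the
  functional is recovered as \<open>h x - h (j x) j\<close>. With \<open>j = 0\<close> the same
  formula covers real scalars.\<close>

theorem Hahn_Banach:
  fixes g :: "'e \<Rightarrow> 'k"
  assumes W: "subspace W" and M: "0 \<le> M"
    and gadd: "\<And>x y. x \<in> W \<Longrightarrow> y \<in> W \<Longrightarrow> g (x + y) = g x + g y"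
    and gscale: "\<And>c x. x \<in> W \<Longrightarrow> g (smul c x) = c * g x"
    and gM: "\<And>x. x \<in> W \<Longrightarrow> norm (g x) \<le> M * norm x"
  obtains f where "f \<in> dual smul" "norm f \<le> M" "\<And>x. x \<in> W \<Longrightarrow> blinfun_apply f x = g x"
proof -
  obtain re :: "'k \<Rightarrow> real" and j :: 'k where re: "linear re" "re 1 = 1" "\<And>z. \<bar>re z\<bar> \<le> norm z" "norm j \<le> 1"
    "\<And>z. z = of_real (re z) - of_real (re (j * z)) * j" and jj: "j * j = - 1 \<or> j = 0"
    and dec: "\<And>z. \<exists>a b. z = of_real a + of_real b * j"
    by (rule ex_re) blast
  interpret re: linear re by fact
  have re_of_real_mult: "re (of_real a * z) = a * re z" for a z
    using re.scale[of a z] by (simp add: scaleR_conv_of_real)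
  have re_of_real: "re (of_real a) = a" for a
    using re_of_real_mult[of a 1] re(2) by simp
  have rej: "re j = 0"
    using re(5)[of 1] re(2) re.zero by auto
  obtain h where h: "linear h" "\<And>x. h x \<le> M * norm x" "\<And>x. x \<in> W \<Longrightarrow> h x = re (g x)"
  proof (rule Hahn_Banach_sublinear[of "\<lambda>x. M * norm x" W "\<lambda>x. re (g x)"])
    show "sublinear (\<lambda>x::'e. M * norm x)"
      using M mult_left_mono[OF norm_triangle_ineq M] by (auto simp: sublinear_def distrib_left)
    show "real_vector.subspace W" by (rule real_subspace[OF W])
    show "re (g (x + y)) = re (g x) + re (g y)" if "x \<in> W" "y \<in> W" for x y
      using that by (simp add: gadd re.add)
    show "re (g (r *\<^sub>R x)) = r * re (g x)" if "x \<in> W" for r x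
      using gscale[OF that, of "of_real r"] by (simp add: smul_of_real re_of_real_mult)
    show "re (g x) \<le> M * norm x" if "x \<in> W" for x
      using gM[OF that] re(3)[of "g x"] by linarith
  qed blast
  interpret h: linear h by fact
  define F where "F x = of_real (h x) - of_real (h (smul j x)) * j" for x
  have Fadd: "F (x + y) = F x + F y" for x y
    by (simp add: F_def h.add scale_right_distrib algebra_simps)
  have FscaleR: "F (r *\<^sub>R x) = of_real r * F x" for r x
    by (simp add: F_def h.scale smul_scaleR algebra_simps)
  have h0: "h (- x) = - h x" for x by (rule h.neg)
  have Fj: "F (smul j x) = j * F x" for x
    using jj
  proof
    assume "j = 0"
    then show ?thesis by (simp add: F_def h.zero)
  next
    assume jj: "j * j = - 1"
    have "F (smul j x) = of_real (h (smul j x)) + of_real (h x) * j"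
      by (simp add: F_def jj h0)
    also have "\<dots> = j * F x"
      using arg_cong[OF jj, of "\<lambda>w. w * of_real (h (smul j x))"] by (simp add: F_def algebra_simps)
    finally show ?thesis .
  qed
  have Fscale: "F (smul c x) = c * F x" for c x
  proof -
    obtain a b where c: "c = of_real a + of_real b * j" using dec by blast
    have "F (smul c x) = F (a *\<^sub>R x + b *\<^sub>R smul j x)"
      by (simp add: c scale_left_distrib smul_of_real flip: scale_scale)
    also have "\<dots> = c * F x"
      by (simp add: Fadd FscaleR Fj c algebra_simps)
    finally show ?thesis .
  qed
  have reF: "re (F x) = h x" for x
    by (simp add: F_def re.diff re_of_real re_of_real_mult rej)
  have FM: "norm (F x) \<le> M * norm x" for x
  proof (cases "F x = 0")
    case False
    \<comment> \<open>Rotation by a unimodular scalar makes the value real and nonnegative, so the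
      bound for \<open>h\<close> carries over without a loss in the constant.\<close>
    define w where "w = of_real (norm (F x)) * inverse (F x)"
    have w: "norm w = 1" "w * F x = of_real (norm (F x))"
      using False by (simp_all add: w_def norm_mult norm_inverse)
    have "norm (F x) = re (F (smul w x))" by (simp add: Fscale w re_of_real)
    also have "\<dots> \<le> M * norm (smul w x)" unfolding reF by (rule h(2))
    finally show ?thesis by (simp add: norm_smul w)
  qed (simp add: M)
  have bl: "bounded_linear F"
    by (rule bounded_linear_intro[where K = M]) (auto simp: Fadd FscaleR FM scaleR_conv_of_real mult.commute[of _ M])
  show thesis
  proof (rule that[of "Blinfun F"])
    show "Blinfun F \<in> dual smul" by (simp add: dual_def bounded_linear_Blinfun_apply[OF bl] Fscale)
    show "norm (Blinfun F) \<le> M"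
      by (rule norm_blinfun_bound[OF M]) (simp add: bounded_linear_Blinfun_apply[OF bl] FM)
    show "blinfun_apply (Blinfun F) x = g x" if "x \<in> W" for x
      using that h(3)[of x] h(3)[of "smul j x"] subspace_scale[OF W that] re(5)[of "g x"]
      by (simp add: bounded_linear_Blinfun_apply[OF bl] F_def gscale)
  qed
qed

text \<open>The coefficient of \<open>v\<close> is a functional on the sum of \<open>W\<close> and
  the line through \<open>v\<close>; the lower bound \<open>d\<close> for the distance from
  \<open>v\<close> to \<open>W\<close> bounds it by \<open>1 / d\<close>.\<close>

lemma separating_functional:
  assumes W: "subspace W" and d: "0 < d" "\<And>w. w \<in> W \<Longrightarrow> d \<le> norm (v - w)"
  obtains f where "f \<in> dual smul" "norm f \<le> 1 / d" "\<And>w. w \<in> W \<Longrightarrow> blinfun_apply f w = 0"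
    "blinfun_apply f v = 1"
proof -
  have vW: "v \<notin> W" using d(2)[of v] d(1) by auto
  have uniq: "c = c'" if "x - smul c v \<in> W" "x - smul c' v \<in> W" for x c c'
  proof (rule ccontr)
    assume ne: "c \<noteq> c'"
    have "smul (inverse (c - c')) ((x - smul c' v) - (x - smul c v)) \<in> W"
      by (rule subspace_scale[OF W subspace_diff[OF W that(2,1)]])
    moreover have "(x - smul c' v) - (x - smul c v) = smul (c - c') v"
      by (simp add: scale_left_diff_distrib)
    ultimately show False using ne vW by simp
  qed
  define V where "V = {x. \<exists>c. x - smul c v \<in> W}"
  define g where "g x = (THE c. x - smul c v \<in> W)" for x
  have g: "g x = c" if "x - smul c v \<in> W" for x c
    unfolding g_def using that uniq by blast
  have V: "subspace V"
  proof (rule subspaceI)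
    show "0 \<in> V" using subspace_0[OF W] by (auto simp: V_def intro!: exI[of _ 0])
    show "x + y \<in> V" if xy: "x \<in> V" "y \<in> V" for x y
    proof -
      obtain c c' where "x - smul c v \<in> W" "y - smul c' v \<in> W" using xy by (auto simp: V_def)
      then have "(x - smul c v) + (y - smul c' v) \<in> W" by (rule subspace_add[OF W])
      then have "x + y - smul (c + c') v \<in> W" by (simp add: scale_left_distrib algebra_simps)
      then show ?thesis by (auto simp: V_def)
    qed
    show "smul r x \<in> V" if "x \<in> V" for r x
    proof -
      obtain c where "x - smul c v \<in> W" using \<open>x \<in> V\<close> by (auto simp: V_def)
      then have "smul r (x - smul c v) \<in> W" by (rule subspace_scale[OF W])
      then have "smul r x - smul (r * c) v \<in> W" by (simp add: scale_right_diff_distrib)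
      then show ?thesis by (auto simp: V_def)
    qed
  qed
  obtain f where f: "f \<in> dual smul" "norm f \<le> 1 / d" "\<And>x. x \<in> V \<Longrightarrow> blinfun_apply f x = g x"
  proof (rule Hahn_Banach[OF V, of "1 / d" g])
    fix x y assume xy: "x \<in> V" "y \<in> V"
    then obtain c c' where c: "x - smul c v \<in> W" "y - smul c' v \<in> W" by (auto simp: V_def)
    then have "(x - smul c v) + (y - smul c' v) \<in> W" by (rule subspace_add[OF W])
    then have "x + y - smul (c + c') v \<in> W" by (simp add: scale_left_distrib algebra_simps)
    then show "g (x + y) = g x + g y" using c by (simp add: g)
  next
    fix r x assume "x \<in> V"
    then obtain c where c: "x - smul c v \<in> W" by (auto simp: V_def)
    then have "smul r (x - smul c v) \<in> W" by (rule subspace_scale[OF W])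
    then have "smul r x - smul (r * c) v \<in> W" by (simp add: scale_right_diff_distrib)
    then show "g (smul r x) = r * g x" using c by (simp add: g)
  next
    fix x assume "x \<in> V"
    then obtain c where c: "x - smul c v \<in> W" by (auto simp: V_def)
    show "norm (g x) \<le> 1 / d * norm x"
    proof (cases "c = 0")
      case False
      have "smul (- inverse c) (x - smul c v) \<in> W" using c by (rule subspace_scale[OF W])
      then have "d \<le> norm (v - smul (- inverse c) (x - smul c v))" by (rule d(2))
      also have "v - smul (- inverse c) (x - smul c v) = smul (inverse c) x"
        using False by (simp add: scale_right_diff_distrib)
      also have "norm \<dots> = norm x / norm c" by (simp add: norm_smul norm_inverse divide_inverse_commute)
      finally show ?thesis using d(1) False g[OF c] by (simp add: field_simps)
    qed (use g[OF c] d(1) in simp)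
  qed (use d in auto)
  have WV: "w \<in> V" "g w = 0" if "w \<in> W" for w
    using that g[of w 0] by (auto simp: V_def intro!: exI[of _ 0])
  have "v \<in> V" "g v = 1"
    using subspace_0[OF W] g[of v 1] by (auto simp: V_def intro!: exI[of _ 1])
  then show thesis using that f WV by metis
qed

lemma norming_functional:
  obtains f where "f \<in> dual smul" "norm f \<le> 1" "blinfun_apply f v = of_real (norm v)"
proof (cases "v = 0")
  case True
  then show thesis using that[of 0] by (simp add: dual_def)
next
  case False
  obtain f where f: "f \<in> dual smul" "norm f \<le> 1 / norm v" "blinfun_apply f v = 1"
    using separating_functional[of "{0}" "norm v" v] False by auto
  show thesis
  proof (rule that[of "norm v *\<^sub>R f"])
    show "norm v *\<^sub>R f \<in> dual smul"
      using f(1) by (simp add: dual_def scaleR_blinfun.rep_eq)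
    show "norm (norm v *\<^sub>R f) \<le> 1" using f(2) False by (simp add: field_simps)
    show "blinfun_apply (norm v *\<^sub>R f) v = of_real (norm v)"
      by (simp add: scaleR_blinfun.rep_eq f(3) scaleR_conv_of_real)
  qed
qed

lemma functional_vanishing_on_closed_subspace:
  assumes W: "subspace W" "closed W" and v: "v \<notin> W"
  obtains f where "f \<in> dual smul" "\<And>w. w \<in> W \<Longrightarrow> blinfun_apply f w = 0" "blinfun_apply f v = 1"
proof -
  obtain d where d: "0 < d" "ball v d \<subseteq> - W"
    using W(2) v open_contains_ball[of "- W"] by (auto simp: open_Compl)
  have "d \<le> norm (v - w)" if "w \<in> W" for w
    using d(2) that by (force simp: dist_norm not_le[symmetric])
  then show thesis using separating_functional[OF W(1) d(1)] that by metis
qed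

lemma norm_le_by_functionals:
  assumes "\<And>f. f \<in> dual smul \<Longrightarrow> norm f \<le> 1 \<Longrightarrow> norm (blinfun_apply f v) \<le> M"
  shows "norm v \<le> M"
  using norming_functional[of v] assms by (metis norm_of_real abs_norm_cancel)

lemma eq_by_functionals:
  assumes "\<And>f. f \<in> dual smul \<Longrightarrow> blinfun_apply f v = blinfun_apply f w"
  shows "v = w"
proof -
  have "norm (v - w) \<le> 0"
    using assms by (intro norm_le_by_functionals) (simp add: blinfun.diff_right)
  then show ?thesis by simp
qed

section \<open>Operators of finite rank and their traces\<close>

definition rank1 :: "'e \<Rightarrow> ('e \<Rightarrow>\<^sub>L 'k) \<Rightarrow> 'e \<Rightarrow>\<^sub>L 'e" where
  "rank1 u f = Blinfun (\<lambda>x. smul (blinfun_apply f x) u)"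

lemma rank1_apply: "blinfun_apply (rank1 u f) x = smul (blinfun_apply f x) u"
  unfolding rank1_def
  by (subst bounded_linear_Blinfun_apply)
    (auto intro!: bounded_linear_compose[OF bounded_linear_smul_left] blinfun.bounded_linear_right)

lemma norm_rank1: "norm (rank1 u f) \<le> norm u * norm f"
proof (rule norm_blinfun_bound)
  show "norm (blinfun_apply (rank1 u f) x) \<le> norm u * norm f * norm x" for x
    using mult_left_mono[OF norm_blinfun[of f x] norm_ge_zero[of u]]
    by (simp add: rank1_apply norm_smul mult_ac)
qed simp

lemma rank1_bounded_ops: "f \<in> dual smul \<Longrightarrow> rank1 u f \<in> bounded_ops smul"
  by (simp add: bounded_ops_def rank1_apply dual_smul)

text \<open>A list stands for a tensor of vectors and functionals: \<open>op_of L\<close> is its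
  operator and \<open>pairing L x\<close> the trace of \<open>x o\<^sub>L op_of L\<close>. Keeping
  the list postpones the question whether the trace depends on the operator only.\<close>

definition op_of :: "('e \<times> ('e \<Rightarrow>\<^sub>L 'k)) list \<Rightarrow> 'e \<Rightarrow>\<^sub>L 'e" where
  "op_of L = (\<Sum>(u, f)\<leftarrow>L. rank1 u f)"

definition pairing :: "('e \<times> ('e \<Rightarrow>\<^sub>L 'k)) list \<Rightarrow> ('e \<Rightarrow>\<^sub>L 'e) \<Rightarrow> 'k" where
  "pairing L x = (\<Sum>(u, f)\<leftarrow>L. blinfun_apply f (blinfun_apply x u))"

lemma op_of_simps [simp]:
  "op_of [] = 0" "op_of ((u, f) # L) = rank1 u f + op_of L" "op_of (L @ M) = op_of L + op_of M"
  by (simp_all add: op_of_def)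

lemma pairing_simps [simp]:
  "pairing [] x = 0" "pairing ((u, f) # L) x = blinfun_apply f (blinfun_apply x u) + pairing L x"
  "pairing (L @ M) x = pairing L x + pairing M x"
  by (simp_all add: pairing_def)

lemma pairing_add: "pairing L (x + y) = pairing L x + pairing L y"
  by (induction L) (auto simp: blinfun.add_left blinfun.add_right)

lemma pairing_scaleR: "pairing L (r *\<^sub>R x) = r *\<^sub>R pairing L x"
  by (induction L) (auto simp: blinfun.scaleR_left blinfun.scaleR_right algebra_simps)

lemma pairing_smul_op: "set L \<subseteq> UNIV \<times> dual smul \<Longrightarrow> pairing L (smul_op smul c x) = c * pairing L x"
  by (induction L) (auto simp: smul_op_apply dual_smul algebra_simps)

text \<open>Testing a pairing on rank one recovers the matrix entries of its operator. This turns an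
  approximation of functionals into an approximation of operators.\<close>

lemma pairing_rank1:
  "set L \<subseteq> UNIV \<times> dual smul \<Longrightarrow> g \<in> dual smul \<Longrightarrow>
    pairing L (rank1 v g) = blinfun_apply g (blinfun_apply (op_of L) v)"
  by (induction L)
    (auto simp: rank1_apply dual_smul blinfun.add_left blinfun.add_right mult.commute)

lemma op_of_bounded_ops: "set L \<subseteq> UNIV \<times> dual smul \<Longrightarrow> op_of L \<in> bounded_ops smul"
proof (induction L)
  case (Cons p L)
  then show ?case
    using rank1_bounded_ops by (cases p) (auto simp: bounded_ops_def blinfun.add_left scale_right_distrib)
qed (simp add: bounded_ops_def)

lemma op_of_compose_left:
  "T \<in> bounded_ops smul \<Longrightarrow> op_of (map (\<lambda>(u, f). (blinfun_apply T u, f)) L) = T o\<^sub>L op_of L"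
  by (induction L)
    (auto intro!: blinfun_eqI simp: blinfun.add_left blinfun.add_right rank1_apply bounded_ops_smul)

lemma op_of_compose_right: "op_of (map (\<lambda>(u, f). (u, f o\<^sub>L T)) L) = op_of L o\<^sub>L T"
  by (induction L) (auto intro!: blinfun_eqI simp: blinfun.add_left rank1_apply)

lemma dual_compose: "f \<in> dual smul \<Longrightarrow> T \<in> bounded_ops smul \<Longrightarrow> f o\<^sub>L T \<in> dual smul"
  by (simp add: dual_def bounded_ops_def)

lemma op_of_range_span: "blinfun_apply (op_of L) x \<in> span (fst ` set L)"
proof (induction L)
  case (Cons p L)
  have "fst ` set L \<subseteq> fst ` set (p # L)" by auto
  from subsetD[OF span_mono[OF this] Cons.IH]
  have "blinfun_apply (op_of L) x \<in> span (fst ` set (p # L))" .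
  then have "smul c (fst p) + blinfun_apply (op_of L) x \<in> span (fst ` set (p # L))" for c
    by (intro span_add[OF span_scale[OF span_base]]) auto
  then show ?case
    by (cases p) (auto simp: blinfun.add_left rank1_apply)
qed (simp add: span_zero)

text \<open>Induction in the manner of Gram and Schmidt: the part of the new vector that the
  projection misses is added, with a functional that vanishes on the old vectors.\<close>

lemma ex_projection_onto_span:
  assumes "finite B"
  shows "\<exists>L. set L \<subseteq> span B \<times> dual smul \<and> (\<forall>b\<in>span B. blinfun_apply (op_of L) b = b)"
proof -
  have "\<exists>L. set L \<subseteq> span B \<times> dual smul \<and> (\<forall>b\<in>B. blinfun_apply (op_of L) b = b)"
    using assms
  proof (induction B)
    case empty
    then show ?case by (intro exI[of _ "[]"]) simp
  next
    case (insert v B)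
    then obtain L where L: "set L \<subseteq> span B \<times> dual smul" "\<And>b. b \<in> B \<Longrightarrow> blinfun_apply (op_of L) b = b"
      by blast
    have sub: "span B \<subseteq> span (insert v B)" by (intro span_mono) auto
    define u where "u = v - blinfun_apply (op_of L) v"
    obtain f where f: "f \<in> dual smul" "blinfun_apply f u = of_real (norm u)"
      using norming_functional by blast
    have Lb: "op_of L \<in> bounded_ops smul" using L(1) by (intro op_of_bounded_ops) auto
    \<comment> \<open>\<open>g\<close> vanishes on \<open>B\<close> and equals 1 at
      \<open>v\<close>. If \<open>u = 0\<close>, then \<open>v\<close> is fixed already, and
      \<open>inverse 0 = 0\<close> makes \<open>g\<close> zero.\<close>
    define g where "g = inverse (norm u) *\<^sub>R (f - (f o\<^sub>L op_of L))"
    have "g \<in> dual smul"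
      using f(1) dual_compose[OF f(1) Lb] unfolding g_def dual_def
      by (simp add: blinfun.diff_left blinfun.scaleR_left algebra_simps)
    moreover have "fst ` set L \<subseteq> span (insert v B)" using L(1) sub by auto
    then have "blinfun_apply (op_of L) v \<in> span (insert v B)"
      using op_of_range_span[of L v] span_minimal[OF _ subspace_span] by blast
    then have "u \<in> span (insert v B)"
      unfolding u_def by (intro span_diff) (auto intro: span_base)
    moreover have "blinfun_apply (op_of ((u, g) # L)) b = b" if "b \<in> insert v B" for b
    proof (cases "b \<in> B")
      case True
      then show ?thesis
        by (simp add: blinfun.add_left rank1_apply g_def blinfun.scaleR_left blinfun.diff_left L(2))
    next
      case False
      then have "b = v" using that by auto
      show ?thesis
      proof (cases "u = 0")
        case True
        then show ?thesis using \<open>b = v\<close> by (simp add: blinfun.add_left rank1_apply u_def)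
      next
        case False
        have "blinfun_apply g v = 1"
        proof -
          have "blinfun_apply g v = inverse (norm u) *\<^sub>R blinfun_apply f u"
            unfolding g_def u_def blinfun.scaleR_left blinfun.diff_left blinfun.diff_right
            by (simp only: blinfun_apply_blinfun_compose)
          also have "\<dots> = of_real (inverse (norm u) * norm u)"
            by (simp only: f(2) scaleR_conv_of_real of_real_mult)
          also have "\<dots> = 1" using False by simp
          finally show ?thesis .
        qed
        then show ?thesis using \<open>b = v\<close> by (simp add: blinfun.add_left rank1_apply u_def)
      qed
    qed
    ultimately show ?case
      using L(1) sub by (intro exI[of _ "(u, g) # L"]) auto
  qed
  then obtain L where L: "set L \<subseteq> span B \<times> dual smul" "\<And>b. b \<in> B \<Longrightarrow> blinfun_apply (op_of L) b = b"
    by blast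
  have Lb: "op_of L \<in> bounded_ops smul" using L(1) by (intro op_of_bounded_ops) auto
  have "span B \<subseteq> {b. blinfun_apply (op_of L) b = b}"
    using L(2) by (intro span_minimal subspaceI)
      (auto simp: blinfun.add_right blinfun.zero_right bounded_ops_smul[OF Lb])
  then show ?thesis using L(1) by auto
qed

lemma finite_rank_ops_eq: "finite_rank_ops smul = op_of ` {L. set L \<subseteq> UNIV \<times> dual smul}"
proof safe
  fix T assume "T \<in> finite_rank_ops smul"
  then obtain B where T: "T \<in> bounded_ops smul" "finite B" "range (blinfun_apply T) \<subseteq> span B"
    by (auto simp: finite_rank_ops_def)
  obtain L where L: "set L \<subseteq> span B \<times> dual smul" "\<And>b. b \<in> span B \<Longrightarrow> blinfun_apply (op_of L) b = b"
    using ex_projection_onto_span[OF T(2)] by blast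
  have "T = op_of L o\<^sub>L T"
  proof (rule blinfun_eqI)
    fix x
    have "blinfun_apply T x \<in> span B" using T(3) by blast
    then show "blinfun_apply T x = blinfun_apply (op_of L o\<^sub>L T) x" using L(2) by simp
  qed
  then have "T = op_of (map (\<lambda>(u, f). (u, f o\<^sub>L T)) L)"
    by (simp add: op_of_compose_right)
  moreover have "set (map (\<lambda>(u, f). (u, f o\<^sub>L T)) L) \<subseteq> UNIV \<times> dual smul"
    using L(1) dual_compose[OF _ T(1)] by auto
  ultimately show "T \<in> op_of ` {L. set L \<subseteq> UNIV \<times> dual smul}" by blast
next
  fix L :: "('e \<times> ('e \<Rightarrow>\<^sub>L 'k)) list" assume "set L \<subseteq> UNIV \<times> dual smul"
  then show "op_of L \<in> finite_rank_ops smul"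
    using op_of_bounded_ops op_of_range_span by (auto simp: finite_rank_ops_def intro!: exI[of _ "fst ` set L"])
qed

lemma op_of_image_cball:
  obtains K where "compact K" "blinfun_apply (op_of L) ` cball 0 1 \<subseteq> K"
proof -
  have "\<exists>K. compact K \<and> blinfun_apply (op_of L) ` cball 0 1 \<subseteq> K"
  proof (induction L)
    case Nil
    then show ?case by (intro exI[of _ "{0}"]) auto
  next
    case (Cons p L)
    obtain u f where p: "p = (u, f)" by (cases p)
    obtain K where K: "compact K" "blinfun_apply (op_of L) ` cball 0 1 \<subseteq> K" using Cons by blast
    define K' where "K' = (\<lambda>c. smul c u) ` cball 0 (norm f)"
    have K': "compact K'" unfolding K'_def
      by (intro compact_continuous_image compact_cball_scalar linear_continuous_on bounded_linear_smul_left)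
    have "blinfun_apply (op_of (p # L)) x \<in> {a + b | a b. a \<in> K' \<and> b \<in> K}" if "x \<in> cball 0 1" for x
    proof -
      have "norm (blinfun_apply f x) \<le> norm f"
        using that norm_blinfun[of f x] mult_left_mono[of "norm x" 1 "norm f"] by auto
      then have "smul (blinfun_apply f x) u \<in> K'" by (auto simp: K'_def)
      moreover have "blinfun_apply (op_of L) x \<in> K" using K(2) that by blast
      ultimately show ?thesis by (auto simp: p blinfun.add_left rank1_apply)
    qed
    then show ?case using compact_sums[OF K' K(1)] by blast
  qed
  then show thesis using that by blast
qed

lemma op_of_compact_ops:
  assumes "set L \<subseteq> UNIV \<times> dual smul"
  shows "op_of L \<in> compact_ops smul"
proof -
  obtain K where K: "compact K" "blinfun_apply (op_of L) ` cball 0 1 \<subseteq> K"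
    using op_of_image_cball by blast
  then have "closure (blinfun_apply (op_of L) ` cball 0 1) \<subseteq> K"
    by (intro closure_minimal compact_imp_closed)
  then have "compact (closure (blinfun_apply (op_of L) ` cball 0 1))"
    using K(1) by (metis closed_closure compact_Int_closed inf.absorb2)
  then show ?thesis using op_of_bounded_ops[OF assms] by (simp add: compact_ops_def)
qed

end

locale banach_over = normed_space_over smul
  for smul :: "'k::real_or_complex \<Rightarrow> 'e::banach \<Rightarrow> 'e"
begin

lemma compact_closure_image_cball:
  assumes z: "z \<in> closure (range op_of)"
  shows "compact (closure (blinfun_apply z ` cball 0 1))"
  unfolding compact_eq_totally_bounded
proof (intro conjI allI impI)
  let ?S = "blinfun_apply z ` cball 0 1"
  show "complete (closure ?S)" by (simp add: complete_eq_closed)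
  fix e :: real assume e: "0 < e"
  obtain L where L: "dist (op_of L) z < e / 4"
    using z e closure_approachable[of z] by (metis divide_pos_pos imageE zero_less_numeral)
  obtain K where K: "compact K" "blinfun_apply (op_of L) ` cball 0 1 \<subseteq> K"
    using op_of_image_cball by blast
  obtain k where k: "finite k" "K \<subseteq> (\<Union>x\<in>k. ball x (e / 4))"
    using K(1) e unfolding compact_eq_totally_bounded by (metis divide_pos_pos zero_less_numeral)
  have "?S \<subseteq> (\<Union>x\<in>k. cball x (e / 2))"
  proof
    fix y assume "y \<in> ?S"
    then obtain w where w: "norm w \<le> 1" "y = blinfun_apply z w" by auto
    then have "blinfun_apply (op_of L) w \<in> K" using K(2) by auto
    then obtain x where x: "x \<in> k" "dist x (blinfun_apply (op_of L) w) < e / 4" using k(2) by auto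
    have "dist (blinfun_apply (op_of L) w) y = norm (blinfun_apply (op_of L - z) w)"
      by (simp add: w dist_norm blinfun.diff_left)
    also have "\<dots> \<le> norm (op_of L - z) * 1"
      using norm_blinfun mult_left_mono[OF w(1) norm_ge_zero] order_trans by blast
    also have "\<dots> < e / 4" using L by (simp add: dist_norm)
    finally have "dist x y \<le> e / 2"
      using x(2) dist_triangle[of x y "blinfun_apply (op_of L) w"] by linarith
    then show "y \<in> (\<Union>x\<in>k. cball x (e / 2))" using x(1) by auto
  qed
  then have "closure ?S \<subseteq> (\<Union>x\<in>k. cball x (e / 2))"
    using k(1) by (intro closure_minimal closed_UN) auto
  also have "\<dots> \<subseteq> (\<Union>x\<in>k. ball x e)" using e by (intro UN_mono) auto
  finally show "\<exists>k. finite k \<and> closure ?S \<subseteq> (\<Union>x\<in>k. ball x e)" using k(1) by blast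
qed

end

section \<open>Reflexive spaces\<close>

lemma norm_blinfun_le:
  assumes "\<And>x. norm x \<le> 1 \<Longrightarrow> norm (blinfun_apply T x) \<le> M"
  shows "norm T \<le> M"
proof (rule norm_blinfun_bound)
  show M: "0 \<le> M" using assms[of 0] by (simp add: blinfun.zero_right)
  show "norm (blinfun_apply T x) \<le> M * norm x" for x
  proof (cases "x = 0")
    case False
    have "norm (blinfun_apply T (inverse (norm x) *\<^sub>R x)) \<le> M"
      using False by (intro assms) simp
    then show ?thesis using False by (simp add: blinfun.scaleR_right field_simps)
  qed (simp add: blinfun.zero_right)
qed

lemma ex_almost_norming:
  fixes T :: "'a::real_normed_vector \<Rightarrow>\<^sub>L 'b::real_normed_vector"
  assumes "0 < d"
  shows "\<exists>x. norm x \<le> 1 \<and> norm T - d \<le> norm (blinfun_apply T x)"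
proof (rule ccontr)
  assume "\<not> ?thesis"
  then have "norm T \<le> norm T - d" by (intro norm_blinfun_le) (meson not_le less_imp_le)
  then show False using assms by simp
qed

text \<open>With this multiplication the Hahn-Banach theorem applies to functionals as vectors, and
  \<open>dual fmul\<close> can play the bidual. The ambient type also contains maps that are only
  real linear, so \<open>dual smul\<close> enters as a closed subspace.\<close>

definition fmul :: "'k::real_or_complex \<Rightarrow> ('e::real_normed_vector \<Rightarrow>\<^sub>L 'k) \<Rightarrow> ('e \<Rightarrow>\<^sub>L 'k)" where
  "fmul c f = blinfun_mult_right c o\<^sub>L f"

lemma fmul_apply [simp]: "blinfun_apply (fmul c f) x = c * blinfun_apply f x"
  by (simp add: fmul_def)

lemma normed_space_over_fmul: "normed_space_over (fmul :: 'k::real_or_complex \<Rightarrow> ('e::real_normed_vector \<Rightarrow>\<^sub>L 'k) \<Rightarrow> _)"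
proof
  have le: "norm (fmul c f) \<le> norm c * norm f" for c :: 'k and f :: "'e \<Rightarrow>\<^sub>L 'k"
    by (intro norm_blinfun_bound)
      (auto simp: norm_mult mult.assoc intro!: mult_left_mono norm_blinfun)
  show "norm (fmul c f) = norm c * norm f" for c :: 'k and f :: "'e \<Rightarrow>\<^sub>L 'k"
  proof (cases "c = 0")
    case True
    then show ?thesis using le[of c f] by simp
  next
    case False
    have "f = fmul (inverse c) (fmul c f)" using False by (intro blinfun_eqI) simp
    then have "norm f \<le> norm (inverse c) * norm (fmul c f)" using le by metis
    then have "norm f \<le> inverse (norm c) * norm (fmul c f)" by (simp only: norm_inverse)
    then have "norm c * norm f \<le> norm (fmul c f)" using False by (simp add: field_simps)
    then show ?thesis using le[of c f] by simp
  qed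
qed (auto intro!: blinfun_eqI simp: blinfun.add_left blinfun.add_right blinfun.scaleR_left scaleR_conv_of_real algebra_simps)

lemma ex_countable_dense_scalars:
  obtains Q :: "'k::real_or_complex set" where "countable Q" "closure Q = UNIV"
proof -
  obtain j :: 'k where j: "\<And>z. \<exists>a b. z = of_real a + of_real b * j"
    by (rule ex_re) blast
  define h where "h = (\<lambda>(a::real, b::real). of_real a + of_real b * j)"
  have "h ` closure (\<rat> \<times> \<rat>) \<subseteq> closure (h ` (\<rat> \<times> \<rat>))"
    unfolding h_def by (intro closure_subset image_closure_subset continuous_intros)
      (auto simp: case_prod_unfold intro!: continuous_intros)
  moreover have "range h = UNIV" using j by (auto simp: h_def image_iff case_prod_unfold)
  ultimately have "closure (h ` (\<rat> \<times> \<rat>)) = UNIV"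
    by (simp add: closure_Times Rats_closure_real top.extremum_unique)
  then show thesis
    by (intro that[of "h ` (\<rat> \<times> \<rat>)"] countable_image countable_SIGMA countable_rat)
qed

context normed_space_over
begin

lemma bounded_bilinear_smul: "bounded_bilinear smul"
proof
  show "\<exists>K. \<forall>a b. norm (smul a b) \<le> norm a * norm b * K"
    by (rule exI[of _ 1]) (simp add: norm_smul)
  show "smul (r *\<^sub>R a) b = r *\<^sub>R smul a b" for r a b
    by (simp add: scaleR_conv_of_real smul_of_real flip: scale_scale)
qed (auto simp: scale_left_distrib scale_right_distrib smul_scaleR)

text \<open>With a countable dense \<open>Q\<close>, a countable set can satisfy the hypotheses;
  this is what keeps the generated closed subspaces separable.\<close>

lemma subspace_closure:
  assumes Q: "closure Q = UNIV" and S0: "0 \<in> S"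
    and S: "\<And>q u v. q \<in> Q \<Longrightarrow> u \<in> S \<Longrightarrow> v \<in> S \<Longrightarrow> smul q u + v \<in> S"
  shows "subspace (closure S)"
proof -
  define h where "h = (\<lambda>(q, u, v). smul q u + v)"
  have "h ` closure (Q \<times> S \<times> S) \<subseteq> closure S"
  proof (rule image_closure_subset)
    show "continuous_on (closure (Q \<times> S \<times> S)) h"
      unfolding h_def case_prod_unfold
      by (intro continuous_intros bounded_bilinear.continuous_on[OF bounded_bilinear_smul])
    show "h ` (Q \<times> S \<times> S) \<subseteq> closure S"
      using S closure_subset[of S] by (auto simp: h_def)
  qed simp
  then have comb: "smul q u + v \<in> closure S" if "u \<in> closure S" "v \<in> closure S" for q u v
    using that Q by (force simp: closure_Times h_def)
  have "0 \<in> closure S" using S0 closure_subset by blast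
  then show ?thesis
    using comb[of _ _ 1] comb[of _ 0] by (intro subspaceI) auto
qed

lemma closed_bounded_ops: "closed (bounded_ops smul)"
proof -
  have "bounded_ops smul = (\<Inter>c. \<Inter>x. {T. blinfun_apply T (smul c x) = smul c (blinfun_apply T x)})"
    by (auto simp: bounded_ops_def)
  also have "closed \<dots>"
    by (intro closed_INT ballI closed_Collect_eq continuous_intros
      bounded_linear.continuous_on[OF bounded_linear_smul_right])
  finally show ?thesis .
qed

lemma closed_dual: "closed (dual smul)"
proof -
  have "dual smul = (\<Inter>c. \<Inter>x. {f. blinfun_apply f (smul c x) = c * blinfun_apply f x})"
    by (auto simp: dual_def)
  also have "closed \<dots>"
    by (intro closed_INT ballI closed_Collect_eq continuous_intros)
  finally show ?thesis .
qed

lemma dual_fmul: "f \<in> dual smul \<Longrightarrow> fmul c f \<in> dual smul"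
  and dual_add: "f \<in> dual smul \<Longrightarrow> g \<in> dual smul \<Longrightarrow> f + g \<in> dual smul"
  and dual_zero: "0 \<in> dual smul"
  by (simp_all add: dual_def blinfun.add_left algebra_simps)

lemma bidual_represented:
  assumes "reflexive_space smul" "\<Phi> \<in> dual fmul"
  obtains x where "\<And>f. f \<in> dual smul \<Longrightarrow> blinfun_apply \<Phi> f = blinfun_apply f x"
proof -
  have eq: "g = fmul c f" if "\<forall>x. blinfun_apply g x = c * blinfun_apply f x" for c g f
    using that by (intro blinfun_eqI) simp
  have "bidual_functional smul (blinfun_apply \<Phi>)"
    unfolding bidual_functional_def
  proof (intro conjI ballI allI impI)
    show "\<exists>C. \<forall>f\<in>dual smul. norm (blinfun_apply \<Phi> f) \<le> C * norm f"
      using norm_blinfun by blast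
    show "blinfun_apply \<Phi> g = c * blinfun_apply \<Phi> f"
      if "\<forall>x. blinfun_apply g x = c * blinfun_apply f x" for c f g
      using assms(2) eq[OF that] by (simp add: dual_def)
  qed (simp add: blinfun.add_right)
  then show thesis using assms(1) that by (auto simp: reflexive_space_def)
qed

text \<open>Reflexivity makes norm-closed subspaces of the dual weak* closed: a functional on the
  dual that separates \<open>f\<close> from \<open>F\<close> is evaluation at a point where
  \<open>F\<close> vanishes and \<open>f\<close> does not.\<close>

lemma in_closed_subspace_of_dual:
  fixes F :: "('e \<Rightarrow>\<^sub>L 'k) set"
  assumes refl: "reflexive_space smul" and F: "module.subspace fmul F" "closed F" "F \<subseteq> dual smul"
    and f: "f \<in> dual smul" "\<And>x. (\<And>g. g \<in> F \<Longrightarrow> blinfun_apply g x = 0) \<Longrightarrow> blinfun_apply f x = 0"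
  shows "f \<in> F"
proof (rule ccontr)
  assume "f \<notin> F"
  interpret D: normed_space_over "fmul :: 'k \<Rightarrow> ('e \<Rightarrow>\<^sub>L 'k) \<Rightarrow> _"
    by (rule normed_space_over_fmul)
  obtain \<Phi> where \<Phi>: "\<Phi> \<in> dual fmul" "\<And>g. g \<in> F \<Longrightarrow> blinfun_apply \<Phi> g = 0" "blinfun_apply \<Phi> f = 1"
    using D.functional_vanishing_on_closed_subspace[OF F(1,2) \<open>f \<notin> F\<close>] by blast
  obtain x where x: "\<And>f. f \<in> dual smul \<Longrightarrow> blinfun_apply \<Phi> f = blinfun_apply f x"
    using bidual_represented[OF refl \<Phi>(1)] by blast
  have "blinfun_apply f x = 0" using F(3) \<Phi>(2) x by (intro f(2)) (metis subsetD)
  then show False using x[OF f(1)] \<Phi>(3) by simp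
qed

end

context banach_over
begin

text \<open>
  A maximal vector \<open>y\<close> in the compact closure of the image of the unit ball defines the
  functional \<open>f \<circ> z \<mapsto> f y\<close> on a subspace of the dual; an extension of norm at most one is
  evaluation at a preimage of \<open>y\<close>.
\<close>

lemma norm_attained:
  assumes refl: "reflexive_space smul"
    and z: "z \<in> closure (op_of ` {L. set L \<subseteq> UNIV \<times> dual smul})"
  obtains u f where "norm u \<le> 1" "f \<in> dual smul" "norm f \<le> 1"
    "blinfun_apply f (blinfun_apply z u) = of_real (norm z)"
proof -
  interpret D: normed_space_over "fmul :: 'k \<Rightarrow> ('e \<Rightarrow>\<^sub>L 'k) \<Rightarrow> _"
    by (rule normed_space_over_fmul)
  have zb: "z \<in> bounded_ops smul"
    using z closed_bounded_ops op_of_bounded_ops closure_minimal[of "op_of ` {L. set L \<subseteq> UNIV \<times> dual smul}" "bounded_ops smul"]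
    by blast
  let ?S = "blinfun_apply z ` cball 0 1"
  have "z \<in> closure (range op_of)" using z closure_mono[of "op_of ` _" "range op_of"] by blast
  then have "compact (closure ?S)" by (rule compact_closure_image_cball)
  then obtain y where y: "y \<in> closure ?S" "\<And>v. v \<in> closure ?S \<Longrightarrow> norm v \<le> norm y"
    using compact_attains_sup[of "norm ` closure ?S"]
    by (force intro: compact_continuous_image continuous_intros)
  have zy: "norm z \<le> norm y"
    by (rule norm_blinfun_le, rule y(2), rule subsetD[OF closure_subset]) simp
  \<comment> \<open>This estimate makes the functional \<open>g\<close> below independent of the
    chosen \<open>f\<close> and bounds it by one.\<close>
  have fy: "norm (blinfun_apply f y) \<le> norm (f o\<^sub>L z)" for f :: "'e \<Rightarrow>\<^sub>L 'k"
  proof -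
    have "closed {v. norm (blinfun_apply f v) \<le> norm (f o\<^sub>L z)}"
      by (intro closed_Collect_le continuous_intros)
    moreover have "norm (blinfun_apply f (blinfun_apply z x)) \<le> norm (f o\<^sub>L z)" if "norm x \<le> 1" for x
      using norm_blinfun[of "f o\<^sub>L z" x] mult_left_mono[OF that norm_ge_zero[of "f o\<^sub>L z"]] by simp
    ultimately have "closure ?S \<subseteq> {v. norm (blinfun_apply f v) \<le> norm (f o\<^sub>L z)}"
      by (intro closure_minimal) auto
    then show ?thesis using y(1) by blast
  qed
  define W where "W = (\<lambda>f. f o\<^sub>L z) ` dual smul"
  define g where "g h = blinfun_apply (SOME f. f \<in> dual smul \<and> h = f o\<^sub>L z) y" for h
  have g: "g (f o\<^sub>L z) = blinfun_apply f y" if f: "f \<in> dual smul" for f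
  proof -
    define f' where "f' = (SOME f'. f' \<in> dual smul \<and> f o\<^sub>L z = f' o\<^sub>L z)"
    have "f' \<in> dual smul \<and> f o\<^sub>L z = f' o\<^sub>L z" unfolding f'_def using f by (rule someI[where x = f, OF conjI]) simp
    then have "(f' - f) o\<^sub>L z = 0"
      using bounded_bilinear.diff_left[OF bounded_bilinear_blinfun_compose, of f' f z] by simp
    then have "blinfun_apply (f' - f) y = 0" using fy[of "f' - f"] by simp
    then show ?thesis by (simp add: g_def f'_def blinfun.diff_left)
  qed
  have fm: "fmul c (f o\<^sub>L z) = fmul c f o\<^sub>L z" for c f by (intro blinfun_eqI) simp
  have ad: "(f o\<^sub>L z) + (h o\<^sub>L z) = (f + h) o\<^sub>L z" for f h :: "'e \<Rightarrow>\<^sub>L 'k"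
    by (intro blinfun_eqI) (simp add: blinfun.add_left)
  have W: "D.subspace W"
  proof (rule D.subspaceI)
    show "0 \<in> W" unfolding W_def using dual_zero by (intro image_eqI[of _ _ 0]) (auto intro!: blinfun_eqI)
    show "f + h \<in> W" if "f \<in> W" "h \<in> W" for f h
      using that dual_add unfolding W_def by (auto simp: ad)
    show "fmul c f \<in> W" if "f \<in> W" for c f
      using that dual_fmul unfolding W_def by (auto simp: fm)
  qed
  obtain \<Phi> where \<Phi>: "\<Phi> \<in> dual fmul" "norm \<Phi> \<le> 1" "\<And>h. h \<in> W \<Longrightarrow> blinfun_apply \<Phi> h = g h"
  proof (rule D.Hahn_Banach[OF W, of 1 g])
    show "g (f + h) = g f + g h" if "f \<in> W" "h \<in> W" for f h
      using that dual_add unfolding W_def by (auto simp: ad g blinfun.add_left)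
    show "g (fmul c f) = c * g f" if "f \<in> W" for c f
      using that dual_fmul unfolding W_def by (auto simp: fm g)
    show "norm (g f) \<le> 1 * norm f" if "f \<in> W" for f
      using that fy unfolding W_def by (auto simp: g)
  qed auto
  obtain u where u: "\<And>f. f \<in> dual smul \<Longrightarrow> blinfun_apply \<Phi> f = blinfun_apply f u"
    using bidual_represented[OF refl \<Phi>(1)] by blast
  have "blinfun_apply z u = y"
  proof (rule eq_by_functionals)
    fix f assume f: "f \<in> dual smul"
    have "f o\<^sub>L z \<in> W" using f by (simp add: W_def)
    then show "blinfun_apply f (blinfun_apply z u) = blinfun_apply f y"
      using \<Phi>(3)[of "f o\<^sub>L z"] u[OF dual_compose[OF f zb]] g[OF f] by simp
  qed
  moreover have u1: "norm u \<le> 1"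
  proof (rule norm_le_by_functionals)
    fix f assume f: "f \<in> dual smul" "norm f \<le> 1"
    have "norm (blinfun_apply \<Phi> f) \<le> norm \<Phi> * norm f" by (rule norm_blinfun)
    also have "\<dots> \<le> 1" using f \<Phi>(2) by (simp add: mult_le_one)
    finally show "norm (blinfun_apply f u) \<le> 1" using u[OF f(1)] by simp
  qed
  moreover have "norm (blinfun_apply z u) \<le> norm z"
    using norm_blinfun[of z u] mult_left_mono[OF u1 norm_ge_zero[of z]] by simp
  ultimately have "norm y = norm z" using zy by simp
  moreover obtain f where "f \<in> dual smul" "norm f \<le> 1" "blinfun_apply f y = of_real (norm y)"
    using norming_functional by blast
  ultimately show thesis using that u1 \<open>blinfun_apply z u = y\<close> by metis
qed

text \<open>Vectors and functionals are closed off together: each vector receives a norming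
  functional, each functional a sequence of almost norming vectors. The first makes the projection
  onto \<open>closure U\<close> along the common kernel \<open>N\<close> of \<open>closure G\<close>
  contractive; the second, with reflexivity, shows that the two subspaces span everything.\<close>

lemma ex_separable_projection:
  fixes V :: "'e set"
  assumes refl: "reflexive_space smul" and V: "countable V"
  obtains U G P where "countable U" "countable G" "V \<subseteq> U" "G \<subseteq> dual smul"
    "P \<in> bounded_ops smul" "norm P \<le> 1"
    "\<And>x. blinfun_apply P x \<in> closure U" "\<And>x. x \<in> closure U \<Longrightarrow> blinfun_apply P x = x"
    "\<And>f. f \<in> dual smul \<Longrightarrow> f o\<^sub>L P \<in> closure G" "\<And>f. f \<in> closure G \<Longrightarrow> f o\<^sub>L P = f"
proof -
  interpret D: normed_space_over "fmul :: 'k \<Rightarrow> ('e \<Rightarrow>\<^sub>L 'k) \<Rightarrow> _"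
    by (rule normed_space_over_fmul)
  obtain Q :: "'k set" where Q: "countable Q" "closure Q = UNIV"
    by (rule ex_countable_dense_scalars)
  have "\<exists>f. f \<in> dual smul \<and> norm f \<le> 1 \<and> blinfun_apply f v = of_real (norm v)" for v
    using norming_functional by blast
  then obtain h where h: "\<And>v. h v \<in> dual smul" "\<And>v. norm (h v) \<le> 1"
    "\<And>v. blinfun_apply (h v) v = of_real (norm v)"
    by metis
  have "\<forall>f m. \<exists>w. norm w \<le> 1 \<and> norm f - inverse (real (Suc m)) \<le> norm (blinfun_apply f w)"
    for f :: "'e \<Rightarrow>\<^sub>L 'k" and m
    by (intro allI ex_almost_norming) simp
  then obtain w where w: "\<And>f m. norm (w f m) \<le> 1"
    "\<And>(f::'e \<Rightarrow>\<^sub>L 'k) m. norm f - inverse (real (Suc m)) \<le> norm (blinfun_apply f (w f m))"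
    by metis
  \<comment> \<open>Combining pairs coordinatewise lets one countable iteration serve both sides;
    each coordinate projection of \<open>XX\<close> inherits the closure property.\<close>
  define comb where "comb q p p' = (smul q (fst p) + fst p', fmul q (snd p) + snd p')"
    for q and p p' :: "'e \<times> ('e \<Rightarrow>\<^sub>L 'k)"
  define step where "step S = S \<union> (\<lambda>(q, p, p'). comb q p p') ` (Q \<times> S \<times> S)
      \<union> (\<lambda>(p, m). (w (snd p) m, h (fst p))) ` (S \<times> UNIV)" for S
  define X where "X n = (step ^^ n) (insert 0 V \<times> {0})" for n
  define XX where "XX = (\<Union>n. X n)"
  have XS: "X (Suc n) = step (X n)" for n by (simp add: X_def)
  have X0: "X 0 = insert 0 V \<times> {0}" by (simp add: X_def)
  have "mono X" by (rule incseq_SucI) (auto simp: XS step_def)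
  have "countable (X n)" for n
  proof (induction n)
    case (Suc n)
    then show ?case unfolding XS step_def using Q(1) by (intro countable_Un countable_image countable_SIGMA) auto
  qed (use V in \<open>simp add: X0\<close>)
  then have cX: "countable XX" by (simp add: XX_def)
  have XXcomb: "comb q p p' \<in> XX" if "q \<in> Q" "p \<in> XX" "p' \<in> XX" for q p p'
  proof -
    obtain m n where mn: "p \<in> X m" "p' \<in> X n" using \<open>p \<in> XX\<close> \<open>p' \<in> XX\<close> by (auto simp: XX_def)
    then have "p \<in> X (max m n)" "p' \<in> X (max m n)"
      using monoD[OF \<open>mono X\<close>, of m "max m n"] monoD[OF \<open>mono X\<close>, of n "max m n"] by auto
    then have "comb q p p' \<in> X (Suc (max m n))"
      unfolding XS step_def using \<open>q \<in> Q\<close> by (intro UnI1 UnI2 image_eqI[of _ _ "(q, p, p')"]) auto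
    then show ?thesis by (auto simp: XX_def)
  qed
  have XXwh: "(w (snd p) m, h (fst p)) \<in> XX" if "p \<in> XX" for p m
  proof -
    obtain n where "p \<in> X n" using \<open>p \<in> XX\<close> by (auto simp: XX_def)
    then have "(w (snd p) m, h (fst p)) \<in> X (Suc n)"
      unfolding XS step_def by (intro UnI2 image_eqI[of _ _ "(p, m)"]) auto
    then show ?thesis by (auto simp: XX_def)
  qed
  define U where "U = fst ` XX"
  define G where "G = snd ` XX"
  have "X n \<subseteq> UNIV \<times> dual smul" for n
  proof (induction n)
    case (Suc n)
    have cmb: "comb q p p' \<in> UNIV \<times> dual smul" if "p \<in> X n" "p' \<in> X n" for q p p'
      using subsetD[OF Suc that(1)] subsetD[OF Suc that(2)]
      by (auto simp: comb_def intro!: dual_add dual_fmul)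
    have "(case x of (q, p, p') \<Rightarrow> comb q p p') \<in> UNIV \<times> dual smul" if "x \<in> Q \<times> X n \<times> X n" for x
      using that cmb[of "fst (snd x)" "snd (snd x)" "fst x"]
      by (simp only: mem_Times_iff case_prod_unfold)
    then have "(\<lambda>(q, p, p'). comb q p p') ` (Q \<times> X n \<times> X n) \<subseteq> UNIV \<times> dual smul"
      by (rule image_subsetI)
    then show ?case
      using Suc unfolding XS step_def by (intro Un_least) (auto simp: h)
  qed (auto simp: X0 dual_zero)
  then have Gd: "G \<subseteq> dual smul" unfolding G_def XX_def by fastforce
  have X0': "fst ` X 0 \<subseteq> U" "snd ` X 0 \<subseteq> G" by (auto simp: XX_def U_def G_def intro!: imageI)
  then have VU: "V \<subseteq> U" and U0: "0 \<in> U" and G0: "0 \<in> G"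
    by (auto simp: X0)
  have hG: "h u \<in> G" if "u \<in> U" for u
    using that XXwh by (force simp: U_def G_def)
  have wU: "w g m \<in> U" if "g \<in> G" for g m
    using that XXwh by (force simp: U_def G_def)
  have Ucomb: "smul q u + v \<in> U" if "q \<in> Q" "u \<in> U" "v \<in> U" for q u v
    using that XXcomb by (force simp: U_def comb_def)
  have Gcomb: "fmul q u + v \<in> G" if "q \<in> Q" "u \<in> G" "v \<in> G" for q u v
    using that XXcomb by (force simp: G_def comb_def)
  define E where "E = closure U"
  define F where "F = closure G"
  define N where "N = {x. \<forall>g\<in>F. blinfun_apply g x = 0}"
  have E: "subspace E" "closed E" unfolding E_def using Q(2) U0 Ucomb by (auto intro: subspace_closure)
  have F: "D.subspace F" "closed F" unfolding F_def using Q(2) G0 Gcomb by (auto intro: D.subspace_closure)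
  have Fd: "F \<subseteq> dual smul" unfolding F_def using Gd closed_dual by (intro closure_minimal)
  have GF: "G \<subseteq> F" and UE: "U \<subseteq> E" unfolding F_def E_def by (rule closure_subset)+
  have N: "subspace N" 
    using Fd by (intro subspaceI) (auto simp: N_def blinfun.zero_right blinfun.add_right dual_smul subset_iff)
  have closedN: "closed N"
  proof -
    have "N = (\<Inter>g\<in>F. {x. blinfun_apply g x = 0})" by (auto simp: N_def)
    also have "closed \<dots>" by (intro closed_INT ballI closed_Collect_eq continuous_intros)
    finally show ?thesis .
  qed
  \<comment> \<open>Norming functionals of vectors in \<open>U\<close> vanish on \<open>N\<close>,
    so adding an element of \<open>N\<close> cannot shorten the vector. Uniqueness of the
    decomposition, closedness of the sum and the bound for the projection all come from
    this.\<close>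
  have le: "norm v \<le> norm (v + x)" if "v \<in> E" "x \<in> N" for v x
  proof -
    have "norm u \<le> norm (u + x)" if "u \<in> U" for u
    proof -
      have "h u \<in> F" using hG[OF that] GF by blast
      then have "of_real (norm u) = blinfun_apply (h u) (u + x)"
        using \<open>x \<in> N\<close> h(3)[of u] by (simp add: N_def blinfun.add_right)
      then have "norm u = norm (blinfun_apply (h u) (u + x))" by (metis abs_norm_cancel norm_of_real)
      also have "\<dots> \<le> norm (h u) * norm (u + x)" by (rule norm_blinfun)
      also have "\<dots> \<le> 1 * norm (u + x)" using h(2) by (intro mult_right_mono) auto
      finally show ?thesis by simp
    qed
    moreover have "closed {v. norm v \<le> norm (v + x)}" by (intro closed_Collect_le continuous_intros)
    ultimately have "E \<subseteq> {v. norm v \<le> norm (v + x)}"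
      unfolding E_def by (intro closure_minimal) auto
    then show ?thesis using that by blast
  qed
  \<comment> \<open>Since \<open>U\<close> almost norms \<open>G\<close>, subtracting an
    \<open>f\<close> that vanishes on \<open>U\<close> never shortens a member of \<open>G\<close>,
    hence of its closure; applied to \<open>f\<close> itself this gives zero.\<close>
  have Fzero: "f = 0" if f: "f \<in> F" "\<And>u. u \<in> U \<Longrightarrow> blinfun_apply f u = 0" for f
  proof -
    have "norm g \<le> norm (g - f)" if g: "g \<in> G" for g
    proof (rule field_le_epsilon)
      fix e :: real assume "0 < e"
      then obtain m where m: "inverse (real (Suc m)) < e" using reals_Archimedean by blast
      have "norm (blinfun_apply g (w g m)) = norm (blinfun_apply (g - f) (w g m))"
        using f(2)[OF wU[OF g]] by (simp add: blinfun.diff_left)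
      also have "\<dots> \<le> norm (g - f) * 1"
        using norm_blinfun[of "g - f" "w g m"] mult_left_mono[OF w(1) norm_ge_zero] order_trans by blast
      finally show "norm g \<le> norm (g - f) + e" using w(2)[of g m] m by simp
    qed
    moreover have "closed {g. norm g \<le> norm (g - f)}" by (intro closed_Collect_le continuous_intros)
    ultimately have "F \<subseteq> {g. norm g \<le> norm (g - f)}"
      unfolding F_def by (intro closure_minimal) auto
    then show ?thesis using f(1) by force
  qed
  have FI: "f \<in> F" if "f \<in> dual smul" "\<And>x. x \<in> N \<Longrightarrow> blinfun_apply f x = 0" for f
    using in_closed_subspace_of_dual[OF refl F Fd that(1)] that(2) by (auto simp: N_def)
  define W where "W = {v + x | v x. v \<in> E \<and> x \<in> N}"
  have "closed W"
    unfolding closed_sequential_limits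
  proof (intro allI impI)
    fix s l assume "(\<forall>n. s n \<in> W) \<and> s \<longlonglongrightarrow> l"
    then have sW: "\<And>n. s n \<in> W" and sl: "s \<longlonglongrightarrow> l" by auto
    have "\<exists>v. v \<in> E \<and> s n - v \<in> N" for n using sW[of n] by (auto simp: W_def)
    then obtain v where v: "\<And>n. v n \<in> E" "\<And>n. s n - v n \<in> N" by metis
    have "dist (v m) (v n) \<le> dist (s m) (s n)" for m n
      using le[OF subspace_diff[OF E(1) v(1) v(1)] subspace_diff[OF N v(2) v(2)], of m n m n]
      by (simp add: dist_norm)
    then have "Cauchy v"
      using LIMSEQ_imp_Cauchy[OF sl] unfolding Cauchy_def by (meson le_less_trans)
    then obtain a where a: "v \<longlonglongrightarrow> a" using Cauchy_convergent convergentD by blast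
    have "a \<in> E" using closed_sequentially[OF E(2) _ a] v(1) by blast
    moreover have "l - a \<in> N"
      using closed_sequentially[OF closedN _ tendsto_diff[OF sl a]] v(2) by blast
    ultimately show "l \<in> W" unfolding W_def by (intro CollectI exI[of _ a] exI[of _ "l - a"]) simp
  qed
  have subW: "subspace W"
  proof (rule subspaceI)
    show "0 \<in> W" using subspace_0[OF E(1)] subspace_0[OF N] unfolding W_def by force
    show "x + y \<in> W" if "x \<in> W" "y \<in> W" for x y
    proof -
      obtain a b c d where "a \<in> E" "b \<in> N" "x = a + b" "c \<in> E" "d \<in> N" "y = c + d"
        using \<open>x \<in> W\<close> \<open>y \<in> W\<close> by (auto simp: W_def)
      then show ?thesis unfolding W_def
        by (intro CollectI exI[of _ "a + c"] exI[of _ "b + d"]) (auto intro: subspace_add E N)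
    qed
    show "smul r x \<in> W" if "x \<in> W" for r x
    proof -
      obtain a b where "a \<in> E" "b \<in> N" "x = a + b" using \<open>x \<in> W\<close> by (auto simp: W_def)
      then show ?thesis unfolding W_def
        by (intro CollectI exI[of _ "smul r a"] exI[of _ "smul r b"])
          (auto intro: subspace_scale E N simp: scale_right_distrib)
    qed
  qed
  \<comment> \<open>A functional that vanishes on \<open>E\<close> and on \<open>N\<close> lies in
    \<open>F\<close> because of \<open>N\<close>, and is then zero because of
    \<open>E\<close>.\<close>
  have WU: "W = UNIV"
  proof (rule ccontr)
    assume "W \<noteq> UNIV"
    then obtain x where "x \<notin> W" by auto
    then obtain f where f: "f \<in> dual smul" "\<And>v. v \<in> W \<Longrightarrow> blinfun_apply f v = 0" "blinfun_apply f x = 1"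
      using functional_vanishing_on_closed_subspace[OF subW \<open>closed W\<close>] by blast
    have EW: "E \<subseteq> W" using subspace_0[OF N] unfolding W_def by force
    have NW: "N \<subseteq> W" using subspace_0[OF E(1)] unfolding W_def by force
    have "f \<in> F" using f(1,2) NW by (intro FI) auto
    then have "f = 0" using f(2) UE EW by (intro Fzero) auto
    then show False using f(3) by simp
  qed
  have "\<exists>p. p \<in> E \<and> x - p \<in> N" for x
  proof -
    have "x \<in> W" by (simp add: WU)
    then show ?thesis by (auto simp: W_def)
  qed
  then obtain p where p: "\<And>x. p x \<in> E" "\<And>x. x - p x \<in> N" by metis
  have puniq: "p x = v" if "v \<in> E" "x - v \<in> N" for x v
  proof -
    have "norm (p x - v) \<le> norm ((p x - v) + ((x - p x) - (x - v)))"
      by (rule le[OF subspace_diff[OF E(1) p(1) that(1)] subspace_diff[OF N p(2) that(2)]])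
    then show ?thesis by simp
  qed
  have padd: "p (x + y) = p x + p y" for x y
    using subspace_add[OF N p(2)[of x] p(2)[of y]] p(1)
    by (intro puniq subspace_add[OF E(1)]) (auto simp: algebra_simps)
  have psmul: "p (smul c x) = smul c (p x)" for c x
    using subspace_scale[OF N p(2)[of x]] p(1)
    by (intro puniq subspace_scale[OF E(1)]) (auto simp: scale_right_diff_distrib)
  have pn: "norm (p x) \<le> norm x" for x
    using le[OF p(1) p(2), of x x] by simp
  have bl: "bounded_linear p"
    using pn psmul[of "of_real _"] by (intro bounded_linear_intro[where K = 1]) (auto simp: padd smul_of_real)
  define P where "P = Blinfun p"
  have P: "blinfun_apply P x = p x" for x by (simp add: P_def bounded_linear_Blinfun_apply[OF bl])
  show thesis
  proof (rule that[of U G P])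
    show "countable U" "countable G" unfolding U_def G_def using cX by auto
    show "P \<in> bounded_ops smul" by (simp add: bounded_ops_def P psmul)
    show "norm P \<le> 1" by (rule norm_blinfun_bound) (auto simp: P pn)
    show "blinfun_apply P x \<in> closure U" for x using p(1) by (simp add: P E_def)
    show "blinfun_apply P x = x" if "x \<in> closure U" for x
      using that subspace_0[OF N] by (auto simp: P E_def intro!: puniq)
    show "f o\<^sub>L P \<in> closure G" if f: "f \<in> dual smul" for f
    proof -
      have "f o\<^sub>L P \<in> F"
      proof (rule FI)
        show "f o\<^sub>L P \<in> dual smul" by (rule dual_compose[OF f \<open>P \<in> bounded_ops smul\<close>])
        fix x assume "x \<in> N"
        then have "p x = 0" using subspace_0[OF E(1)] by (intro puniq) auto
        then show "blinfun_apply (f o\<^sub>L P) x = 0" by (simp add: P blinfun.zero_right)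
      qed
      then show ?thesis by (simp add: F_def)
    qed
    show "f o\<^sub>L P = f" if "f \<in> closure G" for f
    proof (rule blinfun_eqI)
      fix x
      have "blinfun_apply f (x - p x) = 0" using p(2)[of x] that by (simp add: N_def F_def)
      then show "blinfun_apply (f o\<^sub>L P) x = blinfun_apply f x" by (simp add: P blinfun.diff_right)
    qed
  qed (use VU Gd in auto)
qed

end

section \<open>Elementary functionals\<close>

lemma compact_null_set:
  fixes K :: "'a::real_normed_vector set"
  assumes "0 \<in> K" and fin: "\<And>e. 0 < e \<Longrightarrow> finite {x \<in> K. e \<le> norm x}"
  shows "compact K"
proof (rule compactI)
  fix C :: "'a set set" assume C: "\<forall>t\<in>C. open t" "K \<subseteq> \<Union>C"
  then obtain T where T: "T \<in> C" "0 \<in> T" using assms(1) by blast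
  then obtain e where e: "0 < e" "ball 0 e \<subseteq> T" using C(1) open_contains_ball by blast
  have "\<forall>x\<in>K. \<exists>t. t \<in> C \<and> x \<in> t" using C(2) by blast
  then obtain c where c: "\<And>x. x \<in> K \<Longrightarrow> c x \<in> C \<and> x \<in> c x" by (auto dest!: bchoice)
  let ?C = "insert T (c ` {x \<in> K. e \<le> norm x})"
  have "x \<in> \<Union>?C" if "x \<in> K" for x
    using that c e(2) by (cases "e \<le> norm x") (auto simp: subset_iff)
  moreover have "?C \<subseteq> C" "finite ?C" using T c fin[OF e(1)] by auto
  ultimately show "\<exists>C'\<subseteq>C. finite C' \<and> K \<subseteq> \<Union>C'" by blast
qed

lemma sublinear_norm_plus_linear:
  assumes "0 \<le> e" "linear g"
  shows "sublinear (\<lambda>x. e * norm x + g x)"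
proof (rule sublinearI)
  interpret linear g by fact
  show "e * norm (x + y) + g (x + y) \<le> e * norm x + g x + (e * norm y + g y)" for x y
    using mult_left_mono[OF norm_triangle_ineq assms(1), of x y] by (simp add: add distrib_left)
  show "e * norm (r *\<^sub>R x) + g (r *\<^sub>R x) \<le> r * (e * norm x + g x)" if "0 < r" for r x
    using that by (simp add: scale algebra_simps)
  show "e * norm (0::'a) + g 0 = 0" by (simp add: zero)
qed

text \<open>The range of \<open>P\<close> is the separable space, and \<open>closure G\<close>, the
  functionals with \<open>f o\<^sub>L P = f\<close>, is its dual. Compressed operators on all of
  \<open>E\<close> spare a separate type for the subspace.\<close>

locale separable_projection = banach_over smul
  for smul :: "'k::real_or_complex \<Rightarrow> 'e::banach \<Rightarrow> 'e" +
  fixes U :: "'e set" and G :: "('e \<Rightarrow>\<^sub>L 'k) set" and P :: "'e \<Rightarrow>\<^sub>L 'e"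
  assumes refl: "reflexive_space smul"
    and countable_U: "countable U" and countable_G: "countable G"
    and G_dual: "G \<subseteq> dual smul"
    and P_bounded: "P \<in> bounded_ops smul" and norm_P: "norm P \<le> 1"
    and P_in: "blinfun_apply P x \<in> closure U"
    and P_id: "x \<in> closure U \<Longrightarrow> blinfun_apply P x = x"
    and P_dual_in: "f \<in> dual smul \<Longrightarrow> f o\<^sub>L P \<in> closure G"
    and P_dual_id: "f \<in> closure G \<Longrightarrow> f o\<^sub>L P = f"
begin

definition lists :: "('e \<times> ('e \<Rightarrow>\<^sub>L 'k)) list set" where
  "lists = {L. set L \<subseteq> closure U \<times> closure G}"

text \<open>These are the operators of finite rank on the range of \<open>P\<close>, extended to
  \<open>E\<close> through \<open>P\<close>.\<close>

definition ops :: "('e \<Rightarrow>\<^sub>L 'e) set" where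
  "ops = op_of ` lists"

lemma dual_if: "f \<in> closure G \<Longrightarrow> f \<in> dual smul"
  using closure_minimal[OF G_dual closed_dual] by blast

lemma closure_U_iff: "x \<in> closure U \<longleftrightarrow> blinfun_apply P x = x"
  using P_in P_id by metis

lemma closure_G_iff: "f \<in> closure G \<longleftrightarrow> f \<in> dual smul \<and> f o\<^sub>L P = f"
  using P_dual_in P_dual_id dual_if by metis

lemma zero_in: "0 \<in> closure U" "0 \<in> closure G"
  by (auto simp: closure_U_iff closure_G_iff dual_zero blinfun.zero_right intro!: blinfun_eqI)

lemma smul_in: "x \<in> closure U \<Longrightarrow> smul c x \<in> closure U"
  by (simp add: closure_U_iff bounded_ops_smul[OF P_bounded])

lemma scaleR_in: "x \<in> closure U \<Longrightarrow> r *\<^sub>R x \<in> closure U"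
  using smul_in[of x "of_real r"] by (simp add: smul_of_real)

lemma lists_dual: "L \<in> lists \<Longrightarrow> set L \<subseteq> UNIV \<times> dual smul"
  using dual_if by (auto simp: lists_def)

lemma lists_append: "L \<in> lists \<Longrightarrow> M \<in> lists \<Longrightarrow> L @ M \<in> lists"
  by (auto simp: lists_def)

definition scale_list :: "'k \<Rightarrow> ('e \<times> ('e \<Rightarrow>\<^sub>L 'k)) list \<Rightarrow> ('e \<times> ('e \<Rightarrow>\<^sub>L 'k)) list" where
  "scale_list c L = map (\<lambda>(u, f). (smul c u, f)) L"

lemma scale_list_in: "L \<in> lists \<Longrightarrow> scale_list c L \<in> lists"
  using smul_in by (auto simp: lists_def scale_list_def)

lemma op_of_scale_list: "L \<in> lists \<Longrightarrow> op_of (scale_list c L) = smul_op smul c (op_of L)"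
  by (induction L)
    (auto simp: scale_list_def lists_def smul_op_apply rank1_apply blinfun.add_left
      scale_right_distrib mult.commute intro!: blinfun_eqI)

lemma pairing_scale_list:
  "L \<in> lists \<Longrightarrow> x \<in> bounded_ops smul \<Longrightarrow> pairing (scale_list c L) x = c * pairing L x"
  by (induction L)
    (auto simp: scale_list_def lists_def dual_smul[OF dual_if] bounded_ops_smul algebra_simps)

lemma ops_bounded: "x \<in> ops \<Longrightarrow> x \<in> bounded_ops smul"
  using op_of_bounded_ops lists_dual by (auto simp: ops_def)

lemma ops_add: "x \<in> ops \<Longrightarrow> y \<in> ops \<Longrightarrow> x + y \<in> ops"
  unfolding ops_def by (auto simp flip: op_of_simps(3) intro!: imageI lists_append)

lemma ops_smul: "x \<in> ops \<Longrightarrow> smul_op smul c x \<in> ops"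
  unfolding ops_def by (auto simp flip: op_of_scale_list intro!: imageI scale_list_in)

lemma smul_op_of_real: "smul_op smul (of_real r) x = r *\<^sub>R x"
  by (intro blinfun_eqI) (simp add: smul_op_apply smul_of_real blinfun.scaleR_left)

lemma norm_smul_op: "norm (smul_op smul c x) \<le> norm c * norm x"
  by (intro norm_blinfun_bound)
    (auto simp: smul_op_apply norm_smul mult.assoc intro!: mult_left_mono norm_blinfun)

lemma ops_scaleR: "x \<in> ops \<Longrightarrow> r *\<^sub>R x \<in> ops"
  using ops_smul[of x "of_real r"] by (simp add: smul_op_of_real)

lemma ops_subspace: "real_vector.subspace ops"
proof -
  have "0 \<in> ops" unfolding ops_def by (intro image_eqI[of _ _ "[]"]) (auto simp: lists_def)
  then show ?thesis using ops_add ops_scaleR by (auto simp: real_vector.subspace_def)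
qed

lemma ops_compress: "x \<in> closure ops \<Longrightarrow> P o\<^sub>L x o\<^sub>L P = x"
proof -
  have eq: "P o\<^sub>L op_of L o\<^sub>L P = op_of L" if "L \<in> lists" for L
    using that
  proof (induction L)
    case (Cons p L)
    then have "blinfun_apply P (fst p) = fst p" "snd p o\<^sub>L P = snd p"
      by (auto simp: lists_def closure_U_iff closure_G_iff)
    moreover have "blinfun_apply (snd p) (blinfun_apply P x) = blinfun_apply (snd p o\<^sub>L P) x" for x
      by simp
    ultimately have "blinfun_apply P (fst p) = fst p"
      "\<And>x. blinfun_apply (snd p) (blinfun_apply P x) = blinfun_apply (snd p) x" by simp_all
    then have "P o\<^sub>L rank1 (fst p) (snd p) o\<^sub>L P = rank1 (fst p) (snd p)"
      by (intro blinfun_eqI) (simp add: rank1_apply bounded_ops_smul[OF P_bounded])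
    then show ?case using Cons
      by (cases p) (simp add: lists_def bounded_bilinear.add_left[OF bounded_bilinear_blinfun_compose]
        bounded_bilinear.add_right[OF bounded_bilinear_blinfun_compose])
  qed (auto intro!: blinfun_eqI simp: blinfun.zero_right)
  have "closed {x. P o\<^sub>L x o\<^sub>L P = x}"
    by (intro closed_Collect_eq continuous_intros bounded_linear.continuous_on bounded_linear_intros)
  then have "closure ops \<subseteq> {x. P o\<^sub>L x o\<^sub>L P = x}"
    using eq by (intro closure_minimal) (auto simp: ops_def)
  then show "x \<in> closure ops \<Longrightarrow> P o\<^sub>L x o\<^sub>L P = x" by blast
qed

text \<open>A norming pair exists in the whole space; since \<open>P\<close> is contractive,
  compression moves it into \<open>closure U\<close> and \<open>closure G\<close> without leaving
  the unit balls.\<close>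

lemma ops_norm_attained:
  assumes "z \<in> closure ops"
  obtains u f where "u \<in> closure U" "norm u \<le> 1" "f \<in> closure G" "norm f \<le> 1"
    "blinfun_apply f (blinfun_apply z u) = of_real (norm z)"
proof -
  have "ops \<subseteq> op_of ` {L. set L \<subseteq> UNIV \<times> dual smul}" using lists_dual by (auto simp: ops_def)
  then have "z \<in> closure (op_of ` {L. set L \<subseteq> UNIV \<times> dual smul})" using assms closure_mono by blast
  from norm_attained[OF refl this]
  obtain u f where uf: "norm u \<le> 1" "f \<in> dual smul" "norm f \<le> 1"
    "blinfun_apply f (blinfun_apply z u) = of_real (norm z)" by blast
  have "blinfun_apply z u = blinfun_apply (P o\<^sub>L z o\<^sub>L P) u" using ops_compress[OF assms] by simp
  then have "blinfun_apply (f o\<^sub>L P) (blinfun_apply z (blinfun_apply P u)) = of_real (norm z)"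
    using uf(4) by simp
  moreover have "norm (blinfun_apply P u) \<le> norm P * norm u" by (rule norm_blinfun)
  then have "norm (blinfun_apply P u) \<le> 1" using uf(1) norm_P by (meson mult_le_one norm_ge_zero order_trans)
  moreover have "norm (f o\<^sub>L P) \<le> norm f * norm P" by (rule norm_blinfun_compose)
  then have "norm (f o\<^sub>L P) \<le> 1" using uf(3) norm_P by (meson mult_le_one norm_ge_zero order_trans)
  ultimately show thesis using that P_in P_dual_in[OF uf(2)] by blast
qed

text \<open>
  Were there no approximation, one could pick \<open>x\<^sub>n\<close> with \<open>\<phi> x\<^sub>n = 1\<close> on which the first
  \<open>n\<close> members of a countable dense family of elementary functionals \<open>x \<mapsto> f (x u)\<close> stay below
  \<open>1 - \<epsilon>\<close>. By density every elementary functional would eventually stay below \<open>1 - \<epsilon> / 2\<close>,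
  contradicting Simons' inequality because elementary functionals attain the norms.
\<close>

lemma functional_approximation:
  fixes \<phi> :: "('e \<Rightarrow>\<^sub>L 'e) \<Rightarrow> 'k"
  assumes add: "\<And>x y. x \<in> ops \<Longrightarrow> y \<in> ops \<Longrightarrow> \<phi> (x + y) = \<phi> x + \<phi> y"
    and scale: "\<And>c x. x \<in> ops \<Longrightarrow> \<phi> (smul_op smul c x) = c * \<phi> x"
    and le: "\<And>x. x \<in> ops \<Longrightarrow> norm (\<phi> x) \<le> norm x"
    and e: "0 < \<epsilon>" "\<epsilon> \<le> 1"
  shows "\<exists>L\<in>lists. (\<forall>(u, f)\<in>set L. norm f \<le> 2) \<and> (\<Sum>(u, f)\<leftarrow>L. norm u) \<le> 2 \<and>
    (\<forall>x\<in>ops. norm (\<phi> x - pairing L x) \<le> \<epsilon> * norm x)"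
proof (rule ccontr)
  assume neg: "\<not> ?thesis"
  obtain re :: "'k \<Rightarrow> real" where re: "linear re" "re 1 = 1" "\<And>z. \<bar>re z\<bar> \<le> norm z"
    by (rule ex_re) blast
  interpret re: linear re by fact
  have re_of_real: "re (of_real r) = r" for r
    using re.scale[of r 1] re(2) by (simp add: scaleR_conv_of_real)
  \<comment> \<open>\<open>\<phi>\<close> is controlled on \<open>ops\<close> only, whereas
    \<open>linear\<close> speaks about the whole type; hence its real part is extended.\<close>
  obtain h where h: "linear h" "\<And>x. h x \<le> norm x" "\<And>x. x \<in> ops \<Longrightarrow> h x = re (\<phi> x)"
  proof (rule Hahn_Banach_sublinear[of norm ops "\<lambda>x. re (\<phi> x)"])
    show "sublinear (norm :: ('e \<Rightarrow>\<^sub>L 'e) \<Rightarrow> real)"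
      using sublinear_norm_plus_linear[of 1 "\<lambda>_. 0"] by (simp add: linear_zero)
    show "real_vector.subspace ops" by (rule ops_subspace)
    show "re (\<phi> (x + y)) = re (\<phi> x) + re (\<phi> y)" if "x \<in> ops" "y \<in> ops" for x y
      using that by (simp add: add re.add)
    show "re (\<phi> (r *\<^sub>R x)) = r * re (\<phi> x)" if "x \<in> ops" for r x
      using scale[OF that, of "of_real r"] re.scale[of r "\<phi> x"]
      by (simp add: smul_op_of_real scaleR_conv_of_real)
    show "re (\<phi> x) \<le> norm x" if "x \<in> ops" for x using le[OF that] re(3)[of "\<phi> x"] by linarith
  qed blast
  interpret h: linear h by fact
  \<comment> \<open>The bound 2 leaves room: members of \<open>U\<close> and \<open>G\<close> close
    to the unit balls may have norm slightly above one.\<close>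
  define S where "S = insert (0, 0) {(u, f). u \<in> U \<and> f \<in> G \<and> norm u \<le> 2 \<and> norm f \<le> 2}"
  have "S \<subseteq> insert (0, 0) (U \<times> G)" by (auto simp: S_def)
  then have cS: "countable S" by (rule countable_subset) (simp add: countable_U countable_G)
  have Sne: "S \<noteq> {}" by (simp add: S_def)
  \<comment> \<open>The zero pair at index 0 makes \<open>B 0\<close> vanish. This later yields
    \<open>0 < h x\<close> and the bound \<open>1 / \<epsilon>\<close> for the norms of the chosen
    operators.\<close>
  define b where "b n = (case n of 0 \<Rightarrow> (0, 0) | Suc m \<Rightarrow> from_nat_into S m)" for n
  have bS: "b n \<in> S" for n using from_nat_into[OF Sne] by (auto simp: b_def S_def split: nat.split)
  have b0: "b 0 = (0, 0)" by (simp add: b_def)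
  have b_surj: "\<exists>n. b n = p" if "p \<in> S" for p
    using from_nat_into_surj[OF cS that] by (metis b_def nat.case(2))
  have bin: "fst (b n) \<in> closure U" "snd (b n) \<in> closure G" "norm (fst (b n)) \<le> 2" "norm (snd (b n)) \<le> 2" for n
    using bS[of n] zero_in closure_subset[of U] closure_subset[of G] by (auto simp: S_def)
  define B where "B n x = re (blinfun_apply (snd (b n)) (blinfun_apply x (fst (b n))))" for n x
  have Blin: "linear (B n)" for n
    unfolding B_def by (intro linearI)
      (simp_all add: blinfun.add_left blinfun.add_right blinfun.scaleR_left blinfun.scaleR_right re.add re.scale)
  have ex: "\<exists>x\<in>ops. h x = 1 \<and> (\<forall>i\<le>n. \<epsilon> * norm x + B i x < 1)" for n
  proof -
    \<comment> \<open>\<open>a i x < 0\<close> says that \<open>h\<close> exceeds \<open>B i\<close>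
      at \<open>x\<close> by more than \<open>\<epsilon> * norm x\<close>. If no \<open>x\<close>
      achieves this for all \<open>i \<le> n\<close>, a convex combination of the \<open>B i\<close>
      approximates \<open>h\<close> on \<open>ops\<close>, contrary to \<open>neg\<close>.\<close>
    define a where "a i x = \<epsilon> * norm x + (B i x - h x)" for i x
    have asub: "sublinear (a i)" for i
      unfolding a_def using e Blin h(1) by (intro sublinear_norm_plus_linear linear_compose_sub) auto
    have "\<exists>x\<in>ops. \<forall>i\<le>n. a i x < 0"
    proof (rule ccontr)
      assume "\<not> ?thesis"
      then have "\<And>x. x \<in> ops \<Longrightarrow> \<exists>i\<le>n. 0 \<le> a i x" by (meson not_le)
      from exists_convex_comb_nonneg[OF ops_subspace asub this]
      obtain l where l: "\<And>i. 0 \<le> l i" "(\<Sum>i\<le>n. l i) = 1" "\<And>x. x \<in> ops \<Longrightarrow> 0 \<le> (\<Sum>i\<le>n. l i * a i x)"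
        by blast
      define L where "L = map (\<lambda>i. (l i *\<^sub>R fst (b i), snd (b i))) [0..<Suc n]"
      have set_n: "set [0..<Suc n] = {..n}" by auto
      have pL: "pairing L x = (\<Sum>i\<le>n. l i *\<^sub>R blinfun_apply (snd (b i)) (blinfun_apply x (fst (b i))))" for x
        unfolding L_def pairing_def map_map
        by (subst interv_sum_list_conv_sum_set_nat)
          (simp only: set_n o_def case_prod_conv blinfun.scaleR_right)
      have L: "L \<in> lists" using bin scaleR_in by (auto simp: L_def lists_def)
      have "(\<Sum>(u, f)\<leftarrow>L. norm u) = (\<Sum>i\<le>n. norm (l i *\<^sub>R fst (b i)))"
        unfolding L_def map_map
        by (subst interv_sum_list_conv_sum_set_nat) (simp only: set_n o_def case_prod_conv)
      also have "\<dots> \<le> (\<Sum>i\<le>n. l i * 2)"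
        using l(1) bin by (intro sum_mono) (auto intro!: mult_mono)
      also have "\<dots> = 2" using l(2) by (simp flip: sum_distrib_right)
      finally have m: "(\<Sum>(u, f)\<leftarrow>L. norm u) \<le> 2" .
      have main: "re (\<phi> x - pairing L x) \<le> \<epsilon> * norm x" if x: "x \<in> ops" for x
      proof -
        have "(\<Sum>i\<le>n. l i * a i x) = (\<Sum>i\<le>n. l i * (\<epsilon> * norm x - h x)) + (\<Sum>i\<le>n. l i * B i x)"
          by (simp add: a_def algebra_simps flip: sum.distrib)
        also have "\<dots> = \<epsilon> * norm x - h x + re (pairing L x)"
          using l(2) by (simp add: pL re.sum re.scale B_def flip: sum_distrib_right)
        finally show ?thesis using l(3)[OF x] h(3)[OF x] by (simp add: re.diff)
      qed
      have "norm (\<phi> x - pairing L x) \<le> \<epsilon> * norm x" if x: "x \<in> ops" for x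
      proof (cases "\<phi> x - pairing L x = 0")
        case False
        define w where "w = of_real (norm (\<phi> x - pairing L x)) * inverse (\<phi> x - pairing L x)"
        have w: "norm w = 1" "w * (\<phi> x - pairing L x) = of_real (norm (\<phi> x - pairing L x))"
          using False by (simp_all add: w_def norm_mult norm_inverse)
        have "norm (\<phi> x - pairing L x) = re (\<phi> (smul_op smul w x) - pairing L (smul_op smul w x))"
          using w(2) re_of_real x lists_dual[OF L] by (simp add: scale pairing_smul_op right_diff_distrib)
        also have "\<dots> \<le> \<epsilon> * norm (smul_op smul w x)" using x by (intro main ops_smul)
        also have "\<dots> \<le> \<epsilon> * norm x" using norm_smul_op[of w x] w(1) e by (intro mult_left_mono) auto
        finally show ?thesis .
      qed (use e in auto)
      moreover have "\<forall>(u, f)\<in>set L. norm f \<le> 2" using bin by (auto simp: L_def)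
      ultimately show False using neg L m by blast
    qed
    then obtain x where x: "x \<in> ops" "\<And>i. i \<le> n \<Longrightarrow> a i x < 0" by blast
    have "B 0 x = 0" by (simp add: B_def b0 re.zero)
    moreover have "0 \<le> \<epsilon> * norm x" using e by simp
    ultimately have hx: "0 < h x" using x(2)[of 0] by (simp add: a_def)
    have "\<epsilon> * norm (inverse (h x) *\<^sub>R x) + B i (inverse (h x) *\<^sub>R x) < 1" if "i \<le> n" for i
    proof -
      have "inverse (h x) * (\<epsilon> * norm x + B i x) < inverse (h x) * h x"
        using x(2)[OF that] hx by (intro mult_strict_left_mono) (auto simp: a_def)
      then show ?thesis using hx linear_scale[OF Blin[of i], of "inverse (h x)" x] by (simp add: algebra_simps)
    qed
    moreover have "h (inverse (h x) *\<^sub>R x) = 1" using hx by (simp add: h.scale)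
    ultimately show ?thesis using ops_scaleR[OF x(1)] by blast
  qed
  then obtain xs where xs: "\<And>n. xs n \<in> ops" "\<And>n. h (xs n) = 1"
    "\<And>n i. i \<le> n \<Longrightarrow> \<epsilon> * norm (xs n) + B i (xs n) < 1" by metis
  have xs_le: "norm (xs n) \<le> 1 / \<epsilon>" for n
  proof -
    have "B 0 (xs n) = 0" by (simp add: B_def b0 re.zero)
    then show ?thesis using xs(3)[of 0 n] e by (simp add: field_simps)
  qed
  have xs_ge: "1 \<le> norm (xs n)" for n using h(2)[of "xs n"] xs(2) by simp
  define \<B> where "\<B> = {\<lambda>z. re (blinfun_apply f (blinfun_apply z u)) | u f.
    u \<in> closure U \<and> norm u \<le> 1 \<and> f \<in> closure G \<and> norm f \<le> 1}"
  have "\<exists>\<beta>\<in>\<B>. \<forall>N. \<exists>n\<ge>N. 1 - \<epsilon> / 2 \<le> \<beta> (xs n)"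
  proof (rule Simons_inequality[where M = "1 / \<epsilon>"])
    show "norm (xs n) \<le> 1 / \<epsilon>" for n by (rule xs_le)
    show "linear \<beta>" if "\<beta> \<in> \<B>" for \<beta>
      using that unfolding \<B>_def by (auto intro!: linearI
        simp: blinfun.add_left blinfun.add_right blinfun.scaleR_left blinfun.scaleR_right re.add re.scale)
    show "\<beta> z \<le> norm z" if \<beta>: "\<beta> \<in> \<B>" for \<beta> z
    proof -
      obtain u f where uf: "norm u \<le> 1" "norm f \<le> 1" "\<beta> = (\<lambda>z. re (blinfun_apply f (blinfun_apply z u)))"
        using \<beta> by (auto simp: \<B>_def)
      have "\<beta> z \<le> norm (blinfun_apply f (blinfun_apply z u))"
        unfolding uf(3) using re(3) abs_le_D1 by blast
      also have "\<dots> \<le> norm f * norm (blinfun_apply z u)" by (rule norm_blinfun)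
      also have "\<dots> \<le> 1 * (norm z * norm u)"
        using uf(2) by (intro mult_mono norm_blinfun) auto
      also have "\<dots> \<le> norm z" using mult_left_mono[OF uf(1) norm_ge_zero[of z]] by simp
      finally show ?thesis .
    qed
    show "\<exists>\<beta>\<in>\<B>. \<beta> z = norm z" if "z \<in> closure (convex hull range xs)" for z
    proof -
      have "convex hull range xs \<subseteq> ops"
        using xs(1) subspace_imp_convex[OF ops_subspace] by (intro hull_minimal) auto
      then have "z \<in> closure ops" using that closure_mono by blast
      then obtain u f where "u \<in> closure U" "norm u \<le> 1" "f \<in> closure G" "norm f \<le> 1"
        "blinfun_apply f (blinfun_apply z u) = of_real (norm z)"
        by (rule ops_norm_attained)
      then show ?thesis unfolding \<B>_def
        by (intro bexI[of _ "\<lambda>z. re (blinfun_apply f (blinfun_apply z u))"]) (auto simp: re_of_real)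
    qed
    show "1 \<le> norm y" if "y \<in> convex hull range xs" for y
    proof -
      have "convex (h -` {1})" by (rule convex_linear_vimage[OF h(1)]) simp
      then have "convex hull range xs \<subseteq> h -` {1}"
        using xs(2) by (intro hull_minimal) auto
      then show ?thesis using that h(2)[of y] by auto
    qed
  qed (use e in auto)
  then obtain u f where u: "u \<in> closure U" "norm u \<le> 1" and f: "f \<in> closure G" "norm f \<le> 1"
    and freq: "\<And>N. \<exists>n\<ge>N. 1 - \<epsilon> / 2 \<le> re (blinfun_apply f (blinfun_apply (xs n) u))"
    by (auto simp: \<B>_def)
  \<comment> \<open>The norm of \<open>xs n\<close> is at most \<open>1 / \<epsilon>\<close>, so
    moving \<open>u\<close> and \<open>f\<close> by \<open>d\<close> costs at most
    \<open>3 * d / \<epsilon> = \<epsilon> / 4\<close>, half of the gap between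
    \<open>1 - \<epsilon>\<close> and \<open>1 - \<epsilon> / 2\<close>.\<close>
  define d where "d = \<epsilon>\<^sup>2 / 12"
  have "\<epsilon>\<^sup>2 \<le> 1" using e by (simp add: power_le_one)
  then have d: "0 < d" "d \<le> 1" using e by (auto simp: d_def)
  obtain u' where u': "u' \<in> U" "dist u' u < d" using u(1) d(1) closure_approachable by blast
  obtain f' where f': "f' \<in> G" "dist f' f < d" using f(1) d(1) closure_approachable by blast
  have n': "norm u' \<le> 2" "norm f' \<le> 2"
    using u' f' u f d norm_triangle_sub[of u' u] norm_triangle_sub[of f' f] by (auto simp: dist_norm)
  then have "(u', f') \<in> S" using u' f' by (simp add: S_def)
  then obtain i where i: "b i = (u', f')" using b_surj by blast
  obtain n where n: "n \<ge> i" "1 - \<epsilon> / 2 \<le> re (blinfun_apply f (blinfun_apply (xs n) u))"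
    using freq by blast
  let ?x = "xs n"
  have "re (blinfun_apply f' (blinfun_apply ?x u')) < 1 - \<epsilon> * norm ?x"
    using xs(3)[OF n(1)] i by (simp add: B_def)
  also have "\<dots> \<le> 1 - \<epsilon>" using xs_ge[of n] e by simp
  finally have 1: "re (blinfun_apply f' (blinfun_apply ?x u')) < 1 - \<epsilon>" .
  have "blinfun_apply f (blinfun_apply ?x u) - blinfun_apply f' (blinfun_apply ?x u')
      = blinfun_apply f (blinfun_apply ?x (u - u')) + blinfun_apply (f - f') (blinfun_apply ?x u')"
    by (simp add: blinfun.diff_left blinfun.diff_right)
  moreover have "norm (blinfun_apply f (blinfun_apply ?x (u - u'))) \<le> 1 * (norm ?x * d)"
    using f(2) u'(2) d(1)
    by (intro order_trans[OF norm_blinfun] mult_mono mult_left_mono)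
      (auto simp: dist_norm norm_minus_commute intro: less_imp_le)
  moreover have "norm (blinfun_apply (f - f') (blinfun_apply ?x u')) \<le> d * (norm ?x * 2)"
    using f'(2) n'(1) d(1)
    by (intro order_trans[OF norm_blinfun] mult_mono mult_left_mono)
      (auto simp: dist_norm norm_minus_commute intro: less_imp_le)
  ultimately have "norm (blinfun_apply f (blinfun_apply ?x u) - blinfun_apply f' (blinfun_apply ?x u')) \<le> 3 * (norm ?x * d)"
    using norm_triangle_ineq[of "blinfun_apply f (blinfun_apply ?x (u - u'))" "blinfun_apply (f - f') (blinfun_apply ?x u')"]
    by (simp add: mult.commute[of d])
  also have "\<dots> \<le> 3 * (1 / \<epsilon> * d)" using xs_le d(1) by (intro mult_left_mono mult_right_mono) auto
  also have "\<dots> = \<epsilon> / 4" using e by (simp add: d_def power2_eq_square)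
  finally have "re (blinfun_apply f (blinfun_apply ?x u)) - re (blinfun_apply f' (blinfun_apply ?x u')) \<le> \<epsilon> / 4"
    using re(3)[of "blinfun_apply f (blinfun_apply ?x u) - blinfun_apply f' (blinfun_apply ?x u')"]
    by (simp add: re.diff)
  then show False using 1 n(2) e by linarith
qed

end

section \<open>The trace\<close>

context separable_projection
begin

text \<open>Tolerance one half after normalisation by \<open>M\<close>. Iterated on the remainders,
  it halves their norms each time.\<close>

lemma functional_approximation_scaled:
  fixes R :: "('e \<times> ('e \<Rightarrow>\<^sub>L 'k)) list"
  assumes R: "R \<in> lists" and M: "0 < M" "\<And>x. x \<in> ops \<Longrightarrow> norm (pairing R x) \<le> M * norm x"
  shows "\<exists>L\<in>lists. (\<forall>(u, f)\<in>set L. norm f \<le> 2) \<and> (\<Sum>(u, f)\<leftarrow>L. norm u) \<le> 2 * M \<and>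
    (\<forall>x\<in>ops. norm (pairing R x - pairing L x) \<le> M / 2 * norm x)"
proof -
  define \<phi> where "\<phi> x = of_real (inverse M) * pairing R x" for x
  have "\<exists>L\<in>lists. (\<forall>(u, f)\<in>set L. norm f \<le> 2) \<and> (\<Sum>(u, f)\<leftarrow>L. norm u) \<le> 2 \<and>
    (\<forall>x\<in>ops. norm (\<phi> x - pairing L x) \<le> 1 / 2 * norm x)"
  proof (rule functional_approximation)
    show "norm (\<phi> x) \<le> norm x" if "x \<in> ops" for x
      using M(2)[OF that] M(1) by (simp add: \<phi>_def norm_mult norm_divide field_simps)
  qed (use lists_dual[OF R] in \<open>auto simp: \<phi>_def pairing_add pairing_smul_op distrib_left\<close>)
  then obtain L where L: "L \<in> lists" "\<forall>(u, f)\<in>set L. norm f \<le> 2" "(\<Sum>(u, f)\<leftarrow>L. norm u) \<le> 2"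
    "\<And>x. x \<in> ops \<Longrightarrow> norm (\<phi> x - pairing L x) \<le> 1 / 2 * norm x" by blast
  let ?L = "scale_list (of_real M) L"
  have "(\<Sum>(u, f)\<leftarrow>?L. norm u) = M * (\<Sum>(u, f)\<leftarrow>L. norm u)"
    using M(1) by (induction L) (auto simp: scale_list_def norm_smul algebra_simps)
  also have "\<dots> \<le> 2 * M" using L(3) M(1) by simp
  finally have 1: "(\<Sum>(u, f)\<leftarrow>?L. norm u) \<le> 2 * M" .
  have 2: "\<forall>(u, f)\<in>set ?L. norm f \<le> 2" using L(2) by (auto simp: scale_list_def)
  have "norm (pairing R x - pairing ?L x) \<le> M / 2 * norm x" if x: "x \<in> ops" for x
  proof -
    have "pairing R x - pairing ?L x = of_real M * (\<phi> x - pairing L x)"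
      using M(1) pairing_scale_list[OF L(1) ops_bounded[OF x]] by (simp add: \<phi>_def right_diff_distrib)
    then have "norm (pairing R x - pairing ?L x) = M * norm (\<phi> x - pairing L x)"
      using M(1) by (simp add: norm_mult)
    also have "\<dots> \<le> M * (1 / 2 * norm x)" using L(4)[OF x] M(1) by (intro mult_left_mono) auto
    finally show ?thesis by simp
  qed
  then show ?thesis using scale_list_in[OF L(1)] 1 2 by blast
qed

text \<open>The approximation property supplies operators on all of \<open>E\<close>, and bounds
  over \<open>ops\<close> apply only after compression. Pairings with members of
  \<open>lists\<close> do not notice the difference.\<close>

lemma pairing_compress:
  assumes "L \<in> lists"
  shows "pairing L (P o\<^sub>L x o\<^sub>L P) = pairing L x"
  using assms
proof (induction L)
  case (Cons p L)
  then have "blinfun_apply P (fst p) = fst p" and 1: "snd p o\<^sub>L P = snd p"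
    by (auto simp: lists_def closure_U_iff closure_G_iff)
  moreover have "blinfun_apply (snd p) (blinfun_apply P y) = blinfun_apply (snd p o\<^sub>L P) y" for y
    by simp
  ultimately show ?case using Cons by (cases p) (simp add: lists_def)
qed simp

lemma compress_in_ops:
  assumes "T \<in> finite_rank_ops smul"
  shows "P o\<^sub>L T o\<^sub>L P \<in> ops"
proof -
  obtain L where L: "set L \<subseteq> UNIV \<times> dual smul" "T = op_of L"
    using assms by (auto simp: finite_rank_ops_eq)
  have "P o\<^sub>L T o\<^sub>L P = op_of (map (\<lambda>(u, f). (u, f o\<^sub>L P)) (map (\<lambda>(u, f). (blinfun_apply P u, f)) L))"
    by (simp only: L(2) op_of_compose_right op_of_compose_left[OF P_bounded])
  moreover have "map (\<lambda>(u, f). (u, f o\<^sub>L P)) (map (\<lambda>(u, f). (blinfun_apply P u, f)) L) \<in> lists"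
    using L(1) P_in P_dual_in by (auto simp: lists_def)
  ultimately show ?thesis unfolding ops_def by (rule image_eqI)
qed

lemma norm_pairing_le:
  assumes "\<And>u f. (u, f) \<in> set L \<Longrightarrow> norm (blinfun_apply f (blinfun_apply x u)) \<le> c u f"
  shows "norm (pairing L x) \<le> (\<Sum>(u, f)\<leftarrow>L. c u f)"
  using assms
proof (induction L)
  case (Cons p L)
  obtain u f where p: "p = (u, f)" by (cases p)
  have "norm (pairing L x) \<le> (\<Sum>(u, f)\<leftarrow>L. c u f)" using Cons by auto
  moreover have "norm (blinfun_apply f (blinfun_apply x u)) \<le> c u f" using Cons.prems p by auto
  ultimately show ?case
    unfolding p by (simp add: norm_triangle_le add_mono)
qed simp

text \<open>
  Peeling off approximations of geometrically decreasing size represents the functional by a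
  nuclear series, whose vectors can be rescaled into a compact set; on that set the approximation
  property replaces the identity by an operator of finite rank.
\<close>

lemma trace_bound:
  assumes AP: "approximation_property smul"
    and S: "S \<in> lists" and \<iota>: "0 < \<iota>" and le: "\<And>x. x \<in> ops \<Longrightarrow> norm (pairing S x) \<le> \<iota> * norm x"
  shows "norm (pairing S id_blinfun) \<le> 34 * \<iota>"
proof -
  define good where "good m R \<longleftrightarrow> R \<in> lists \<and> (\<forall>x\<in>ops. norm (pairing R x) \<le> \<iota> / 2 ^ m * norm x)" for m R
  have "\<exists>L\<in>lists. (\<forall>(u, f)\<in>set L. norm f \<le> 2) \<and> (\<Sum>(u, f)\<leftarrow>L. norm u) \<le> 2 * (\<iota> / 2 ^ m) \<and>
      (\<forall>x\<in>ops. norm (pairing R x - pairing L x) \<le> \<iota> / 2 ^ m / 2 * norm x)" if "good m R" for m R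
    using that \<iota> by (intro functional_approximation_scaled) (auto simp: good_def)
  then obtain \<Lambda> where \<Lambda>: "\<And>m R. good m R \<Longrightarrow> \<Lambda> m R \<in> lists"
    "\<And>m R u f. good m R \<Longrightarrow> (u, f) \<in> set (\<Lambda> m R) \<Longrightarrow> norm f \<le> 2"
    "\<And>m R. good m R \<Longrightarrow> (\<Sum>(u, f)\<leftarrow>\<Lambda> m R. norm u) \<le> 2 * (\<iota> / 2 ^ m)"
    "\<And>m R x. good m R \<Longrightarrow> x \<in> ops \<Longrightarrow> norm (pairing R x - pairing (\<Lambda> m R) x) \<le> \<iota> / 2 ^ m / 2 * norm x"
    by (metis (no_types, lifting) case_prodD)
  define R where "R = rec_nat S (\<lambda>m R. R @ scale_list (- 1) (\<Lambda> m R))"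
  have R0: "R 0 = S" and RS: "R (Suc m) = R m @ scale_list (- 1) (\<Lambda> m (R m))" for m
    by (simp_all add: R_def)
  define N where "N m = \<Lambda> m (R m)" for m
  have pRS: "pairing (R (Suc m)) x = pairing (R m) x - pairing (N m) x"
    if "N m \<in> lists" "x \<in> bounded_ops smul" for m x
    using that by (simp add: RS pairing_scale_list N_def)
  have good: "good m (R m)" for m
  proof (induction m)
    case 0
    then show ?case using S le by (simp add: good_def R0)
  next
    case (Suc m)
    have "R (Suc m) \<in> lists"
      using Suc \<Lambda>(1)[OF Suc] by (auto simp: RS good_def intro!: lists_append scale_list_in)
    moreover have "norm (pairing (R (Suc m)) x) \<le> \<iota> / 2 ^ Suc m * norm x" if x: "x \<in> ops" for x
      using \<Lambda>(4)[OF Suc x] pRS[of m x] \<Lambda>(1)[OF Suc] ops_bounded[OF x] by (simp add: N_def mult.commute)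
    ultimately show ?case by (simp add: good_def)
  qed
  have N: "N m \<in> lists" "\<And>u f. (u, f) \<in> set (N m) \<Longrightarrow> norm f \<le> 2"
    "(\<Sum>(u, f)\<leftarrow>N m. norm u) \<le> 2 * (\<iota> / 2 ^ m)" for m
    unfolding N_def using \<Lambda>[OF good] by auto
  \<comment> \<open>The vectors of stage \<open>m\<close> have total norm at most
    \<open>2 * \<iota> / 2 ^ m\<close>. Rescaled to length \<open>(2/3) ^ m\<close> they accumulate
    only at zero; undoing this costs \<open>(3/2) ^ m\<close>, still summable against
    \<open>1 / 2 ^ m\<close>.\<close>
  define K where "K = insert 0 (fst ` set S \<union> (\<Union>m. (\<lambda>(u, f). (2/3) ^ m *\<^sub>R sgn u) ` set (N m)))"
  have "compact K"
  proof (rule compact_null_set)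
    fix e :: real assume "0 < e"
    then obtain M where M: "(2/3::real) ^ M < e" using real_arch_pow_inv[of e "2/3"] by auto
    have "{x \<in> K. e \<le> norm x} \<subseteq> insert 0 (fst ` set S \<union> (\<Union>m<M. (\<lambda>(u, f). (2/3) ^ m *\<^sub>R sgn u) ` set (N m)))"
    proof
      fix x assume x: "x \<in> {x \<in> K. e \<le> norm x}"
      then consider "x = 0" | "x \<in> fst ` set S"
        | m u f where "(u, f) \<in> set (N m)" "x = (2/3) ^ m *\<^sub>R sgn u"
        by (auto simp: K_def)
      then show "x \<in> insert 0 (fst ` set S \<union> (\<Union>m<M. (\<lambda>(u, f). (2/3) ^ m *\<^sub>R sgn u) ` set (N m)))"
      proof cases
        case (3 m u f)
        have "m < M"
        proof (rule ccontr)
          assume "\<not> m < M"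
          then have "(2/3::real) ^ m \<le> (2/3) ^ M" by (intro power_decreasing) auto
          moreover have "norm x \<le> (2/3) ^ m" unfolding 3(2) by (auto simp: norm_sgn)
          moreover have "e \<le> norm x" using x by blast
          ultimately show False using M by linarith
        qed
        then show ?thesis using 3 by force
      qed auto
    qed
    then show "finite {x \<in> K. e \<le> norm x}" by (rule finite_subset) auto
  qed (simp add: K_def)
  define c where "c = (\<Sum>(u, f)\<leftarrow>S. norm f)"
  have c0: "0 \<le> c" unfolding c_def by (intro sum_list_nonneg) auto
  \<comment> \<open>\<open>\<eta> \<le> 1\<close> controls \<open>T\<close> on the rescaled vectors;
    \<open>\<eta> * c \<le> \<iota>\<close> bounds the cost of replacing the identity by
    \<open>T\<close> in \<open>S\<close>.\<close>
  define \<eta> where "\<eta> = min 1 (\<iota> / (c + 1))"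
  have \<eta>: "0 < \<eta>" "\<eta> \<le> 1" "\<eta> * c \<le> \<iota>"
  proof -
    show "0 < \<eta>" "\<eta> \<le> 1" using \<iota> c0 by (auto simp: \<eta>_def)
    have "\<eta> * c \<le> \<iota> / (c + 1) * (c + 1)" using c0 \<iota> by (intro mult_mono) (auto simp: \<eta>_def)
    then show "\<eta> * c \<le> \<iota>" using c0 by simp
  qed
  obtain T where T: "T \<in> finite_rank_ops smul" "\<And>x. x \<in> K \<Longrightarrow> norm (blinfun_apply T x - x) < \<eta>"
    using AP[unfolded approximation_property_def, rule_format, OF conjI[OF \<open>compact K\<close> \<eta>(1)]] by auto
  have Tb: "T \<in> bounded_ops smul" using T(1) by (simp add: finite_rank_ops_def)
  have NT: "norm (pairing (N m) T) \<le> 8 * \<iota> * (3/4) ^ m" for m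
  proof -
    have "norm (pairing (N m) T) \<le> (\<Sum>(u, f)\<leftarrow>N m. 4 * (3/2) ^ m * norm u)"
    proof (rule norm_pairing_le)
      fix u f assume uf: "(u, f) \<in> set (N m)"
      have "norm (blinfun_apply T u - u) \<le> (3/2) ^ m * norm u"
      proof -
        define v where "v = (2/3) ^ m *\<^sub>R sgn u"
        define r where "r = (3/2) ^ m * norm u"
        have "v \<in> K" using uf unfolding K_def v_def by force
        then have v: "norm (blinfun_apply T v - v) \<le> 1" using T(2) \<eta>(2) by fastforce
        have "(3/2) ^ m * (2/3) ^ m = (1::real)" by (simp flip: power_mult_distrib)
        then have "r * (2/3) ^ m = norm u" by (simp add: r_def mult_ac)
        then have "r *\<^sub>R v = norm u *\<^sub>R sgn u" unfolding v_def by (simp only: scaleR_scaleR)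
        also have "\<dots> = u" by (cases "u = 0") (simp_all add: sgn_div_norm)
        finally have "u = r *\<^sub>R v" by (rule sym)
        then have "blinfun_apply T u - u = r *\<^sub>R (blinfun_apply T v - v)"
          by (simp only: blinfun.scaleR_right scaleR_diff_right)
        then have "norm (blinfun_apply T u - u) = (3/2) ^ m * norm u * norm (blinfun_apply T v - v)"
          by (simp add: r_def)
        also have "\<dots> \<le> (3/2) ^ m * norm u * 1" using v by (intro mult_left_mono) auto
        finally show ?thesis by simp
      qed
      moreover have "norm (blinfun_apply T u) \<le> norm (blinfun_apply T u - u) + norm u"
        using norm_triangle_sub[of "blinfun_apply T u" u] by simp
      moreover have "norm u \<le> (3/2) ^ m * norm u"
        using mult_right_mono[of 1 "(3/2) ^ m" "norm u"] by simp
      ultimately have "norm (blinfun_apply T u) \<le> 2 * ((3/2) ^ m * norm u)" by linarith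
      then have "norm f * norm (blinfun_apply T u) \<le> 2 * (2 * ((3/2) ^ m * norm u))"
        using N(2)[OF uf] by (intro mult_mono) auto
      then show "norm (blinfun_apply f (blinfun_apply T u)) \<le> 4 * (3/2) ^ m * norm u"
        using norm_blinfun[of f "blinfun_apply T u"] by linarith
    qed
    also have "\<dots> = 4 * (3/2) ^ m * (\<Sum>(u, f)\<leftarrow>N m. norm u)"
      by (simp add: case_prod_unfold sum_list_const_mult)
    also have "\<dots> \<le> 4 * (3/2) ^ m * (2 * (\<iota> / 2 ^ m))" using N(3) by (intro mult_left_mono) auto
    also have "\<dots> = 8 * \<iota> * ((3/2) ^ m * (1/2) ^ m)" by (simp add: power_one_over field_simps)
    also have "\<dots> = 8 * \<iota> * (3/4) ^ m" by (simp flip: power_mult_distrib)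
    finally show ?thesis .
  qed
  \<comment> \<open>The terms \<open>8 * \<iota> * (3/4) ^ m\<close> sum to
    \<open>32 * \<iota>\<close>. The remainder and the replacement of the identity by
    \<open>T\<close> contribute \<open>\<iota>\<close> each, whence 34.\<close>
  have bound: "norm (pairing S T) \<le> norm (pairing (R m) T) + 32 * \<iota> * (1 - (3/4) ^ m)" for m
  proof (induction m)
    case 0
    then show ?case by (simp add: R0)
  next
    case (Suc m)
    have "pairing (R m) T = pairing (R (Suc m)) T + pairing (N m) T"
      using pRS[OF N(1) Tb] by simp
    then have "norm (pairing (R m) T) \<le> norm (pairing (R (Suc m)) T) + 8 * \<iota> * (3/4) ^ m"
      using norm_triangle_ineq NT[of m] by (metis add_left_mono order_trans)
    then show ?case using Suc by (simp add: algebra_simps)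
  qed
  let ?T = "P o\<^sub>L T o\<^sub>L P"
  \<comment> \<open>No bound for the norm of \<open>T\<close> is known in advance, so the number of
    stages is chosen after \<open>T\<close>.\<close>
  obtain m where m: "norm ?T < 2 ^ m" using real_arch_pow[of 2 "norm ?T"] by auto
  have "norm (pairing (R m) T) = norm (pairing (R m) ?T)"
    using good[of m] by (simp add: good_def pairing_compress)
  also have "\<dots> \<le> \<iota> / 2 ^ m * norm ?T" using good[of m] compress_in_ops[OF T(1)] by (simp add: good_def)
  also have "\<dots> \<le> \<iota> / 2 ^ m * 2 ^ m" using m \<iota> by (intro mult_left_mono) auto
  finally have 1: "norm (pairing (R m) T) \<le> \<iota>" by simp
  have "32 * \<iota> * (1 - (3/4) ^ m) \<le> 32 * \<iota> * 1" using \<iota> by (intro mult_left_mono) auto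
  then have "norm (pairing S T) \<le> 33 * \<iota>"
    using bound[of m] 1 by linarith
  moreover have "norm (pairing S (id_blinfun - T)) \<le> \<iota>"
  proof -
    have "norm (pairing S (id_blinfun - T)) \<le> (\<Sum>(u, f)\<leftarrow>S. \<eta> * norm f)"
    proof (rule norm_pairing_le)
      fix u f assume "(u, f) \<in> set S"
      then have "u \<in> K" by (force simp: K_def)
      then have "norm (blinfun_apply (id_blinfun - T) u) \<le> \<eta>"
        using T(2)[of u] by (simp add: blinfun.diff_left norm_minus_commute[of u])
      then have "norm f * norm (blinfun_apply (id_blinfun - T) u) \<le> norm f * \<eta>"
        by (intro mult_left_mono) auto
      then show "norm (blinfun_apply f (blinfun_apply (id_blinfun - T) u)) \<le> \<eta> * norm f"
        using norm_blinfun[of f "blinfun_apply (id_blinfun - T) u"] by (simp add: mult.commute)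
    qed
    also have "\<dots> = \<eta> * c" by (simp add: c_def case_prod_unfold sum_list_const_mult)
    finally show ?thesis using \<eta>(3) by simp
  qed
  moreover have "pairing S id_blinfun = pairing S T + pairing S (id_blinfun - T)"
    by (simp flip: pairing_add)
  ultimately show ?thesis
    using norm_triangle_ineq[of "pairing S T" "pairing S (id_blinfun - T)"] by simp
qed

text \<open>
  The trace is a bounded functional on the operators of finite rank, hence approximated by an
  elementary functional; the corresponding operator of finite rank is close to a multiple of the
  identity.
\<close>

lemma finite_independent:
  assumes AP: "approximation_property smul"
    and C: "\<And>L x. L \<in> lists \<Longrightarrow> x \<in> ops \<Longrightarrow> norm (pairing L x) \<le> C * norm (op_of L) * norm x"
    and V: "V \<subseteq> closure U" "independent V"
  shows "finite V"
proof -
  define D where "D = 34 * max C 1"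
  have D: "1 \<le> D" by (simp add: D_def)
  have tr: "norm (pairing L id_blinfun) \<le> D * norm (op_of L)" if L: "L \<in> lists" for L
  proof (rule field_le_epsilon)
    fix e :: real assume e: "0 < e"
    \<comment> \<open>The summand \<open>e / 34\<close> keeps the bound strictly positive, as
      \<open>trace_bound\<close> demands, even when \<open>op_of L\<close> is zero.\<close>
    have "norm (pairing L id_blinfun) \<le> 34 * (max C 1 * norm (op_of L) + e / 34)"
    proof (rule trace_bound[OF AP L])
      show "0 < max C 1 * norm (op_of L) + e / 34" using e by (intro add_nonneg_pos mult_nonneg_nonneg) auto
      fix x assume x: "x \<in> ops"
      have "norm (pairing L x) \<le> C * norm (op_of L) * norm x" by (rule C[OF L x])
      also have "\<dots> \<le> (max C 1 * norm (op_of L) + e / 34) * norm x"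
        using e by (intro mult_right_mono add_increasing2) (auto intro: mult_right_mono)
      finally show "norm (pairing L x) \<le> (max C 1 * norm (op_of L) + e / 34) * norm x" .
    qed
    then show "norm (pairing L id_blinfun) \<le> D * norm (op_of L) + e" by (simp add: D_def)
  qed
  have id_b: "id_blinfun \<in> bounded_ops smul" by (simp add: bounded_ops_def)
  \<comment> \<open>The bound also shows that the trace depends on the operator only: the difference
    of two lists for one operator has operator zero.\<close>
  have tr_eq: "pairing L id_blinfun = pairing M id_blinfun"
    if LM: "L \<in> lists" "M \<in> lists" "op_of L = op_of M" for L M
  proof -
    have "norm (pairing (L @ scale_list (- 1) M) id_blinfun) \<le> D * norm (op_of (L @ scale_list (- 1) M))"
      using LM by (intro tr lists_append scale_list_in)
    moreover have "op_of (L @ scale_list (- 1) M) = 0"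
      using LM by (intro blinfun_eqI) (simp add: op_of_scale_list smul_op_apply blinfun.add_left)
    ultimately show ?thesis using LM(2) id_b by (simp add: pairing_scale_list)
  qed
  define t where "t x = pairing (SOME L. L \<in> lists \<and> op_of L = x) id_blinfun" for x
  have t: "t (op_of L) = pairing L id_blinfun" if "L \<in> lists" for L
  proof -
    have "(SOME M. M \<in> lists \<and> op_of M = op_of L) \<in> lists \<and> op_of (SOME M. M \<in> lists \<and> op_of M = op_of L) = op_of L"
      using that by (intro someI[of "\<lambda>M. M \<in> lists \<and> op_of M = op_of L" L]) simp
    then show ?thesis unfolding t_def by (intro tr_eq that) auto
  qed
  define \<phi> where "\<phi> x = of_real (inverse D) * t x" for x
  \<comment> \<open>Multiplication by \<open>D\<close> turns this tolerance into one half, which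
    puts \<open>D *\<^sub>R N\<close> within one half of the identity on
    \<open>closure U\<close>.\<close>
  have "\<exists>L\<in>lists. (\<forall>(u, f)\<in>set L. norm f \<le> 2) \<and> (\<Sum>(u, f)\<leftarrow>L. norm u) \<le> 2 \<and>
    (\<forall>x\<in>ops. norm (\<phi> x - pairing L x) \<le> 1 / (2 * D) * norm x)"
  proof (rule functional_approximation)
    show "\<phi> (x + y) = \<phi> x + \<phi> y" if xy: "x \<in> ops" "y \<in> ops" for x y
    proof -
      obtain L M where "L \<in> lists" "x = op_of L" "M \<in> lists" "y = op_of M" using xy by (auto simp: ops_def)
      then show ?thesis using t[of "L @ M"] lists_append[of L M] by (simp add: \<phi>_def t distrib_left)
    qed
    show "\<phi> (smul_op smul c x) = c * \<phi> x" if "x \<in> ops" for c x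
    proof -
      obtain L where "L \<in> lists" "x = op_of L" using \<open>x \<in> ops\<close> by (auto simp: ops_def)
      then show ?thesis using t[of "scale_list c L"] scale_list_in[of L c] id_b
        by (simp add: \<phi>_def t op_of_scale_list pairing_scale_list)
    qed
    show "norm (\<phi> x) \<le> norm x" if "x \<in> ops" for x
      using that tr D by (auto simp: \<phi>_def ops_def t norm_mult norm_divide field_simps)
    show "0 < 1 / (2 * D)" "1 / (2 * D) \<le> 1" using D by auto
  qed
  then obtain L where L: "L \<in> lists"
    "\<And>x. x \<in> ops \<Longrightarrow> norm (\<phi> x - pairing L x) \<le> 1 / (2 * D) * norm x" by blast
  define N where "N = op_of L"
  have Nb: "N \<in> bounded_ops smul" unfolding N_def using lists_dual[OF L(1)] by (rule op_of_bounded_ops)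
  have close: "norm (v - D *\<^sub>R blinfun_apply N v) \<le> 1 / 2 * norm v" if v: "v \<in> closure U" for v
  proof (rule norm_le_by_functionals)
    fix f assume f: "f \<in> dual smul" "norm f \<le> 1"
    define g where "g = f o\<^sub>L P"
    have g: "g \<in> closure G" unfolding g_def by (rule P_dual_in[OF f(1)])
    have "norm g \<le> norm f * norm P" unfolding g_def by (rule norm_blinfun_compose)
    also have "\<dots> \<le> 1" using f(2) norm_P by (simp add: mult_le_one)
    finally have ng: "norm g \<le> 1" .
    have r: "rank1 v g = op_of [(v, g)]" "[(v, g)] \<in> lists" using v g by (auto simp: lists_def)
    have PN: "blinfun_apply P (blinfun_apply N v) = blinfun_apply N v"
    proof -
      have "P o\<^sub>L op_of L o\<^sub>L P = op_of L" 
        using L(1) closure_subset[of ops] by (intro ops_compress) (auto simp: ops_def)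
      then have "blinfun_apply N v = blinfun_apply P (blinfun_apply N (blinfun_apply P v))"
        unfolding N_def by (metis blinfun_apply_blinfun_compose)
      then show ?thesis by (simp add: P_id[OF v])
    qed
    have "norm (\<phi> (rank1 v g) - pairing L (rank1 v g)) \<le> 1 / (2 * D) * norm (rank1 v g)"
      by (intro L(2)) (unfold ops_def, rule image_eqI, rule r(1), rule r(2))
    also have "\<dots> \<le> 1 / (2 * D) * norm v"
      using D norm_rank1[of v g] mult_left_mono[OF ng norm_ge_zero[of v]] by (intro mult_left_mono) auto
    finally have "norm (\<phi> (rank1 v g) - pairing L (rank1 v g)) \<le> 1 / (2 * D) * norm v" .
    moreover have "\<phi> (rank1 v g) = of_real (inverse D) * blinfun_apply f v"
      using t[OF r(2)] by (simp add: \<phi>_def r(1) g_def P_id[OF v])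
    moreover have "pairing L (rank1 v g) = blinfun_apply f (blinfun_apply N v)"
      using pairing_rank1[OF lists_dual[OF L(1)] dual_if[OF g]] by (simp add: g_def PN flip: N_def)
    ultimately have "norm (of_real (inverse D) * blinfun_apply f v - blinfun_apply f (blinfun_apply N v))
        \<le> 1 / (2 * D) * norm v" by simp
    then have "D * norm (of_real (inverse D) * blinfun_apply f v - blinfun_apply f (blinfun_apply N v))
        \<le> D * (1 / (2 * D) * norm v)" using D by (intro mult_left_mono) auto
    moreover have "D * (1 / (2 * D) * norm v) = 1 / 2 * norm v" using D by simp
    ultimately have "norm (of_real D * (of_real (inverse D) * blinfun_apply f v - blinfun_apply f (blinfun_apply N v)))
        \<le> 1 / 2 * norm v" using D unfolding norm_mult by simp
    moreover have "of_real D * (of_real (inverse D) * blinfun_apply f v - blinfun_apply f (blinfun_apply N v))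
      = blinfun_apply f (v - D *\<^sub>R blinfun_apply N v)"
      using D by (simp add: blinfun.diff_right blinfun.scaleR_right scaleR_conv_of_real right_diff_distrib)
    ultimately show "norm (blinfun_apply f (v - D *\<^sub>R blinfun_apply N v)) \<le> 1 / 2 * norm v" by simp
  qed
  interpret N: module_hom smul smul "blinfun_apply N"
    by unfold_locales (auto simp: blinfun.add_right bounded_ops_smul[OF Nb])
  have span: "span V \<subseteq> closure U"
    using V(1) zero_in smul_in by (intro span_minimal subspaceI) (auto simp: closure_U_iff blinfun.add_right)
  \<comment> \<open>A vector \<open>v\<close> of \<open>closure U\<close> with
    \<open>N v = 0\<close> satisfies \<open>norm v \<le> norm v / 2\<close> by \<open>close\<close>.
    Hence \<open>N\<close> keeps \<open>V\<close> independent inside a finitely generated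
    span.\<close>
  have "inj_on (blinfun_apply N) (span V)"
  proof (rule inj_onI)
    fix v w assume vw: "v \<in> span V" "w \<in> span V" "blinfun_apply N v = blinfun_apply N w"
    then have "v - w \<in> closure U" using span span_diff by blast
    from close[OF this] show "v = w" using vw(3) by (simp add: blinfun.diff_right)
  qed
  then have ind: "independent (blinfun_apply N ` V)"
    by (rule N.independent_injective_image[OF V(2)])
  moreover have "blinfun_apply N ` V \<subseteq> span (fst ` set L)" unfolding N_def using op_of_range_span by blast
  ultimately have "finite (blinfun_apply N ` V)" using independent_span_bound[of "fst ` set L"] by blast
  moreover have "inj_on (blinfun_apply N) V"
    using \<open>inj_on _ (span V)\<close> span_superset by (rule inj_on_subset)
  ultimately show ?thesis by (rule finite_imageD)
qed

end

section \<open>The flip\<close>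

context normed_space_over
begin

lemma ex_infinite_independent:
  assumes "\<not> finite_dim smul"
  obtains V where "countable V" "infinite V" "independent V"
proof -
  obtain B where B: "independent B" "UNIV \<subseteq> span B"
    using maximal_independent_subset[of UNIV] by blast
  then have "infinite B" using assms by (auto simp: finite_dim_def top.extremum_unique)
  then obtain V where "countable V" "infinite V" "V \<subseteq> B" using infinite_countable_subset' by blast
  then show thesis using that independent_mono[OF B(1)] by blast
qed

lemma rank1_compact: "f \<in> dual smul \<Longrightarrow> rank1 u f \<in> compact_ops smul"
  using op_of_compact_ops[of "[(u, f)]"] by simp

lemma sum_compose_apply:
  "blinfun_apply (\<Sum>j<n. a j o\<^sub>L x o\<^sub>L b j) w = (\<Sum>j<n. blinfun_apply (a j) (blinfun_apply x (blinfun_apply (b j) w)))"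
  by (simp add: blinfun.sum_left)

text \<open>Expanding \<open>a j w\<close> along \<open>L\<close> as a sum of
  \<open>f (a j w)\<close> times \<open>u\<close> turns the entry into a sum of
  \<open>f (a j w) * g (b j (x u))\<close>, and these products are entries of the unflipped operator
  at \<open>rank1 w g\<close>. This serves for well-definedness of the flip and for its Lipschitz
  bound.\<close>

lemma flip_entry:
  assumes ab: "\<And>j. j < n \<Longrightarrow> b j \<in> bounded_ops smul" and x: "x \<in> bounded_ops smul"
    and g: "g \<in> dual smul" and a: "\<And>j. j < n \<Longrightarrow> a j \<in> bounded_ops smul"
    and L: "\<And>j. j < n \<Longrightarrow> blinfun_apply (op_of L) (blinfun_apply (a j) w) = blinfun_apply (a j) w"
      "set L \<subseteq> UNIV \<times> dual smul"
  shows "blinfun_apply g (blinfun_apply (\<Sum>j<n. b j o\<^sub>L x o\<^sub>L a j) w) =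
    pairing L ((\<Sum>j<n. a j o\<^sub>L rank1 w g o\<^sub>L b j) o\<^sub>L x)"
proof -
  have one: "blinfun_apply g (blinfun_apply (b j) (blinfun_apply x (blinfun_apply (op_of M) v)))
      = (\<Sum>(u, f)\<leftarrow>M. blinfun_apply f v * blinfun_apply g (blinfun_apply (b j) (blinfun_apply x u)))"
    if "j < n" for j M v
    by (induction M)
      (auto simp: blinfun.add_left blinfun.add_right blinfun.zero_right rank1_apply bounded_ops_smul[OF x]
        bounded_ops_smul[OF ab[OF that]] dual_smul[OF g])
  have "blinfun_apply g (blinfun_apply (\<Sum>j<n. b j o\<^sub>L x o\<^sub>L a j) w)
      = (\<Sum>j<n. \<Sum>(u, f)\<leftarrow>L. blinfun_apply f (blinfun_apply (a j) w) * blinfun_apply g (blinfun_apply (b j) (blinfun_apply x u)))"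
    unfolding sum_compose_apply blinfun.sum_right
    by (intro sum.cong refl, subst L(1)[symmetric]) (auto simp: one)
  also have "\<dots> = (\<Sum>(u, f)\<leftarrow>L. \<Sum>j<n. blinfun_apply f (blinfun_apply (a j) w) * blinfun_apply g (blinfun_apply (b j) (blinfun_apply x u)))"
    by (induction L) (auto simp: sum.distrib)
  also have "\<dots> = pairing L ((\<Sum>j<n. a j o\<^sub>L rank1 w g o\<^sub>L b j) o\<^sub>L x)"
    using L(2)
  proof (induction L)
    case (Cons p L)
    obtain u f where p: "p = (u, f)" by (cases p)
    have "blinfun_apply f (blinfun_apply (\<Sum>j<n. a j o\<^sub>L rank1 w g o\<^sub>L b j) (blinfun_apply x u))
      = (\<Sum>j<n. blinfun_apply f (blinfun_apply (a j) w) * blinfun_apply g (blinfun_apply (b j) (blinfun_apply x u)))"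
      unfolding sum_compose_apply blinfun.sum_right
      using Cons.prems p a by (intro sum.cong refl) (auto simp: rank1_apply bounded_ops_smul dual_smul mult.commute)
    then show ?case using Cons by (simp add: p)
  qed simp
  finally show ?thesis .
qed

end

section \<open>Well-definedness and continuity of the flip\<close>

locale operator_algebra = banach_over smul
  for smul :: "'k::real_or_complex \<Rightarrow> 'e::banach \<Rightarrow> 'e" +
  fixes A :: "('e \<Rightarrow>\<^sub>L 'e) set"
  assumes subalgebra: "subalgebra smul A" and compact_in: "compact_ops smul \<subseteq> A"
begin

lemma A_bounded: "x \<in> A \<Longrightarrow> x \<in> bounded_ops smul"
  using subalgebra by (auto simp: subalgebra_def)

lemma A_zero: "0 \<in> A"
  using subalgebra by (simp add: subalgebra_def)

lemma A_scaleR: "x \<in> A \<Longrightarrow> r *\<^sub>R x \<in> A"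
proof -
  assume "x \<in> A"
  then have "smul_op smul (of_real r) x \<in> A" using subalgebra by (simp add: subalgebra_def)
  moreover have "smul_op smul (of_real r) x = r *\<^sub>R x"
    by (intro blinfun_eqI) (simp add: smul_op_apply smul_of_real blinfun.scaleR_left)
  ultimately show ?thesis by simp
qed

lemma rank1_in: "f \<in> dual smul \<Longrightarrow> rank1 u f \<in> A"
  using rank1_compact compact_in by blast

lemma elem_op_apply: "x \<in> A \<Longrightarrow> elem_op A n a b x = (\<Sum>j<n. a j o\<^sub>L x o\<^sub>L b j)"
  by (simp add: elem_op_def)

text \<open>By \<open>flip_entry\<close> the entries of the flipped operator involve the
  coefficients only through values of the original one at rank one. A list fixing
  \<open>a j w\<close> and \<open>c j w\<close> together serves both representations.\<close>

lemma flip_unique: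
  assumes ab: "\<And>j. j < n \<Longrightarrow> a j \<in> A \<and> b j \<in> A" and cd: "\<And>j. j < m \<Longrightarrow> c j \<in> A \<and> d j \<in> A"
    and eq: "elem_op A n a b = elem_op A m c d"
  shows "elem_op A n b a = elem_op A m d c"
proof (rule extensionalityI[where A = A])
  fix x assume x: "x \<in> A"
  show "elem_op A n b a x = elem_op A m d c x"
    unfolding elem_op_apply[OF x]
  proof (intro blinfun_eqI eq_by_functionals)
    fix w g assume g: "g \<in> dual smul"
    define B where "B = (\<lambda>j. blinfun_apply (a j) w) ` {..<n} \<union> (\<lambda>j. blinfun_apply (c j) w) ` {..<m}"
    have "finite B" by (simp add: B_def)
    from ex_projection_onto_span[OF this] obtain L where
      L: "set L \<subseteq> span B \<times> dual smul" "\<And>v. v \<in> span B \<Longrightarrow> blinfun_apply (op_of L) v = v" by blast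
    have "blinfun_apply (op_of L) v = v" if "v \<in> B" for v using that L(2) by (simp add: span_base)
    moreover have "(\<Sum>j<n. a j o\<^sub>L rank1 w g o\<^sub>L b j) = (\<Sum>j<m. c j o\<^sub>L rank1 w g o\<^sub>L d j)"
      using fun_cong[OF eq, of "rank1 w g"] by (simp add: elem_op_apply rank1_in[OF g])
    moreover have "set L \<subseteq> UNIV \<times> dual smul" using L(1) by auto
    ultimately show "blinfun_apply g (blinfun_apply (\<Sum>j<n. b j o\<^sub>L x o\<^sub>L a j) w)
        = blinfun_apply g (blinfun_apply (\<Sum>j<m. d j o\<^sub>L x o\<^sub>L c j) w)"
      using ab cd x g by (subst (1 2) flip_entry[where L = L]) (auto simp: A_bounded B_def)
  qed
qed (auto simp: elem_op_def)

lemma El_flip_elem_op: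
  assumes ab: "\<And>j. j < n \<Longrightarrow> a j \<in> A \<and> b j \<in> A"
  shows "El_flip A (elem_op A n a b) = elem_op A n b a"
  unfolding El_flip_def
proof (rule the_equality)
  show "\<exists>n' a' b'. (\<forall>j<n'. a' j \<in> A \<and> b' j \<in> A) \<and> elem_op A n a b = elem_op A n' a' b' \<and> elem_op A n b a = elem_op A n' b' a'"
    using ab by blast
  fix S assume "\<exists>n' a' b'. (\<forall>j<n'. a' j \<in> A \<and> b' j \<in> A) \<and> elem_op A n a b = elem_op A n' a' b' \<and> S = elem_op A n' b' a'"
  then show "S = elem_op A n b a" using flip_unique[of n a b] ab by metis
qed

lemma elem_op_in: "(\<And>j. j < n \<Longrightarrow> a j \<in> A \<and> b j \<in> A) \<Longrightarrow> elem_op A n a b \<in> El A"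
  unfolding El_def by blast

lemma El_flip_in: "T \<in> El A \<Longrightarrow> El_flip A T \<in> El A"
  unfolding El_def using El_flip_elem_op by force

lemma El_dist_upper:
  assumes "S \<in> El A" "T \<in> El A" "x \<in> A" "norm x \<le> 1"
  shows "norm (S x - T x) \<le> El_dist A S T"
proof -
  obtain C where C: "\<And>x. x \<in> A \<inter> cball 0 1 \<Longrightarrow> norm (S x) \<le> C" using El_bounded[OF assms(1)] by blast
  obtain D where D: "\<And>x. x \<in> A \<inter> cball 0 1 \<Longrightarrow> norm (T x) \<le> D" using El_bounded[OF assms(2)] by blast
  have "bdd_above ((\<lambda>x. norm (S x - T x)) ` (A \<inter> cball 0 1))"
    using C D by (intro bdd_aboveI2[where M = "C + D"]) (meson add_mono norm_triangle_le_diff)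
  then show ?thesis
    using assms by (auto simp: El_dist_def El_norm_def intro!: cSUP_upper)
qed

lemma El_dist_least:
  assumes "S \<in> El A" "T \<in> El A" "\<And>x. x \<in> A \<Longrightarrow> norm x \<le> 1 \<Longrightarrow> norm (S x - T x) \<le> C"
  shows "El_dist A S T \<le> C"
proof -
  have "0 \<in> A \<inter> cball 0 1" using A_zero by simp
  then show ?thesis
    using assms by (auto simp: El_dist_def El_norm_def intro!: cSUP_least)
qed

lemma El_continuous_map_iff:
  "continuous_map (El_topology A) (El_topology A) (El_flip A) \<longleftrightarrow>
    (\<forall>S\<in>El A. \<forall>e>0. \<exists>d>0. \<forall>T. T \<in> El A \<and> El_dist A S T < d \<longrightarrow> El_dist A (El_flip A S) (El_flip A T) < e)"
proof -
  interpret Metric_space "El A" "El_dist A"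
    using normed_space_over_axioms subalgebra by (rule Metric_space_El)
  show ?thesis
    unfolding El_topology_def metric_continuous_map[OF Metric_space_axioms]
    using El_flip_in by blast
qed

text \<open>As \<open>op_of L\<close> is the identity, one list serves all \<open>T\<close>,
  \<open>x\<close> and \<open>w\<close>, which makes the resulting estimate uniform.\<close>

lemma flip_entry_finite_dim:
  assumes L: "op_of L = id_blinfun" "set L \<subseteq> UNIV \<times> dual smul"
    and T: "T \<in> El A" and x: "x \<in> A" and g: "g \<in> dual smul"
  shows "blinfun_apply g (blinfun_apply (El_flip A T x) w) = pairing L (T (rank1 w g) o\<^sub>L x)"
proof -
  obtain n a b where ab: "T = elem_op A n a b" "\<And>j. j < n \<Longrightarrow> a j \<in> A \<and> b j \<in> A"
    using T unfolding El_def by blast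
  have "El_flip A T = elem_op A n b a" unfolding ab(1) by (rule El_flip_elem_op) (rule ab(2))
  then show ?thesis
    unfolding ab(1) elem_op_apply[OF rank1_in[OF g]]
    using L ab(2) x g by (simp only: elem_op_apply[OF x]) (intro flip_entry; auto simp: A_bounded)
qed

lemma flip_continuous_if_finite_dim:
  assumes "finite_dim smul"
  shows "continuous_map (El_topology A) (El_topology A) (El_flip A)"
proof -
  obtain B where B: "finite B" "span B = UNIV" using assms by (auto simp: finite_dim_def)
  obtain L where L': "set L \<subseteq> span B \<times> dual smul" "\<And>v. v \<in> span B \<Longrightarrow> blinfun_apply (op_of L) v = v"
    using ex_projection_onto_span[OF B(1)] by blast
  then have L: "op_of L = id_blinfun" "set L \<subseteq> UNIV \<times> dual smul"
    using B(2) by (auto intro!: blinfun_eqI)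
  define M where "M = (\<Sum>(u, f)\<leftarrow>L. norm f * norm u)"
  have M: "0 \<le> M" unfolding M_def by (intro sum_list_nonneg) auto
  have lip: "El_dist A (El_flip A S) (El_flip A T) \<le> M * El_dist A S T" if ST: "S \<in> El A" "T \<in> El A" for S T
  proof (rule El_dist_least)
    fix x assume x: "x \<in> A" "norm x \<le> 1"
    show "norm (El_flip A S x - El_flip A T x) \<le> M * El_dist A S T"
    proof (rule norm_blinfun_le, rule norm_le_by_functionals)
      fix w :: 'e and g assume w: "norm w \<le> 1" and g: "g \<in> dual smul" "norm g \<le> 1"
      define Y where "Y = S (rank1 w g) - T (rank1 w g)"
      have "norm (rank1 w g) \<le> 1"
        using norm_rank1[of w g] w g(2) mult_le_one[of "norm w" "norm g"] by simp
      then have Y: "norm Y \<le> El_dist A S T"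
        unfolding Y_def by (intro El_dist_upper ST rank1_in g(1))
      have "blinfun_apply g (blinfun_apply (El_flip A S x - El_flip A T x) w)
          = pairing L (S (rank1 w g) o\<^sub>L x) - pairing L (T (rank1 w g) o\<^sub>L x)"
        by (simp add: blinfun.diff_left blinfun.diff_right flip_entry_finite_dim[OF L _ x(1) g(1)] ST)
      also have "\<dots> = pairing L (Y o\<^sub>L x)"
      proof -
        have "S (rank1 w g) o\<^sub>L x = (Y o\<^sub>L x) + (T (rank1 w g) o\<^sub>L x)"
          by (intro blinfun_eqI) (simp add: Y_def blinfun.add_left blinfun.diff_left)
        then show ?thesis by (simp add: pairing_add)
      qed
      finally have eq: "blinfun_apply g (blinfun_apply (El_flip A S x - El_flip A T x) w) = pairing L (Y o\<^sub>L x)" .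
      have "norm (Y o\<^sub>L x) \<le> norm Y * norm x" by (rule norm_blinfun_compose)
      also have "\<dots> \<le> El_dist A S T * 1" using Y x(2) order_trans[OF norm_ge_zero Y] by (intro mult_mono) auto
      finally have Yx: "norm (Y o\<^sub>L x) \<le> El_dist A S T" by simp
      have "norm (pairing L (Y o\<^sub>L x)) \<le> (\<Sum>(u, f)\<leftarrow>L. norm (Y o\<^sub>L x) * (norm f * norm u))"
      proof (induction L)
        case (Cons p L)
        obtain u f where p: "p = (u, f)" by (cases p)
        have "norm (blinfun_apply f (blinfun_apply (Y o\<^sub>L x) u)) \<le> norm f * (norm (Y o\<^sub>L x) * norm u)"
          by (intro order_trans[OF norm_blinfun] mult_left_mono norm_blinfun) auto
        then show ?case using Cons unfolding p
          by (simp add: mult_ac) (intro norm_triangle_le add_mono; simp add: mult_ac)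
      qed simp
      also have "\<dots> = norm (Y o\<^sub>L x) * M" by (simp add: M_def case_prod_unfold sum_list_const_mult)
      also have "\<dots> \<le> M * El_dist A S T" using Yx M by (simp add: mult.commute mult_left_mono)
      finally show "norm (blinfun_apply g (blinfun_apply (El_flip A S x - El_flip A T x) w)) \<le> M * El_dist A S T"
        unfolding eq .
    qed
  qed (use ST El_flip_in in auto)
  show ?thesis
    unfolding El_continuous_map_iff
  proof (intro ballI allI impI)
    fix S and e :: real assume S: "S \<in> El A" and e: "0 < e"
    have "El_dist A (El_flip A S) (El_flip A T) < e" if T: "T \<in> El A" "El_dist A S T < e / (M + 1)" for T
    proof -
      have "El_dist A (El_flip A S) (El_flip A T) \<le> M * El_dist A S T" by (rule lip[OF S T(1)])
      also have "\<dots> \<le> M * (e / (M + 1))" using T(2) M by (intro mult_left_mono) auto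
      also have "\<dots> < e" using M e by (simp add: field_simps)
      finally show ?thesis .
    qed
    then show "\<exists>d>0. \<forall>T. T \<in> El A \<and> El_dist A S T < d \<longrightarrow> El_dist A (El_flip A S) (El_flip A T) < e"
      using M e by (intro exI[of _ "e / (M + 1)"]) auto
  qed
qed

text \<open>
  The elementary operator with coefficients \<open>u\<^sub>j \<otimes> f\<^sub>0\<close> and \<open>e \<otimes> f\<^sub>j\<close> maps \<open>x\<close> to
  \<open>f\<^sub>0 (x e)\<close> times \<open>\<Sum>u\<^sub>j \<otimes> f\<^sub>j\<close>, its flip maps \<open>x\<close> to the pairing times \<open>e \<otimes> f\<^sub>0\<close>.
\<close>

lemma pairing_bound_if_flip_continuous:
  assumes cont: "continuous_map (El_topology A) (El_topology A) (El_flip A)" and E: "v \<noteq> (0 :: 'e)"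
  obtains C where "0 \<le> C"
    "\<And>L x. set L \<subseteq> UNIV \<times> dual smul \<Longrightarrow> x \<in> A \<Longrightarrow> norm (pairing L x) \<le> C * norm (op_of L) * norm x"
proof -
  define e where "e = inverse (norm v) *\<^sub>R v"
  have e: "norm e = 1" using E by (simp add: e_def)
  obtain f0 where f0: "f0 \<in> dual smul" "norm f0 \<le> 1" "blinfun_apply f0 e = 1"
    using norming_functional[of e] e by auto
  \<comment> \<open>The zero operator as an empty sum, which is its own flip; continuity is
    exploited at this point.\<close>
  define T0 where "T0 = elem_op A 0 (\<lambda>_. 0) (\<lambda>_. 0)"
  have T0: "T0 \<in> El A" "El_flip A T0 = T0" "\<And>x. x \<in> A \<Longrightarrow> T0 x = 0"
    using El_flip_elem_op[of 0 "\<lambda>_. 0" "\<lambda>_. 0"] elem_op_in[of 0 "\<lambda>_. 0" "\<lambda>_. 0"]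
    by (auto simp: T0_def elem_op_def)
  obtain d where d: "0 < d" "\<And>T. T \<in> El A \<Longrightarrow> El_dist A T0 T < d \<Longrightarrow> El_dist A T0 (El_flip A T) < 1"
    using cont[unfolded El_continuous_map_iff, rule_format, OF T0(1) zero_less_one] T0(2) by auto
  have unit: "norm (pairing L x) \<le> 2 / d * norm (op_of L)"
    if L: "set L \<subseteq> UNIV \<times> dual smul" and x: "x \<in> A" "norm x \<le> 1" for L x
  proof (rule field_le_epsilon)
    fix \<eta> :: real assume \<eta>: "0 < \<eta>"
    \<comment> \<open>The summand keeps \<open>N\<close> positive if \<open>op_of L\<close> is zero,
      and its size gives \<open>1 / r = 2 / d * norm (op_of L) + \<eta>\<close>.\<close>
    define N where "N = norm (op_of L) + \<eta> * d / 2"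
    have N: "0 < N" "norm (op_of L) < N" using \<eta> d(1) by (auto simp: N_def intro!: add_nonneg_pos)
    define r where "r = d / (2 * N)"
    have r: "0 < r" "r * norm (op_of L) < d"
    proof -
      show "0 < r" using d(1) N by (simp add: r_def)
      then have "r * norm (op_of L) \<le> r * N" using N by (intro mult_left_mono) auto
      also have "\<dots> = d / 2" using N by (simp add: r_def)
      finally show "r * norm (op_of L) < d" using d(1) by simp
    qed
    \<comment> \<open>The factor \<open>r\<close> sits in the coefficients, so the flip of the
      scaled operator is read off directly.\<close>
    define a where "a j = rank1 (r *\<^sub>R fst (L ! j)) f0" for j
    define b where "b j = rank1 e (snd (L ! j))" for j
    define n where "n = length L"
    have Lj: "snd (L ! j) \<in> dual smul" if "j < n" for j
    proof -
      have "L ! j \<in> UNIV \<times> dual smul" using subsetD[OF L nth_mem] that by (simp add: n_def)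
      then show ?thesis by (simp add: mem_Times_iff)
    qed
    have ab: "a j \<in> A \<and> b j \<in> A" if "j < n" for j
      using Lj[OF that] f0(1) by (simp add: a_def b_def rank1_in)
    define S where "S = elem_op A n a b"
    have S: "S \<in> El A" unfolding S_def using ab by (rule elem_op_in)
    have sum_nth: "(\<Sum>j<n. h (fst (L ! j)) (snd (L ! j))) = (\<Sum>(u, f)\<leftarrow>L. h u f)" for h :: "'e \<Rightarrow> ('e \<Rightarrow>\<^sub>L 'k) \<Rightarrow> 'c::comm_monoid_add"
      by (simp add: sum_list_sum_nth n_def atLeast0LessThan case_prod_unfold)
    have opL: "blinfun_apply (op_of L) w = (\<Sum>(u, f)\<leftarrow>L. smul (blinfun_apply f w) u)" for w
      by (induction L) (auto simp: blinfun.add_left rank1_apply)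
    have Sx: "S y = smul_op smul (of_real r * blinfun_apply f0 (blinfun_apply y e)) (op_of L)" if y: "y \<in> A" for y
    proof (rule blinfun_eqI)
      fix w
      have yb: "y \<in> bounded_ops smul" using y by (rule A_bounded)
      let ?c = "of_real r * blinfun_apply f0 (blinfun_apply y e)"
      have "blinfun_apply (S y) w = (\<Sum>j<n. smul ?c (smul (blinfun_apply (snd (L ! j)) w) (fst (L ! j))))"
        unfolding S_def elem_op_apply[OF y] sum_compose_apply
        by (intro sum.cong refl)
          (simp add: a_def b_def rank1_apply bounded_ops_smul[OF yb] dual_smul[OF f0(1)] mult_ac flip: smul_of_real)
      also have "\<dots> = smul ?c (\<Sum>(u, f)\<leftarrow>L. smul (blinfun_apply f w) u)"
        by (simp add: scale_sum_right flip: sum_nth)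
      finally show "blinfun_apply (S y) w = blinfun_apply (smul_op smul ?c (op_of L)) w"
        by (simp add: smul_op_apply opL)
    qed
    have "El_dist A T0 S \<le> r * norm (op_of L)"
    proof (rule El_dist_least[OF T0(1) S])
      fix y assume y: "y \<in> A" "norm y \<le> 1"
      have ye: "norm (blinfun_apply y e) \<le> 1" using norm_blinfun[of y e] e y(2) by simp
      have "norm (blinfun_apply f0 (blinfun_apply y e)) \<le> norm f0 * norm (blinfun_apply y e)" by (rule norm_blinfun)
      also have "\<dots> \<le> 1" using ye f0(2) by (simp add: mult_le_one)
      finally have f: "norm (blinfun_apply f0 (blinfun_apply y e)) \<le> 1" .
      have "norm (T0 y - S y) = norm (S y)" by (simp add: T0(3)[OF y(1)])
      also have "\<dots> \<le> r * norm (op_of L)"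
        unfolding Sx[OF y(1)]
      proof (rule norm_blinfun_bound)
        fix w
        have "norm (smul (of_real r * blinfun_apply f0 (blinfun_apply y e)) (blinfun_apply (op_of L) w))
          = r * (norm (blinfun_apply f0 (blinfun_apply y e)) * norm (blinfun_apply (op_of L) w))"
          using r(1) by (simp add: norm_smul norm_mult)
        also have "\<dots> \<le> r * (1 * (norm (op_of L) * norm w))"
          using r(1) f by (intro mult_left_mono mult_mono norm_blinfun) auto
        finally show "norm (blinfun_apply (smul_op smul (of_real r * blinfun_apply f0 (blinfun_apply y e)) (op_of L)) w)
          \<le> r * norm (op_of L) * norm w" by (simp add: smul_op_apply)
      qed (use r(1) in simp)
      finally show "norm (T0 y - S y) \<le> r * norm (op_of L)" .
    qed
    then have "El_dist A T0 (El_flip A S) < 1" using r(2) by (intro d(2) S) simp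
    then have "norm (T0 x - El_flip A S x) \<le> 1"
      using El_dist_upper[OF T0(1) El_flip_in[OF S] x] by simp
    then have 1: "norm (El_flip A S x) \<le> 1" by (simp add: T0(3)[OF x(1)])
    have xb: "x \<in> bounded_ops smul" using x(1) by (rule A_bounded)
    have fl: "El_flip A S = elem_op A n b a" unfolding S_def by (rule El_flip_elem_op) (rule ab)
    have "blinfun_apply (El_flip A S x) e = (\<Sum>j<n. smul (of_real r * blinfun_apply (snd (L ! j)) (blinfun_apply x (fst (L ! j)))) e)"
      unfolding fl elem_op_apply[OF x(1)] sum_compose_apply
      by (intro sum.cong refl)
        (simp add: a_def b_def rank1_apply f0(3) blinfun.scaleR_right scaleR_conv_of_real smul_of_real
          flip: scale_scale)
    also have "\<dots> = smul (of_real r * pairing L x) e"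
      by (simp add: pairing_def sum_distrib_left flip: scale_sum_left sum_nth)
    finally have "norm (blinfun_apply (El_flip A S x) e) = r * norm (pairing L x)"
      using r(1) e by (simp add: norm_smul norm_mult)
    moreover have "norm (blinfun_apply (El_flip A S x) e) \<le> 1"
      using norm_blinfun[of "El_flip A S x" e] 1 e by simp
    ultimately have "norm (pairing L x) \<le> 1 / r" using r(1) by (simp add: field_simps)
    also have "\<dots> = 2 / d * norm (op_of L) + \<eta>" using d(1) N(1) by (simp add: r_def N_def field_simps)
    finally show "norm (pairing L x) \<le> 2 / d * norm (op_of L) + \<eta>" .
  qed
  show thesis
  proof (rule that)
    show "0 \<le> 2 / d" using d(1) by simp
    fix L :: "('e \<times> ('e \<Rightarrow>\<^sub>L 'k)) list" and x
    assume L: "set L \<subseteq> UNIV \<times> dual smul" and x: "x \<in> A"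
    show "norm (pairing L x) \<le> 2 / d * norm (op_of L) * norm x"
    proof (cases "x = 0")
      case True
      then show ?thesis using pairing_scaleR[of L 0 0] by simp
    next
      case False
      have "norm (pairing L (inverse (norm x) *\<^sub>R x)) \<le> 2 / d * norm (op_of L)"
        using False A_scaleR[OF x] by (intro unit[OF L]) auto
      then show ?thesis using False by (simp add: pairing_scaleR field_simps)
    qed
  qed
qed

text \<open>A countable infinite independent set is placed inside a separable complemented subspace,
  where the bound obtained from the flip forces it to be finite.\<close>

lemma finite_dim_if_flip_continuous:
  assumes refl: "reflexive_space smul" and AP: "approximation_property smul"
    and cont: "continuous_map (El_topology A) (El_topology A) (El_flip A)"
  shows "finite_dim smul"
proof (rule ccontr)
  assume "\<not> finite_dim smul"
  then obtain V where V: "countable V" "infinite V" "independent V" by (rule ex_infinite_independent)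
  obtain v where v: "v \<in> V" using V(2) by (metis ex_in_conv finite.emptyI)
  have "v \<noteq> 0" using V(3) v dependent_zero by blast
  obtain C where C: "\<And>L x. set L \<subseteq> UNIV \<times> dual smul \<Longrightarrow> x \<in> A \<Longrightarrow> norm (pairing L x) \<le> C * norm (op_of L) * norm x"
    using pairing_bound_if_flip_continuous[OF cont \<open>v \<noteq> 0\<close>] by blast
  obtain U G P where UGP: "countable U" "countable G" "V \<subseteq> U" "G \<subseteq> dual smul"
    "P \<in> bounded_ops smul" "norm P \<le> 1"
    "\<And>x. blinfun_apply P x \<in> closure U" "\<And>x. x \<in> closure U \<Longrightarrow> blinfun_apply P x = x"
    "\<And>f. f \<in> dual smul \<Longrightarrow> f o\<^sub>L P \<in> closure G" "\<And>f. f \<in> closure G \<Longrightarrow> f o\<^sub>L P = f"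
    using ex_separable_projection[OF refl V(1)] by blast
  interpret separable_projection smul U G P
    by unfold_locales (use refl UGP in auto)
  have "finite V"
  proof (rule finite_independent[OF AP _ _ V(3)])
    show "norm (pairing L x) \<le> C * norm (op_of L) * norm x" if "L \<in> lists" "x \<in> ops" for L x
    proof (rule C[OF lists_dual[OF that(1)]])
      show "x \<in> A" using that(2) op_of_compact_ops lists_dual compact_in by (auto simp: ops_def)
    qed
    show "V \<subseteq> closure U" using UGP(3) closure_subset[of U] by blast
  qed
  then show False using V(2) by simp
qed

end

theorem corollary1p2:
  fixes smul :: "'k::real_or_complex \<Rightarrow> 'e::banach \<Rightarrow> 'e"
    and A :: "('e \<Rightarrow>\<^sub>L 'e) set"
  assumes "normed_space_over smul"
    and "reflexive_space smul"
    and "approximation_property smul"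
    and "subalgebra smul A"
    and "closed A"
    and "compact_ops smul \<subseteq> A"
  shows "continuous_map (El_topology A) (El_topology A) (El_flip A) \<longleftrightarrow> finite_dim smul"
proof -
  interpret normed_space_over smul by fact
  interpret operator_algebra smul A by unfold_locales (use assms in auto)
  show ?thesis
    using finite_dim_if_flip_continuous[OF assms(2,3)] flip_continuous_if_finite_dim by blast
qed

end
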